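(* Let $m\ge2$ be an integer and let $g:[0,2\pi]\to\mathbb{R}$ be continuous, strictly concave, three times continuously differentiable in a neighborhood of $\frac{2\pi}{m}$, with $g''\left(\frac{2\pi}{m}\right)\ne0$. Let $f:(S^1)^m\to\mathbb{R}$ be the side-type kernel generated by $g$ (see context). Let $U_1,U_2,\dots$ be independent points on $S^1$ with a common continuous density $p(x)$ such that $\int_0^{2\pi}\prod_{l=0}^{m-1}p\left(x+\frac{2\pi l}{m}\right)dx>0$, and for $n\ge m$ let $H_n=\max_{1\le i_1<\dots<i_m\le n}f(U_{i_1},\dots,U_{i_m})$. Then for every $t>0$ $$\lim_{n\to\infty}\mathbb{P}\left\{n^{\frac{2m}{m-1}}\left(m\,g\left(\tfrac{2\pi}{m}\right)-H_n\right)\le t\right\}=1-\exp\left(-\frac{t^{\frac{m-1}{2}}K}{m}\right),$$ where $$K=\frac{(2\pi)^{\frac{m-1}{2}}\left[\int_0^{2\pi}\prod_{l=0}^{m-1}p\left(x+\frac{2\pi l}{m}\right)dx\right]}{\left(-g''\left(\frac{2\pi}{m}\right)\right)^{\frac{m-1}{2}}\Gamma\left(\frac{m+1}{2}\right)\sqrt{m}}.$$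
   Context: $S^1$ is the unit circle with center $O$; points are identified with polar angles modulo $2\pi$, and a density $p$ on $S^1$ is regarded as a $2\pi$-periodic non-negative function on $\mathbb{R}$ with $\int_0^{2\pi}p(x)\,dx=1$. Side-type kernel generated by $g$: for $U_1,\dots,U_m\in S^1$ let $\beta_i\in[0,2\pi)$ be the counterclockwise angle from $OU_1$ to $OU_{i+1}$, $i=1,\dots,m-1$. If $0=\beta_0\le\beta_1\le\dots\le\beta_{m-1}\le\beta_m=2\pi$, put $$f(U_1,\dots,U_m)=h(\beta_1,\dots,\beta_{m-1})=\sum_{i=1}^m g(\beta_i-\beta_{i-1}),$$ and extend $h$ to all of $[0,2\pi]^{m-1}$ as a symmetric function (so $f$ is the sum of $g$ over the $m$ angles between cyclically neighboring vectors $OU_j$, for the points in counterclockwise order). *)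

theory Defs
  imports "HOL-Probability.Probability"
begin

definition strictly_concave_on :: "real set \<Rightarrow> (real \<Rightarrow> real) \<Rightarrow> bool" where
  "strictly_concave_on S g \<longleftrightarrow> convex S \<and>
     (\<forall>x\<in>S. \<forall>y\<in>S. \<forall>t. x \<noteq> y \<and> 0 < t \<and> t < 1 \<longrightarrow>
        g ((1 - t) * x + t * y) > (1 - t) * g x + t * g y)"

definition C_k_on :: "nat \<Rightarrow> (real \<Rightarrow> real) \<Rightarrow> real set \<Rightarrow> bool" where
  "C_k_on k g N \<longleftrightarrow> open N \<and>
     (\<forall>j<k. \<forall>x\<in>N. (deriv ^^ j) g field_differentiable (at x)) \<and>
     continuous_on N ((deriv ^^ k) g)"

text \<open>The unit circle with its arc length measure (total mass \<open>2 * pi\<close>). A point of the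
  circle is a complex number of norm 1, with polar angle \<^const>\<open>Arg2pi\<close> in \<open>[0, 2 * pi)\<close>.\<close>

definition circle_measure :: "complex measure" where
  "circle_measure =
     distr (restrict_space lborel {0..<2*pi}) (restrict_space borel (sphere 0 1)) cis"

lemma space_circle_measure [simp]: "space circle_measure = sphere 0 1"
  by (simp add: circle_measure_def space_restrict_space)

lemma cis_measurable_circle:
  "cis \<in> measurable (restrict_space lborel {0..<2*pi}) (restrict_space borel (sphere 0 1))"
proof (rule measurable_restrict_space3)
  show "cis \<in> measurable lborel borel"
    by (simp add: borel_measurable_continuous_onI continuous_on_cis)
qed auto

lemma emeasure_circle_measure: "emeasure circle_measure (sphere 0 1) = ennreal (2*pi)"
proof -
  have "cis -` sphere 0 1 \<inter> space (restrict_space lborel {0..<2*pi}) = {0..<2*pi}"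
    by (auto simp: space_restrict_space)
  then show ?thesis
    unfolding circle_measure_def
    by (subst emeasure_distr[OF cis_measurable_circle])
       (auto simp: sets_restrict_space emeasure_restrict_space)
qed

text \<open>The counterclockwise angle from \<open>O u\<close> to \<open>O v\<close>, in \<open>[0, 2 * pi)\<close>.\<close>

definition ccw_angle :: "complex \<Rightarrow> complex \<Rightarrow> real" where
  "ccw_angle u v = Arg2pi (v / u)"

text \<open>The function \<open>h\<close> of \<open>m - 1\<close> angles (given as a list); sorting the list is what extends
  it symmetrically from increasing angles.\<close>

definition side_h :: "(real \<Rightarrow> real) \<Rightarrow> real list \<Rightarrow> real" where
  "side_h g bs = (let cs = 0 # sort bs @ [2*pi]
                  in \<Sum>i=1..length bs + 1. g (cs ! i - cs ! (i - 1)))"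

text \<open>The side-type kernel generated by \<open>g\<close>, applied to the list \<open>[U_1, ..., U_m]\<close>.\<close>

definition side_kernel :: "(real \<Rightarrow> real) \<Rightarrow> complex list \<Rightarrow> real" where
  "side_kernel g us = side_h g (map (ccw_angle (hd us)) (tl us))"

text \<open>The maximum of a kernel of \<open>m\<close> arguments over all subsequences of \<open>u 1, ..., u n\<close>
  of length \<open>m\<close>; it is meaningful only for \<open>n \<ge> m\<close>, where the set of indices is nonempty.\<close>

definition U_max :: "(complex list \<Rightarrow> real) \<Rightarrow> nat \<Rightarrow> nat \<Rightarrow> (nat \<Rightarrow> complex) \<Rightarrow> real" where
  "U_max f m n u =
     Max ((\<lambda>is. f (map u is)) ` {is. length is = m \<and> sorted_wrt (<) is \<and> set is \<subseteq> {1..n}})"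

end

theory Submission
  imports Defs
begin

text \<open>
  Let \<open>\<mu> = 2 * pi / m\<close>. The deficit \<open>m * g \<mu> - f\<close> of \<open>m\<close> points whose consecutive gaps are
  \<open>d\<^sub>1, \<dots>, d\<^sub>m\<close> is the sum of the distances of \<open>g\<close> from its tangent at \<open>\<mu>\<close>, because the gaps add up
  to \<open>m * \<mu>\<close>. Hence it is bounded below by a multiple of the sum of the \<open>(d\<^sub>j - \<mu>)\<^sup>2\<close>, and it is
  asymptotically \<open>- g'' \<mu> / 2\<close> times that sum. So a deficit at most \<open>t * \<sigma>\<^sup>2\<close> means that the points
  lie within distance \<open>O(\<sigma>)\<close> of a regular polygon, with offsets in an ellipsoid of dimension
  \<open>m - 1\<close>; dominated convergence gives the probability of this event up to \<open>o(\<sigma> ^ (m - 1))\<close>.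

  With \<open>\<sigma> ^ (m - 1) = n powr - m\<close>, the number of \<open>m\<close>-subsets of the sample that form such a polygon has
  bounded mean. Two subsets that share a point lie around one common regular polygon, so all \<open>a\<close>
  points of their union are, up to \<open>O(\<sigma>)\<close>, determined by one of them; this has probability
  \<open>O(\<sigma> ^ (a - 1))\<close>, which is \<open>o(n powr - a)\<close> for \<open>a > m\<close>. The Chen--Stein bound for dissociated
  events then yields the Poisson limit of the probability that no subset qualifies.
\<close>

section \<open>Quadratic behaviour of a concave function at a point\<close>

text \<open>Two facts about g act in different places. The Taylor limit c at \<mu> is local: it
  fixes the limiting ellipsoid but says nothing about configurations far from regular. The bound
  with \<kappa> holds on the whole interval: it confines all relevant configurations to distance
  O(\<sigma>), which supplies both the dominating functions and the clustering of overlapping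
  polygons. Its value does not enter the limit.

  The scale is forced by the mean. There are about n^m / m! subsets; with one vertex fixed each has
  (m - 1)! orderings, and each ordering has probability of order \<sigma>^(m - 1). Hence \<sigma> =
  n powr (- m / (m - 1)), and the factor 1 / m in the exponent. Unions of a points contribute n^a *
  \<sigma>^(a - 1) = n powr ((m - a) / (m - 1)), which tends to 0 precisely for a > m.

  The kernel is invariant under rotation, so the set where it is nearly maximal is thin in only m -
  1 of the m directions. One vertex keeps a free angle \<theta>, the others become relative angles;
  integrating the product of the densities over \<theta> yields the integral in K.\<close>

lemma second_order_taylor_quotient:
  fixes g :: "real \<Rightarrow> real"
  assumes "C_k_on 3 g N" "\<mu> \<in> N"
  shows "((\<lambda>h. (g \<mu> + deriv g \<mu> * h - g (\<mu> + h)) / h\<^sup>2) \<longlongrightarrow> - (deriv ^^ 2) g \<mu> / 2) (at 0)"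
proof -
  have N: "open N" "\<And>x. x \<in> N \<Longrightarrow> g field_differentiable at x"
    "\<And>x. x \<in> N \<Longrightarrow> deriv g field_differentiable at x"
    using assms(1) unfolding C_k_on_def by (auto dest: spec[of _ 0] spec[of _ 1])
  have g': "(g has_real_derivative deriv g x) (at x)" if "x \<in> N" for x
    using N(2)[OF that] by (simp add: field_differentiable_derivI)
  have g'': "(deriv g has_real_derivative (deriv ^^ 2) g \<mu>) (at \<mu>)"
    using N(3)[OF assms(2)] by (simp add: field_differentiable_derivI numeral_2_eq_2)
  have ev: "eventually (\<lambda>h. \<mu> + h \<in> N) (at 0)"
  proof -
    have "((\<lambda>h. \<mu> + h) \<longlongrightarrow> \<mu> + 0) (at 0)" by (intro tendsto_intros)
    then show ?thesis using N(1) assms(2) topological_tendstoD by force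
  qed
  show ?thesis
  proof (rule lhopital[where f' = "\<lambda>h. deriv g \<mu> - deriv g (\<mu> + h)" and g' = "\<lambda>h. 2 * h"])
    have "isCont g \<mu>" using g'[OF assms(2)] by (rule DERIV_isCont)
    then have "((\<lambda>h. g (\<mu> + h)) \<longlongrightarrow> g \<mu>) (at 0)" by (simp add: isCont_iff)
    then have "((\<lambda>h. g \<mu> + deriv g \<mu> * h - g (\<mu> + h)) \<longlongrightarrow> g \<mu> + deriv g \<mu> * 0 - g \<mu>) (at 0)"
      by (intro tendsto_intros)
    then show "((\<lambda>h. g \<mu> + deriv g \<mu> * h - g (\<mu> + h)) \<longlongrightarrow> 0) (at 0)" by simp
    have "((\<lambda>h::real. h\<^sup>2) \<longlongrightarrow> 0\<^sup>2) (at 0)" by (intro tendsto_intros)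
    then show "((\<lambda>h::real. h\<^sup>2) \<longlongrightarrow> 0) (at 0)" by simp
    show "eventually (\<lambda>h::real. h\<^sup>2 \<noteq> 0) (at 0)" "eventually (\<lambda>h::real. 2 * h \<noteq> 0) (at 0)"
      by (auto simp: eventually_at_filter)
    show "eventually (\<lambda>h. ((\<lambda>h. h\<^sup>2) has_real_derivative 2 * h) (at h)) (at 0)"
      by (auto intro!: always_eventually derivative_eq_intros)
    show "eventually (\<lambda>h. ((\<lambda>h. g \<mu> + deriv g \<mu> * h - g (\<mu> + h)) has_real_derivative
            deriv g \<mu> - deriv g (\<mu> + h)) (at h)) (at 0)"
      using ev
    proof eventually_elim
      case (elim h)
      have "((\<lambda>h. g (\<mu> + h)) has_real_derivative deriv g (\<mu> + h)) (at h)"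
        using g'[OF elim] DERIV_shift[of g "deriv g (\<mu> + h)" h \<mu>] by (simp add: add.commute)
      then show ?case by (auto intro!: derivative_eq_intros)
    qed
    \<comment> \<open>After one application of l'Hopital the quotient is, up to the factor -1/2, the
      difference quotient of \<open>deriv g\<close> at \<mu>.\<close>
    have "((\<lambda>h. (deriv g (\<mu> + h) - deriv g \<mu>) / h) \<longlongrightarrow> (deriv ^^ 2) g \<mu>) (at 0)"
      using g'' by (simp add: DERIV_def)
    then have "((\<lambda>h. - ((deriv g (\<mu> + h) - deriv g \<mu>) / h) / 2) \<longlongrightarrow> - (deriv ^^ 2) g \<mu> / 2) (at 0)"
      by (intro tendsto_intros) auto
    then show "((\<lambda>h. (deriv g \<mu> - deriv g (\<mu> + h)) / (2 * h)) \<longlongrightarrow> - (deriv ^^ 2) g \<mu> / 2) (at 0)"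
      by (rule Lim_transform_eventually) (auto simp: eventually_at_filter field_simps)
  qed
qed

lemma concave_below_tangent:
  fixes g :: "real \<Rightarrow> real"
  assumes conc: "strictly_concave_on S g" and "\<mu> \<in> interior S"
    and "(g has_real_derivative a) (at \<mu>)" and "x \<in> S"
  shows "g x \<le> g \<mu> + a * (x - \<mu>)"
proof -
  have S: "convex S" using conc by (simp add: strictly_concave_on_def)
  have "convex_on S (\<lambda>x. - g x)"
  proof (rule convex_onI[OF _ S])
    fix t x y :: real assume *: "0 < t" "t < 1" "x \<in> S" "y \<in> S"
    show "- g ((1 - t) *\<^sub>R x + t *\<^sub>R y) \<le> (1 - t) * - g x + t * - g y"
    proof (cases "x = y")
      case True
      then show ?thesis by (simp add: algebra_simps)
    next
      case False
      then have "g ((1 - t) * x + t * y) > (1 - t) * g x + t * g y"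
        using conc * by (auto simp: strictly_concave_on_def)
      then show ?thesis by simp
    qed
  qed
  moreover have "connected S" using S by (rule convex_connected)
  moreover have "((\<lambda>x. - g x) has_field_derivative - a) (at \<mu> within S)"
    using assms(3) by (intro DERIV_minus) (rule has_field_derivative_at_within)
  ultimately have "- g x - - g \<mu> \<ge> - a * (x - \<mu>)"
    using assms by (intro convex_on_imp_above_tangent) auto
  then show ?thesis by simp
qed

text \<open>The distance \<psi> from the tangent is convex and vanishes at \<mu>. Close to \<mu> the
  limit c bounds it below quadratically. Farther away convexity makes it grow at least linearly
  along each ray, and on a bounded interval a linear bound implies a quadratic one with a smaller
  constant.\<close>

lemma strictly_concave_quadratic_gap:
  fixes g :: "real \<Rightarrow> real"
  assumes conc: "strictly_concave_on {l..u} g" and \<mu>: "l < \<mu>" "\<mu> < u"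
    and below: "\<And>x. x \<in> {l..u} \<Longrightarrow> g x \<le> g \<mu> + a * (x - \<mu>)"
    and lim: "((\<lambda>h. (g \<mu> + a * h - g (\<mu> + h)) / h\<^sup>2) \<longlongrightarrow> c) (at 0)" and c: "c > 0"
  obtains \<kappa> where "\<kappa> > 0" "\<And>x. x \<in> {l..u} \<Longrightarrow> \<kappa> * (x - \<mu>)\<^sup>2 \<le> g \<mu> + a * (x - \<mu>) - g x"
proof -
  define \<psi> where "\<psi> x = g \<mu> + a * (x - \<mu>) - g x" for x
  have "eventually (\<lambda>h. c / 2 < (g \<mu> + a * h - g (\<mu> + h)) / h\<^sup>2) (at 0)"
    using lim c by (intro order_tendstoD(1)[where y = c]) auto
  then obtain d where d: "d > 0" "\<And>h. h \<noteq> 0 \<Longrightarrow> \<bar>h\<bar> < d \<Longrightarrow> c / 2 < (g \<mu> + a * h - g (\<mu> + h)) / h\<^sup>2"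
    by (auto simp: eventually_at)
  have near: "c / 2 * (x - \<mu>)\<^sup>2 \<le> \<psi> x" if "\<bar>x - \<mu>\<bar> < d" for x
  proof (cases "x = \<mu>")
    case False
    then have "c / 2 < \<psi> x / (x - \<mu>)\<^sup>2" using d(2)[of "x - \<mu>"] that by (simp add: \<psi>_def)
    then show ?thesis using False by (simp add: field_simps)
  qed (simp add: \<psi>_def)
  define e where "e = d / 2"
  have e: "0 < e" "e < d" using d by (auto simp: e_def)
  have far: "c / 2 * e * \<bar>x - \<mu>\<bar> \<le> \<psi> x" if x: "x \<in> {l..u}" "\<bar>x - \<mu>\<bar> > e" for x
  proof -
    \<comment> \<open>This t puts the convex combination at distance exactly e from \<mu>, within
      the range of \<open>near\<close>; convexity carries the bound from there out to x.\<close>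
    define t where "t = e / \<bar>x - \<mu>\<bar>"
    have t: "0 < t" "t < 1" using x e by (auto simp: t_def field_simps)
    have "\<mu> \<noteq> x" using x e by auto
    then have "g ((1 - t) * \<mu> + t * x) > (1 - t) * g \<mu> + t * g x"
      using conc t x \<mu> by (auto simp: strictly_concave_on_def)
    then have "\<psi> ((1 - t) * \<mu> + t * x) \<le> t * \<psi> x"
      by (simp add: \<psi>_def algebra_simps)
    moreover have "((1 - t) * \<mu> + t * x) - \<mu> = t * (x - \<mu>)" by (simp add: algebra_simps)
    moreover have te: "\<bar>t * (x - \<mu>)\<bar> = e" using x e by (simp add: t_def abs_mult)
    ultimately have "c / 2 * e\<^sup>2 \<le> t * \<psi> x"
      using near[of "(1 - t) * \<mu> + t * x"] e by (metis order_trans power2_abs)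
    then have "c / 2 * e\<^sup>2 / t \<le> \<psi> x" using t by (simp add: field_simps)
    moreover have "c / 2 * e\<^sup>2 / t = c / 2 * e * \<bar>x - \<mu>\<bar>"
      using e by (simp add: t_def power2_eq_square)
    ultimately show ?thesis by simp
  qed
  \<comment> \<open>The second argument turns the linear bound into a quadratic one through \<bar>x
    - \<mu>\<bar> \<le> u - l.\<close>
  define \<kappa> where "\<kappa> = min (c / 2) (c / 2 * e / (u - l))"
  have \<kappa>: "\<kappa> \<le> c / 2" "\<kappa> \<le> c / 2 * e / (u - l)"
    unfolding \<kappa>_def by (rule min.cobounded1 min.cobounded2)+
  show ?thesis
  proof (rule that)
    show "\<kappa> > 0" using c e \<mu> by (simp add: \<kappa>_def)
    fix x assume x: "x \<in> {l..u}"
    have "\<kappa> * (x - \<mu>)\<^sup>2 \<le> \<psi> x"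
    proof (cases "\<bar>x - \<mu>\<bar> > e")
      case False
      have "\<kappa> * (x - \<mu>)\<^sup>2 \<le> c / 2 * (x - \<mu>)\<^sup>2" using \<kappa> by (intro mult_right_mono) auto
      with near[of x] e False show ?thesis by linarith
    next
      case True
      have "\<kappa> * (x - \<mu>)\<^sup>2 = \<kappa> * \<bar>x - \<mu>\<bar> * \<bar>x - \<mu>\<bar>" by (simp add: power2_eq_square)
      also have "\<dots> \<le> (c / 2 * e / (u - l)) * (u - l) * \<bar>x - \<mu>\<bar>"
        using x \<mu> c e \<kappa> by (intro mult_right_mono mult_mono) auto
      also have "(c / 2 * e / (u - l)) * (u - l) = c / 2 * e"
        by (subst times_divide_eq_left, rule nonzero_mult_div_cancel_right) (use \<mu> in simp)
      finally show ?thesis using far[OF x True] by linarith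
    qed
    then show "\<kappa> * (x - \<mu>)\<^sup>2 \<le> g \<mu> + a * (x - \<mu>) - g x" by (simp add: \<psi>_def)
  qed
qed

section \<open>Poisson approximation for dissociated events\<close>

text \<open>The integrating factor is normalised to be 1 at s = 1:
  \<open>exp (l * (s - 1)) * \<phi> s\<close> starts at exp (- l), ends at \<phi> 1, and its slope
  is at most b in absolute value because the factor never exceeds 1 on the unit interval.\<close>

lemma gronwall_exp_bound:
  fixes \<phi> \<phi>' :: "real \<Rightarrow> real"
  assumes der: "\<And>s. 0 \<le> s \<Longrightarrow> s \<le> 1 \<Longrightarrow> (\<phi> has_real_derivative \<phi>' s) (at s)"
    and bnd: "\<And>s. 0 \<le> s \<Longrightarrow> s \<le> 1 \<Longrightarrow> \<bar>\<phi>' s + l * \<phi> s\<bar> \<le> b"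
    and "l \<ge> 0" "\<phi> 0 = 1"
  shows "\<bar>\<phi> 1 - exp (- l)\<bar> \<le> b"
proof -
  define \<psi> where "\<psi> s = exp (l * (s - 1)) * \<phi> s" for s
  have der': "(\<psi> has_real_derivative exp (l * (s - 1)) * (\<phi>' s + l * \<phi> s)) (at s)"
    if "0 \<le> s" "s \<le> 1" for s
    unfolding \<psi>_def
    by (rule derivative_eq_intros der[OF that] refl | simp add: algebra_simps)+
  obtain z where z: "0 < z" "z < 1" "\<psi> 1 - \<psi> 0 = (1 - 0) * (exp (l * (z - 1)) * (\<phi>' z + l * \<phi> z))"
    using MVT2[of 0 1 \<psi> "\<lambda>s. exp (l * (s - 1)) * (\<phi>' s + l * \<phi> s)"] der' by auto
  have "b \<ge> 0" using bnd[of 0] by auto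
  have "l * (z - 1) \<le> 0" using z assms(3) by (simp add: mult_nonneg_nonpos)
  then have "exp (l * (z - 1)) * \<bar>\<phi>' z + l * \<phi> z\<bar> \<le> 1 * b"
    using z by (intro mult_mono bnd) auto
  then have "\<bar>\<psi> 1 - \<psi> 0\<bar> \<le> b" using z by (simp add: abs_mult)
  then show ?thesis using assms(4) by (simp add: \<psi>_def)
qed

text \<open>Both powers lie in [0, 1], so they differ by at most 1. The crude bound suffices because
  d will be the number of events that occur in a neighbourhood.\<close>

lemma power_diff_le_gap:
  fixes r :: real
  assumes "0 \<le> r" "r \<le> 1"
  shows "\<bar>r ^ (a + d) - r ^ a\<bar> \<le> real d"
proof (cases "d = 0")
  case False
  have "0 \<le> r ^ (a+d)" "r ^ (a+d) \<le> 1" "0 \<le> r ^ a" "r ^ a \<le> 1"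
    using assms by (auto simp: power_le_one)
  then show ?thesis using False by (auto simp: abs_if)
qed auto

lemma integral_abs_le_integral:
  fixes f g :: "'a \<Rightarrow> real"
  assumes "integrable M f" "integrable M g" "\<And>x. x \<in> space M \<Longrightarrow> \<bar>f x\<bar> \<le> g x"
  shows "\<bar>\<integral>x. f x \<partial>M\<bar> \<le> (\<integral>x. g x \<partial>M)"
  using integral_abs_bound[of M f] integral_mono[OF integrable_abs[OF assms(1)] assms(2,3)] by linarith

text \<open>
  The generating function \<open>\<phi> s = E (1 - s) ^ W\<close> of the number \<open>W\<close> of events satisfies
  \<open>\<phi>' = - l * \<phi>\<close> up to the error on the right-hand side; integrating from \<open>s = 0\<close> to \<open>s = 1\<close>, where
  \<open>\<phi> 1\<close> is the probability of \<open>W = 0\<close>, replaces the usual Stein equation.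
\<close>

lemma (in prob_space) poisson_approximation_dissociated:
  fixes E :: "'i \<Rightarrow> 'a set" and N :: "'i \<Rightarrow> 'i set"
  assumes fin: "finite I"
    and ev: "\<And>a. a \<in> I \<Longrightarrow> E a \<in> events"
    and N: "\<And>a. a \<in> I \<Longrightarrow> a \<in> N a \<and> N a \<subseteq> I"
    and ind: "\<And>a. a \<in> I \<Longrightarrow> indep_var borel (indicator (E a) :: 'a \<Rightarrow> real)
                  borel (\<lambda>\<omega>. \<Sum>b\<in>I - N a. indicator (E b) \<omega>)"
  shows "\<bar>prob {\<omega>\<in>space M. \<forall>a\<in>I. \<omega> \<notin> E a} - exp (- (\<Sum>a\<in>I. prob (E a)))\<bar>
           \<le> (\<Sum>a\<in>I. \<Sum>b\<in>N a - {a}. prob (E a \<inter> E b)) + (\<Sum>a\<in>I. \<Sum>b\<in>N a. prob (E a) * prob (E b))"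
proof -
  define W where "W J \<omega> = card {a\<in>J. \<omega> \<in> E a}" for J \<omega>
  have W_sum: "W J \<omega> = (\<Sum>a\<in>J. indicator (E a) \<omega>)" if "J \<subseteq> I" for J \<omega>
    using finite_subset[OF that fin]
    by (simp add: W_def indicator_def sum.If_cases Int_def)
  have W_rsum: "real (W J \<omega>) = (\<Sum>a\<in>J. indicator (E a) \<omega>)" if "J \<subseteq> I" for J \<omega>
    using finite_subset[OF that fin] W_sum[OF that, of \<omega>] by (auto simp: indicator_def of_nat_sum intro!: sum.cong)
  have W_meas[measurable]: "W J \<in> measurable M (count_space UNIV)" if "J \<subseteq> I" for J
  proof -
    have [measurable]: "(\<lambda>\<omega>. \<Sum>a\<in>J. indicator (E a) \<omega> :: real) \<in> borel_measurable M"
      using that ev by (intro borel_measurable_sum borel_measurable_indicator) auto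
    have "W J = (\<lambda>\<omega>. nat \<lfloor>\<Sum>a\<in>J. indicator (E a) \<omega> :: real\<rfloor>)"
      by (simp add: W_rsum[OF that, symmetric])
    then show ?thesis by simp
  qed
  have W_I: "W I \<omega> = W (I - N a) \<omega> + W (N a) \<omega>" if "a \<in> I" for a \<omega>
  proof -
    have "{b \<in> I. \<omega> \<in> E b} = {b \<in> I - N a. \<omega> \<in> E b} \<union> {b \<in> N a. \<omega> \<in> E b}"
      using N[OF that] by auto
    then show ?thesis
      unfolding W_def using fin N[OF that]
      by (simp only:) (intro card_Un_disjoint, auto intro: finite_subset)
  qed
  have W_N: "W (N a) \<omega> = Suc (W (N a - {a}) \<omega>)" if "a \<in> I" "\<omega> \<in> E a" for a \<omega>
  proof -
    have "{b \<in> N a. \<omega> \<in> E b} = insert a {b \<in> N a - {a}. \<omega> \<in> E b}"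
      using N[OF that(1)] that by auto
    then show ?thesis
      unfolding W_def using fin N[OF that(1)]
      by (simp only:) (intro card_insert_disjoint, auto intro: finite_subset)
  qed
  have W_le: "W J \<omega> \<le> card I" if "J \<subseteq> I" for J \<omega>
    unfolding W_def using fin that by (intro card_mono) auto
  have W_gap: "\<bar>r ^ (a + W J \<omega>) - r ^ a\<bar> \<le> (\<Sum>b\<in>J. indicator (E b) \<omega>)"
    if "J \<subseteq> I" "0 \<le> r" "r \<le> 1" for r :: real and J a \<omega>
    using power_diff_le_gap[OF that(2,3), of a "W J \<omega>"] W_rsum[OF that(1)] by simp

  define \<phi> where "\<phi> s = expectation (\<lambda>\<omega>. (1 - s) ^ W I \<omega>)" for s :: real
  define \<phi>' where "\<phi>' s = - expectation (\<lambda>\<omega>. real (W I \<omega>) * (1 - s) ^ (W I \<omega> - 1))" for s :: real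
  have bnd_int: "integrable M (\<lambda>\<omega>. f (W J \<omega>))" if "J \<subseteq> I" for f :: "nat \<Rightarrow> real" and J
  proof (rule integrable_const_bound[where B = "\<Sum>k\<le>card I. \<bar>f k\<bar>"])
    show "AE \<omega> in M. norm (f (W J \<omega>)) \<le> (\<Sum>k\<le>card I. \<bar>f k\<bar>)"
      using W_le[OF that] by (auto intro!: AE_I2 member_le_sum)
    show "(\<lambda>\<omega>. f (W J \<omega>)) \<in> borel_measurable M"
      using W_meas[OF that] by measurable
  qed
  \<comment> \<open>W takes finitely many values, so \<phi> is a polynomial in s and can be
    differentiated termwise, without exchanging a derivative and an integral.\<close>
  have exp_W: "expectation (\<lambda>\<omega>. f (W I \<omega>)) = (\<Sum>k\<le>card I. f k * prob {\<omega>\<in>space M. W I \<omega> = k})"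
    for f :: "nat \<Rightarrow> real"
  proof -
    have [measurable]: "{\<omega>\<in>space M. W I \<omega> = k} \<in> events" for k
      using W_meas[OF order_refl] by measurable
    have "expectation (\<lambda>\<omega>. f (W I \<omega>))
        = expectation (\<lambda>\<omega>. \<Sum>k\<le>card I. f k * indicator {\<omega>\<in>space M. W I \<omega> = k} \<omega>)"
    proof (rule Bochner_Integration.integral_cong)
      fix \<omega> assume w: "\<omega> \<in> space M"
      have "(\<Sum>k\<le>card I. f k * indicator {\<omega>\<in>space M. W I \<omega> = k} \<omega>)
          = (\<Sum>k\<le>card I. if k = W I \<omega> then f k else 0)"
        using w by (intro sum.cong) (auto simp: indicator_def)
      then show "f (W I \<omega>) = (\<Sum>k\<le>card I. f k * indicator {\<omega>\<in>space M. W I \<omega> = k} \<omega>)"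
        using W_le[OF order_refl, of \<omega>] by simp
    qed simp
    also have "\<dots> = (\<Sum>k\<le>card I. f k * prob {\<omega>\<in>space M. W I \<omega> = k})"
      by (subst Bochner_Integration.integral_sum) (auto simp: emeasure_eq_measure)
    finally show ?thesis .
  qed
  have der: "(\<phi> has_real_derivative \<phi>' s) (at s)" for s
    unfolding \<phi>_def \<phi>'_def exp_W[of "\<lambda>k. (1 - _) ^ k"]
      exp_W[of "\<lambda>k. real k * (1 - s) ^ (k - 1)"] sum_negf[symmetric]
    by (auto intro!: derivative_eq_intros sum.cong)
  define l where "l = (\<Sum>a\<in>I. prob (E a))"
  define b1 where "b1 = (\<Sum>a\<in>I. \<Sum>b\<in>N a. prob (E a) * prob (E b))"
  define b2 where "b2 = (\<Sum>a\<in>I. \<Sum>b\<in>N a - {a}. prob (E a \<inter> E b))"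
  have sum_int: "integrable M (\<lambda>\<omega>. \<Sum>b\<in>J. indicator (E b) \<omega> :: real)" if "J \<subseteq> I" for J
    using that ev by (intro Bochner_Integration.integrable_sum integrable_real_indicator)
      (auto simp: emeasure_eq_measure)
  have bnd: "\<bar>\<phi>' s + l * \<phi> s\<bar> \<le> b2 + b1" if s: "0 \<le> s" "s \<le> 1" for s
  proof -
    define r where "r = 1 - s"
    have r: "0 \<le> r" "r \<le> 1" using s by (auto simp: r_def)
    define X where "X a \<omega> = (indicator (E a) \<omega> :: real)" for a \<omega>
    have X01: "0 \<le> X a \<omega>" "X a \<omega> \<le> 1" for a \<omega>
      by (auto simp: X_def indicator_def)
    have Xm: "X a \<in> borel_measurable M" if "a \<in> I" for a
      unfolding X_def[abs_def] using ev[OF that] by simp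
    have EX: "expectation (X a) = prob (E a)" if "a \<in> I" for a
      using ev[OF that] sets.sets_into_space[OF ev[OF that]] by (simp add: X_def[abs_def] Int_absorb2)
    have X_int: "integrable M (\<lambda>\<omega>. X a \<omega> * f (W J \<omega>))" if "a \<in> I" "J \<subseteq> I" for f :: "nat \<Rightarrow> real" and J a
    proof (rule Bochner_Integration.integrable_bound[OF bnd_int[OF that(2), of f]])
      show "(\<lambda>\<omega>. X a \<omega> * f (W J \<omega>)) \<in> borel_measurable M"
        using Xm[OF that(1)] W_meas[OF that(2)] by measurable
    qed (use X01 in \<open>auto simp: abs_mult intro!: mult_left_le_one_le\<close>)
    have 1: "\<phi>' s = - (\<Sum>a\<in>I. expectation (\<lambda>\<omega>. X a \<omega> * r ^ (W I \<omega> - 1)))"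
      unfolding \<phi>'_def r_def[symmetric] W_rsum[OF order_refl] sum_distrib_right X_def[symmetric]
      by (subst Bochner_Integration.integral_sum) (auto intro!: X_int)
    have fact: "expectation (\<lambda>\<omega>. X a \<omega> * r ^ W (I - N a) \<omega>)
                = prob (E a) * expectation (\<lambda>\<omega>. r ^ W (I - N a) \<omega>)" if a: "a \<in> I" for a
    proof -
      \<comment> \<open>Independence is given for the real-valued sum of indicators;
        \<open>nat \<lfloor>x\<rfloor>\<close> recovers the count from it.\<close>
      have iv: "indep_var borel (\<lambda>\<omega>. indicator (E a) \<omega> :: real)
             borel ((\<lambda>x. r ^ nat \<lfloor>x\<rfloor>) \<circ> (\<lambda>\<omega>. \<Sum>b\<in>I - N a. indicator (E b) \<omega> :: real))"
        using indep_var_compose[OF ind[OF a], of "\<lambda>x. x" borel "\<lambda>x. r ^ nat \<lfloor>x\<rfloor>" borel]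
        by (simp add: comp_def)
      have *: "(\<lambda>x. r ^ nat \<lfloor>x\<rfloor>) \<circ> (\<lambda>\<omega>. \<Sum>b\<in>I - N a. indicator (E b) \<omega> :: real)
          = (\<lambda>\<omega>. r ^ W (I - N a) \<omega>)"
        by (simp add: comp_def W_rsum[symmetric])
      show ?thesis
        using indep_var_lebesgue_integral[OF iv[unfolded *]] ev[OF a]
          bnd_int[of "I - N a" "\<lambda>k. r ^ k"] EX[OF a]
        by (simp add: X_def[abs_def] integrable_real_indicator emeasure_eq_measure)
    qed
    \<comment> \<open>On \<open>E a\<close> the exponent \<open>W I \<omega> - 1\<close> discounts
      the event a itself, so it exceeds the count outside \<open>N a\<close> by the number of the
      other events in \<open>N a\<close>.\<close>
    have t1: "\<bar>expectation (\<lambda>\<omega>. X a \<omega> * r ^ (W I \<omega> - 1)) - expectation (\<lambda>\<omega>. X a \<omega> * r ^ W (I - N a) \<omega>)\<bar>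
        \<le> (\<Sum>b\<in>N a - {a}. prob (E a \<inter> E b))" (is "\<bar>?l\<bar> \<le> _") if a: "a \<in> I" for a
    proof -
      have "?l = expectation (\<lambda>\<omega>. X a \<omega> * r ^ (W I \<omega> - 1) - X a \<omega> * r ^ W (I - N a) \<omega>)"
        using a by (subst Bochner_Integration.integral_diff) (auto intro!: X_int)
      also have "\<bar>\<dots>\<bar> \<le> expectation (\<lambda>\<omega>. \<Sum>b\<in>N a - {a}. indicator (E a \<inter> E b) \<omega>)"
      proof (rule integral_abs_le_integral)
        show "integrable M (\<lambda>\<omega>. X a \<omega> * r ^ (W I \<omega> - 1) - X a \<omega> * r ^ W (I - N a) \<omega>)"
          using a by (intro Bochner_Integration.integrable_diff X_int) auto
        show "integrable M (\<lambda>\<omega>. \<Sum>b\<in>N a - {a}. indicator (E a \<inter> E b) \<omega> :: real)"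
          using a ev N[OF a] by (intro Bochner_Integration.integrable_sum integrable_real_indicator)
            (auto simp: emeasure_eq_measure)
        fix \<omega>
        show "\<bar>X a \<omega> * r ^ (W I \<omega> - 1) - X a \<omega> * r ^ W (I - N a) \<omega>\<bar>
            \<le> (\<Sum>b\<in>N a - {a}. indicator (E a \<inter> E b) \<omega>)"
        proof (cases "\<omega> \<in> E a")
          case True
          have "W I \<omega> - 1 = W (I - N a) \<omega> + W (N a - {a}) \<omega>"
            using W_I[OF a, of \<omega>] W_N[OF a True] by simp
          then show ?thesis
            using W_gap[of "N a - {a}" r "W (I - N a) \<omega>" \<omega>] N[OF a] r True
            by (auto simp: X_def indicator_inter_arith)
        qed (simp add: X_def)
      qed
      also have "\<dots> = (\<Sum>b\<in>N a - {a}. prob (E a \<inter> E b))"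
      proof -
        have "E a \<inter> E b \<inter> space M = E a \<inter> E b" for b
          using sets.sets_into_space[OF ev[OF a]] by auto
        moreover have "E a \<inter> E b \<in> events" if "b \<in> N a" for b
          using ev[OF a] ev[of b] N[OF a] that by auto
        ultimately show ?thesis
          by (subst Bochner_Integration.integral_sum) (auto simp: emeasure_eq_measure)
      qed
      finally show ?thesis .
    qed
    \<comment> \<open>Puts the events of \<open>N a\<close> back once \<open>E a\<close> has been
      split off by independence.\<close>
    have t2: "\<bar>expectation (\<lambda>\<omega>. r ^ W (I - N a) \<omega>) - expectation (\<lambda>\<omega>. r ^ W I \<omega>)\<bar>
        \<le> (\<Sum>b\<in>N a. prob (E b))" (is "\<bar>?l\<bar> \<le> _") if a: "a \<in> I" for a
    proof -
      have "?l = expectation (\<lambda>\<omega>. r ^ W (I - N a) \<omega> - r ^ W I \<omega>)"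
        using bnd_int[of _ "\<lambda>k. r ^ k"]
        by (subst Bochner_Integration.integral_diff) auto
      also have "\<bar>\<dots>\<bar> \<le> expectation (\<lambda>\<omega>. \<Sum>b\<in>N a. indicator (E b) \<omega>)"
      proof (rule integral_abs_le_integral)
        show "integrable M (\<lambda>\<omega>. r ^ W (I - N a) \<omega> - r ^ W I \<omega>)"
          using bnd_int[of _ "\<lambda>k. r ^ k"] by (intro Bochner_Integration.integrable_diff) auto
        show "integrable M (\<lambda>\<omega>. \<Sum>b\<in>N a. indicator (E b) \<omega> :: real)"
          using sum_int N[OF a] by auto
        fix \<omega>
        show "\<bar>r ^ W (I - N a) \<omega> - r ^ W I \<omega>\<bar> \<le> (\<Sum>b\<in>N a. indicator (E b) \<omega>)"
          using W_gap[of "N a" r "W (I - N a) \<omega>" \<omega>] N[OF a] r W_I[OF a, of \<omega>]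
          by (auto simp: abs_minus_commute)
      qed
      also have "\<dots> = (\<Sum>b\<in>N a. prob (E b))"
        using EX N[OF a] ev unfolding X_def[abs_def]
        by (subst Bochner_Integration.integral_sum)
          (auto simp: emeasure_eq_measure subset_iff intro!: sum.cong)
      finally show ?thesis .
    qed
    have "\<phi>' s + l * \<phi> s = (\<Sum>a\<in>I. prob (E a) * expectation (\<lambda>\<omega>. r ^ W I \<omega>)
            - expectation (\<lambda>\<omega>. X a \<omega> * r ^ (W I \<omega> - 1)))"
      unfolding 1 by (simp add: \<phi>_def l_def r_def sum_distrib_right sum_subtractf)
    also have "\<bar>\<dots>\<bar> \<le> (\<Sum>a\<in>I. (\<Sum>b\<in>N a - {a}. prob (E a \<inter> E b)) + (\<Sum>b\<in>N a. prob (E a) * prob (E b)))"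
    \<comment> \<open>Both terms are compared with \<open>prob (E a) * expectation
      (\<lambda>\<omega>. r ^ W (I - N a) \<omega>)\<close>: the first by \<open>t2\<close>, the
      second by \<open>t1\<close> and \<open>fact\<close>.\<close>
    proof (rule order_trans[OF sum_abs sum_mono])
      fix a assume a: "a \<in> I"
      have "\<bar>prob (E a) * (expectation (\<lambda>\<omega>. r ^ W (I - N a) \<omega>) - expectation (\<lambda>\<omega>. r ^ W I \<omega>))\<bar>
          \<le> prob (E a) * (\<Sum>b\<in>N a. prob (E b))"
        using t2[OF a] by (simp add: abs_mult mult_left_mono)
      then show "\<bar>prob (E a) * expectation (\<lambda>\<omega>. r ^ W I \<omega>) - expectation (\<lambda>\<omega>. X a \<omega> * r ^ (W I \<omega> - 1))\<bar>
          \<le> (\<Sum>b\<in>N a - {a}. prob (E a \<inter> E b)) + (\<Sum>b\<in>N a. prob (E a) * prob (E b))"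
        using t1[OF a] fact[OF a] by (simp add: sum_distrib_left[symmetric] right_diff_distrib)
    qed
    finally show ?thesis by (simp add: b1_def b2_def sum.distrib)
  qed
  have "\<phi> 0 = 1" by (simp add: \<phi>_def prob_space)
  moreover have "\<phi> 1 = prob {\<omega>\<in>space M. \<forall>a\<in>I. \<omega> \<notin> E a}"
  proof -
    have "\<phi> 1 = prob {\<omega>\<in>space M. W I \<omega> = 0}"
      unfolding \<phi>_def exp_W[of "\<lambda>k. (1 - 1) ^ k"]
      by (simp add: power_0_left if_distrib if_distribR cong: if_cong)
    also have "{\<omega>\<in>space M. W I \<omega> = 0} = {\<omega>\<in>space M. \<forall>a\<in>I. \<omega> \<notin> E a}"
      using fin by (auto simp: W_def)
    finally show ?thesis .
  qed
  moreover have "l \<ge> 0" unfolding l_def by (intro sum_nonneg) auto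
  ultimately show ?thesis
    using gronwall_exp_bound[of \<phi> \<phi>' l "b2 + b1"] der bnd by (simp add: l_def b1_def b2_def)
qed

section \<open>Integrals over products of real lines\<close>

text \<open>Serves two purposes: rescaling all offsets by \<sigma>, and passing from independent
  angles to relative angles under Lebesgue measure. The weights \<open>w\<close> absorb the Jacobian
  in the first case and the density in the second. Fubini reduces everything to the one-dimensional
  rule \<open>subst\<close>.\<close>

lemma nn_integral_PiM_substitution:
  fixes \<nu> :: "'i \<Rightarrow> real measure" and \<phi> :: "'i \<Rightarrow> real \<Rightarrow> real" and w :: "'i \<Rightarrow> real \<Rightarrow> ennreal"
  assumes sf: "\<And>i. sigma_finite_measure (\<nu> i)" and sets_\<nu>: "\<And>i. sets (\<nu> i) = sets borel"
    and [measurable]: "\<And>i. \<phi> i \<in> borel_measurable borel" "\<And>i. w i \<in> borel_measurable borel"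
    and "finite J"
    and subst: "\<And>j h. j \<in> J \<Longrightarrow> h \<in> borel_measurable borel \<Longrightarrow>
                  (\<integral>\<^sup>+x. h (\<phi> j x) \<partial>\<nu> j) = (\<integral>\<^sup>+y. h y * w j y \<partial>lborel)"
    and H: "H \<in> borel_measurable (PiM J (\<lambda>_. borel))"
  shows "(\<integral>\<^sup>+x. H (\<lambda>j\<in>J. \<phi> j (x j)) \<partial>PiM J \<nu>) = (\<integral>\<^sup>+y. H y * (\<Prod>j\<in>J. w j (y j)) \<partial>PiM J (\<lambda>_. lborel))"
  using \<open>finite J\<close> subst H
proof (induction J arbitrary: H)
  case empty
  then show ?case by (simp add: PiM_empty nn_integral_count_space_finite)
next
  case (insert i J)
  interpret \<nu>: product_sigma_finite \<nu> by (rule product_sigma_finite.intro) (rule sf)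
  interpret L: product_sigma_finite "\<lambda>_::'i. lborel :: real measure" ..
  note [measurable_cong] = sets_\<nu>
  have [measurable]: "H \<in> borel_measurable (PiM (insert i J) (\<lambda>_. borel))" by fact
  define H2 where "H2 v = (\<integral>\<^sup>+y. H (v(i := y)) * w i y \<partial>lborel)" for v
  have upd: "(\<lambda>(v, y). v(i := y)) \<in> PiM J (\<lambda>_. borel :: real measure) \<Otimes>\<^sub>M borel \<rightarrow>\<^sub>M PiM (insert i J) (\<lambda>_. borel)"
    using measurable_add_dim by simp
  have [measurable]: "(\<lambda>x. H ((fst x)(i := snd x))) \<in> borel_measurable (PiM J (\<lambda>_. borel) \<Otimes>\<^sub>M borel)"
    using measurable_compose[OF upd, of H borel] by (simp add: case_prod_beta)
  have H2[measurable]: "H2 \<in> borel_measurable (PiM J (\<lambda>_. borel))"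
    unfolding H2_def by measurable
  have "(\<integral>\<^sup>+x. H (\<lambda>j\<in>insert i J. \<phi> j (x j)) \<partial>PiM (insert i J) \<nu>)
      = (\<integral>\<^sup>+x. \<integral>\<^sup>+y. H (\<lambda>j\<in>insert i J. \<phi> j ((x(i := y)) j)) \<partial>\<nu> i \<partial>PiM J \<nu>)"
    using insert.hyps by (subst \<nu>.product_nn_integral_insert) auto
  also have "\<dots> = (\<integral>\<^sup>+x. H2 (\<lambda>j\<in>J. \<phi> j (x j)) \<partial>PiM J \<nu>)"
  proof (rule nn_integral_cong)
    fix x assume "x \<in> space (PiM J \<nu>)"
    have *: "(\<lambda>j\<in>insert i J. \<phi> j ((x(i := y)) j)) = (\<lambda>j\<in>J. \<phi> j (x j))(i := \<phi> i y)" for y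
      using insert.hyps by (auto simp: fun_eq_iff)
    have v: "(\<lambda>j\<in>J. \<phi> j (x j)) \<in> space (PiM J (\<lambda>_. borel))"
      by (simp add: space_PiM)
    have "(\<lambda>y. H ((\<lambda>j\<in>J. \<phi> j (x j))(i := y))) \<in> borel_measurable borel"
      using measurable_compose[OF measurable_component_update[OF v insert.hyps(2)] insert.prems(2)] .
    then show "(\<integral>\<^sup>+y. H (\<lambda>j\<in>insert i J. \<phi> j ((x(i := y)) j)) \<partial>\<nu> i) = H2 (\<lambda>j\<in>J. \<phi> j (x j))"
      unfolding * H2_def using insert.prems(1)[of i "\<lambda>y. H ((\<lambda>j\<in>J. \<phi> j (x j))(i := y))"] by simp
  qed
  also have "\<dots> = (\<integral>\<^sup>+y. H2 y * (\<Prod>j\<in>J. w j (y j)) \<partial>PiM J (\<lambda>_. lborel))"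
    using insert.prems(1) by (intro insert.IH H2) auto
  also have "\<dots> = (\<integral>\<^sup>+x. \<integral>\<^sup>+y. H (x(i := y)) * (\<Prod>j\<in>insert i J. w j ((x(i := y)) j)) \<partial>lborel \<partial>PiM J (\<lambda>_. lborel))"
  proof (rule nn_integral_cong)
    fix x assume x: "x \<in> space (PiM J (\<lambda>_::'i. lborel :: real measure))"
    have x': "x \<in> space (PiM J (\<lambda>_. borel))" using x by (simp add: space_PiM)
    have "(\<lambda>y. H (x(i := y))) \<in> borel_measurable borel"
      using measurable_compose[OF measurable_component_update[OF x' insert.hyps(2)] insert.prems(2)] .
    moreover have "(\<Prod>j\<in>J. w j (if j = i then y else x j)) = (\<Prod>j\<in>J. w j (x j))" for y
      using insert.hyps by (intro prod.cong) auto
    ultimately show "H2 x * (\<Prod>j\<in>J. w j (x j))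
       = (\<integral>\<^sup>+y. H (x(i := y)) * (\<Prod>j\<in>insert i J. w j ((x(i := y)) j)) \<partial>lborel)"
      unfolding H2_def using insert.hyps
      by (subst nn_integral_multc[symmetric]) (auto simp: mult.assoc)
  qed
  also have "\<dots> = (\<integral>\<^sup>+y. H y * (\<Prod>j\<in>insert i J. w j (y j)) \<partial>PiM (insert i J) (\<lambda>_. lborel))"
    using insert.hyps by (subst L.product_nn_integral_insert) auto
  finally show ?case .
qed

text \<open>Pads the m - 1 free coordinates with fixed ends, so that all m gaps are consecutive
  differences. The right end is 2*pi for angles and 0 for offsets from the regular polygon; other
  values of z occur when the last free coordinate is eliminated.\<close>

definition chain :: "nat \<Rightarrow> real \<Rightarrow> (nat \<Rightarrow> real) \<Rightarrow> nat \<Rightarrow> real" where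
  "chain m z y j = (if j = 0 then 0 else if j < m then y j else z)"

lemma chain_simps [simp]:
  "chain m z y 0 = 0"
  "0 < j \<Longrightarrow> j < m \<Longrightarrow> chain m z y j = y j"
  "0 < m \<Longrightarrow> chain m z y m = z"
  by (auto simp: chain_def)

lemma chain_measurable [measurable]:
  "(\<lambda>y. chain m z y j) \<in> borel_measurable (PiM {1..<m} (\<lambda>_. borel))"
  by (cases "j = 0"; cases "j < m"; simp add: chain_def)

text \<open>The Dirichlet energy of a path with m edges whose ends are held at 0 and z. Its minimum
  is z\<twosuperior> / m, the term that splits off in \<open>nn_integral_gap_energy\<close>.\<close>

definition gap_energy :: "nat \<Rightarrow> real \<Rightarrow> (nat \<Rightarrow> real) \<Rightarrow> real" where
  "gap_energy m z y = (\<Sum>j=1..m. (chain m z y j - chain m z y (j - 1))\<^sup>2)"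

lemma gap_energy_measurable [measurable]:
  "gap_energy m z \<in> borel_measurable (PiM {1..<m} (\<lambda>_. borel))"
  unfolding gap_energy_def[abs_def] by measurable

lemma gap_energy_Suc:
  assumes "m \<ge> 1"
  shows "gap_energy (Suc m) z (y(m := w)) = gap_energy m w y + (z - w)\<^sup>2"
proof -
  have "(\<Sum>j=1..m. (chain (Suc m) z (y(m := w)) j - chain (Suc m) z (y(m := w)) (j - 1))\<^sup>2)
      = (\<Sum>j=1..m. (chain m w y j - chain m w y (j - 1))\<^sup>2)"
    by (intro sum.cong) (auto simp: chain_def)
  then show ?thesis using assms by (simp add: gap_energy_def)
qed

text \<open>The quadratic in w has its minimum z\<twosuperior> / (a + 1) at w = z * a / (a + 1) and
  leading coefficient (a + 1) / a. Shifting to the minimum and scaling by c makes it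
  x\<twosuperior>, and c is the Jacobian in front.\<close>

lemma nn_integral_complete_square:
  fixes F :: "real \<Rightarrow> ennreal"
  assumes [measurable]: "F \<in> borel_measurable borel" and a: "a > 0"
  shows "(\<integral>\<^sup>+w. F (S + (z - w)\<^sup>2 + w\<^sup>2 / a) \<partial>lborel)
       = ennreal (sqrt a / sqrt (a + 1)) * (\<integral>\<^sup>+x. F (S + z\<^sup>2 / (a + 1) + x\<^sup>2) \<partial>lborel)"
proof -
  define c where "c = sqrt a / sqrt (a + 1)"
  have c: "c > 0" "c\<^sup>2 = a / (a + 1)" using a by (auto simp: c_def power_divide)
  have eq: "S + (z - (z * a / (a + 1) + c * x))\<^sup>2 + (z * a / (a + 1) + c * x)\<^sup>2 / a
      = S + z\<^sup>2 / (a + 1) + x\<^sup>2" for x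
  proof -
    define e d where "e = z / (a + 1)" and "d = c * x"
    have z: "z = e * (a + 1)" using a by (simp add: e_def)
    have "(e * a + d)\<^sup>2 / a = e\<^sup>2 * a + 2 * e * d + d\<^sup>2 / a"
      using a by (simp add: power2_eq_square field_simps)
    moreover have "z * a / (a + 1) = e * a" by (simp add: e_def)
    moreover have "(z - (e * a + d))\<^sup>2 = e\<^sup>2 - 2 * e * d + d\<^sup>2"
      unfolding z by (simp add: power2_eq_square algebra_simps)
    moreover have "z\<^sup>2 / (a + 1) = e\<^sup>2 * (a + 1)"
      unfolding z using a by (simp add: power2_eq_square)
    moreover have "d\<^sup>2 + d\<^sup>2 / a = x\<^sup>2"
      using a by (simp add: d_def power_mult_distrib c(2) divide_simps) (simp add: algebra_simps)
    ultimately show ?thesis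
      by (simp add: d_def[symmetric] algebra_simps)
  qed
  show ?thesis
    using c(1) by (subst nn_integral_real_affine[where c = c and t = "z * a / (a + 1)"])
      (simp_all add: eq c_def[symmetric])
qed

lemma emeasure_eq_nn_integral_indicator:
  assumes [measurable]: "f \<in> measurable M N" "S \<in> sets N"
  shows "emeasure M {x\<in>space M. f x \<in> S} = (\<integral>\<^sup>+x. indicator S (f x) \<partial>M)"
proof -
  have "emeasure M {x\<in>space M. f x \<in> S} = (\<integral>\<^sup>+x. indicator {x\<in>space M. f x \<in> S} x \<partial>M)"
    by (rule nn_integral_indicator[symmetric]) measurable
  also have "\<dots> = (\<integral>\<^sup>+x. indicator S (f x) \<partial>M)"
    by (intro nn_integral_cong) (auto simp: indicator_def)
  finally show ?thesis .
qed

text \<open>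
  The Gram determinant of the gap energy is \<open>m\<close>, whence the Jacobian \<open>1 / sqrt m\<close>; eliminating the
  last coordinate by completing the square makes it appear as a telescoping product.
\<close>

lemma nn_integral_gap_energy:
  fixes F :: "real \<Rightarrow> ennreal"
  assumes "m \<ge> 1" and [measurable]: "F \<in> borel_measurable borel"
  shows "(\<integral>\<^sup>+y. F (S + gap_energy m z y) \<partial>PiM {1..<m} (\<lambda>_. lborel))
       = ennreal (1 / sqrt m) * (\<integral>\<^sup>+x. F (S + z\<^sup>2 / m + (\<Sum>j\<in>{1..<m}. (x j)\<^sup>2)) \<partial>PiM {1..<m} (\<lambda>_. lborel))"
  using assms(1)
proof (induction m arbitrary: S z rule: nat_induct_at_least)
  case base
  then show ?case by (simp add: gap_energy_def nn_integral_count_space_finite PiM_empty)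
next
  case (Suc m)
  interpret L: product_sigma_finite "\<lambda>_::nat. lborel :: real measure" ..
  interpret P: sigma_finite_measure "PiM {1..<m} (\<lambda>_. lborel :: real measure)"
    by (rule L.sigma_finite) simp
  interpret Q: pair_sigma_finite "PiM {1..<m} (\<lambda>_. lborel :: real measure)" "lborel :: real measure" ..
  have ins: "{1..<Suc m} = insert m {1..<m}" using Suc.hyps by auto
  have [measurable]: "gap_energy (Suc m) z \<in> borel_measurable (PiM (insert m {1..<m}) (\<lambda>_. borel))" for z
    unfolding ins[symmetric] by measurable
  have "(\<integral>\<^sup>+y. F (S + gap_energy (Suc m) z y) \<partial>PiM {1..<Suc m} (\<lambda>_. lborel))
      = (\<integral>\<^sup>+w. \<integral>\<^sup>+y. F (S + gap_energy (Suc m) z (y(m := w))) \<partial>PiM {1..<m} (\<lambda>_. lborel) \<partial>lborel)"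
    unfolding ins by (subst L.product_nn_integral_insert_rev) (auto simp del: One_nat_def)
  \<comment> \<open>The energy of the last edge moves into S and the cut point w becomes the right
    end of the shorter path; this is why S and z vary in the induction.\<close>
  also have "\<dots> = (\<integral>\<^sup>+w. \<integral>\<^sup>+y. F ((S + (z - w)\<^sup>2) + gap_energy m w y) \<partial>PiM {1..<m} (\<lambda>_. lborel) \<partial>lborel)"
    using Suc.hyps by (simp add: gap_energy_Suc algebra_simps)
  also have "\<dots> = (\<integral>\<^sup>+w. ennreal (1 / sqrt m) * (\<integral>\<^sup>+x. F ((S + (z - w)\<^sup>2) + w\<^sup>2 / m + (\<Sum>j\<in>{1..<m}. (x j)\<^sup>2))
        \<partial>PiM {1..<m} (\<lambda>_. lborel)) \<partial>lborel)"
    by (simp only: Suc.IH)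
  also have "\<dots> = ennreal (1 / sqrt m) * (\<integral>\<^sup>+w. (\<integral>\<^sup>+x. F ((S + (z - w)\<^sup>2) + w\<^sup>2 / m + (\<Sum>j\<in>{1..<m}. (x j)\<^sup>2))
        \<partial>PiM {1..<m} (\<lambda>_. lborel)) \<partial>lborel)"
    by (intro nn_integral_cmult) measurable
  \<comment> \<open>Exchanging the integrals lets w be integrated with x fixed, so that completing
    the square in w applies; afterwards w becomes coordinate m.\<close>
  also have "(\<integral>\<^sup>+w. (\<integral>\<^sup>+x. F ((S + (z - w)\<^sup>2) + w\<^sup>2 / m + (\<Sum>j\<in>{1..<m}. (x j)\<^sup>2))
        \<partial>PiM {1..<m} (\<lambda>_. lborel)) \<partial>lborel)
     = (\<integral>\<^sup>+x. (\<integral>\<^sup>+w. F ((S + (\<Sum>j\<in>{1..<m}. (x j)\<^sup>2)) + (z - w)\<^sup>2 + w\<^sup>2 / m) \<partial>lborel) \<partial>PiM {1..<m} (\<lambda>_. lborel))"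
    by (subst Q.Fubini') (auto simp: algebra_simps)
  also have "\<dots> = (\<integral>\<^sup>+x. ennreal (sqrt m / sqrt (real m + 1)) *
        (\<integral>\<^sup>+w. F ((S + (\<Sum>j\<in>{1..<m}. (x j)\<^sup>2)) + z\<^sup>2 / (real m + 1) + w\<^sup>2) \<partial>lborel) \<partial>PiM {1..<m} (\<lambda>_. lborel))"
    using Suc.hyps by (subst nn_integral_complete_square) auto
  also have "\<dots> = ennreal (sqrt m / sqrt (real m + 1)) * (\<integral>\<^sup>+x. 
        (\<integral>\<^sup>+w. F (S + z\<^sup>2 / (real m + 1) + (\<Sum>j\<in>insert m {1..<m}. ((x(m := w)) j)\<^sup>2)) \<partial>lborel) \<partial>PiM {1..<m} (\<lambda>_. lborel))"
  proof -
    have "(\<Sum>j\<in>insert m {1..<m}. ((x(m := w)) j)\<^sup>2) = w\<^sup>2 + (\<Sum>j\<in>{1..<m}. (x j)\<^sup>2)" for x w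
      by simp
    then have *: "S + z\<^sup>2 / (real m + 1) + (\<Sum>j\<in>insert m {1..<m}. ((x(m := w)) j)\<^sup>2)
        = (S + (\<Sum>j\<in>{1..<m}. (x j)\<^sup>2)) + z\<^sup>2 / (real m + 1) + w\<^sup>2" for x w
      by simp
    show ?thesis
      unfolding * by (intro nn_integral_cmult) measurable
  qed
  also have "(\<integral>\<^sup>+x. (\<integral>\<^sup>+w. F (S + z\<^sup>2 / (real m + 1) + (\<Sum>j\<in>insert m {1..<m}. ((x(m := w)) j)\<^sup>2)) \<partial>lborel) \<partial>PiM {1..<m} (\<lambda>_. lborel))
     = (\<integral>\<^sup>+x. F (S + z\<^sup>2 / (real m + 1) + (\<Sum>j\<in>insert m {1..<m}. (x j)\<^sup>2)) \<partial>PiM (insert m {1..<m}) (\<lambda>_. lborel))"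
    by (subst L.product_nn_integral_insert) auto
  finally show ?case
    using Suc.hyps unfolding ins
    by (simp add: mult.assoc[symmetric] ennreal_mult[symmetric] add.commute)
qed

text \<open>With all coordinates but one frozen, at most two values of the remaining one are
  left.\<close>

lemma emeasure_PiM_sphere_null:
  assumes "finite A" "A \<noteq> {}"
  shows "emeasure (PiM A (\<lambda>_. lborel)) {x\<in>space (PiM A (\<lambda>_. lborel)). (\<Sum>j\<in>A. (x j)\<^sup>2) = (r::real)} = 0"
proof -
  interpret L: product_sigma_finite "\<lambda>_::'a. lborel :: real measure" ..
  obtain i J where A: "A = insert i J" "i \<notin> J" "finite J"
    using assms by (metis Set.set_insert all_not_in_conv finite_insert)
  let ?P = "PiM A (\<lambda>_. lborel :: real measure)"
  have "emeasure ?P {x\<in>space ?P. (\<Sum>j\<in>A. (x j)\<^sup>2) = r} = (\<integral>\<^sup>+x. indicator {r} (\<Sum>j\<in>A. (x j)\<^sup>2) \<partial>?P)"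
    using emeasure_eq_nn_integral_indicator[of "\<lambda>x. \<Sum>j\<in>A. (x j)\<^sup>2" ?P borel "{r}"] by simp
  also have "\<dots> = (\<integral>\<^sup>+x. \<integral>\<^sup>+y. indicator {r} (\<Sum>j\<in>A. ((x(i := y)) j)\<^sup>2) \<partial>lborel \<partial>PiM J (\<lambda>_. lborel))"
    unfolding A(1) by (intro L.product_nn_integral_insert) (use A in auto)
  also have "\<dots> = (\<integral>\<^sup>+x. 0 \<partial>PiM J (\<lambda>_. lborel :: real measure))"
  proof (rule nn_integral_cong)
    fix x :: "'a \<Rightarrow> real"
    define s where "s = (\<Sum>j\<in>J. (x j)\<^sup>2)"
    have "(\<Sum>j\<in>A. ((x(i := y)) j)\<^sup>2) = y\<^sup>2 + s" for y
    proof -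
      have "(\<Sum>j\<in>J. ((x(i := y)) j)\<^sup>2) = s"
        unfolding s_def using A by (intro sum.cong) auto
      then show ?thesis using A by simp
    qed
    then have "(\<integral>\<^sup>+y. indicator {r} (\<Sum>j\<in>A. ((x(i := y)) j)\<^sup>2) \<partial>lborel)
        = (\<integral>\<^sup>+y. indicator {y. y\<^sup>2 + s = r} y \<partial>lborel)"
      by (intro nn_integral_cong) (auto simp: indicator_def)
    also have "\<dots> = emeasure lborel {y. y\<^sup>2 + s = r}"
      by (rule nn_integral_indicator) measurable
    also have "\<dots> = 0"
    proof -
      have "{y. y\<^sup>2 + s = r} \<subseteq> {sqrt (r - s), - sqrt (r - s)}"
      proof
        fix y assume "y \<in> {y. y\<^sup>2 + s = r}"
        then have "r - s = y\<^sup>2" by auto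
        then show "y \<in> {sqrt (r - s), - sqrt (r - s)}" by (simp add: abs_if)
      qed
      then have "countable {y. y\<^sup>2 + s = r}" by (rule countable_subset) simp
      then show ?thesis by (rule emeasure_lborel_countable)
    qed
    finally show "(\<integral>\<^sup>+y. indicator {r} (\<Sum>j\<in>A. ((x(i := y)) j)\<^sup>2) \<partial>lborel) = 0" .
  qed
  finally show ?thesis by simp
qed

text \<open>The boundary of the limiting ellipsoid must be negligible for the indicators of the
  rescaled regions to converge almost everywhere. \<open>nn_integral_gap_energy\<close> reduces the
  claim to spheres.\<close>

lemma emeasure_gap_energy_null:
  assumes "m \<ge> 2"
  shows "emeasure (PiM {1..<m} (\<lambda>_. lborel)) {y\<in>space (PiM {1..<m} (\<lambda>_. lborel)). gap_energy m 0 y = r} = 0"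
proof -
  let ?P = "PiM {1..<m} (\<lambda>_. lborel :: real measure)"
  have gm: "gap_energy m 0 \<in> borel_measurable ?P" by measurable
  have "emeasure ?P {y\<in>space ?P. gap_energy m 0 y = r} = (\<integral>\<^sup>+y. indicator {r} (0 + gap_energy m 0 y) \<partial>?P)"
    using emeasure_eq_nn_integral_indicator[OF gm, of "{r}"] by simp
  also have "\<dots> = ennreal (1 / sqrt m) * (\<integral>\<^sup>+y. indicator {r} (0 + 0\<^sup>2 / m + (\<Sum>j\<in>{1..<m}. (y j)\<^sup>2)) \<partial>?P)"
    using assms by (intro nn_integral_gap_energy) auto
  also have "(\<integral>\<^sup>+y. indicator {r} (0 + 0\<^sup>2 / m + (\<Sum>j\<in>{1..<m}. (y j)\<^sup>2)) \<partial>?P)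
      = emeasure ?P {y\<in>space ?P. (\<Sum>j\<in>{1..<m}. (y j)\<^sup>2) = r}"
    using emeasure_eq_nn_integral_indicator[of "\<lambda>y. \<Sum>j\<in>{1..<m}. (y j)\<^sup>2" ?P borel "{r}"] by simp
  also have "\<dots> = 0" using assms by (intro emeasure_PiM_sphere_null) auto
  finally show ?thesis by simp
qed

lemma emeasure_gap_energy_le:
  assumes "m \<ge> 2" "r > 0"
  shows "emeasure (PiM {1..<m} (\<lambda>_. lborel)) {y\<in>space (PiM {1..<m} (\<lambda>_. lborel)). gap_energy m 0 y \<le> r\<^sup>2}
       = ennreal (unit_ball_vol (real m - 1) * r ^ (m - 1) / sqrt m)"
proof -
  let ?P = "PiM {1..<m} (\<lambda>_. lborel :: real measure)"
  have gm: "gap_energy m 0 \<in> borel_measurable ?P" by measurable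
  have "emeasure ?P {y\<in>space ?P. gap_energy m 0 y \<le> r\<^sup>2} = (\<integral>\<^sup>+y. indicator {..r\<^sup>2} (0 + gap_energy m 0 y) \<partial>?P)"
    using emeasure_eq_nn_integral_indicator[OF gm, of "{..r\<^sup>2}"] by simp
  also have "\<dots> = ennreal (1 / sqrt m) * (\<integral>\<^sup>+y. indicator {..r\<^sup>2} (0 + 0\<^sup>2 / m + (\<Sum>j\<in>{1..<m}. (y j)\<^sup>2)) \<partial>?P)"
    using assms by (intro nn_integral_gap_energy) auto
  also have "(\<integral>\<^sup>+y. indicator {..r\<^sup>2} (0 + 0\<^sup>2 / m + (\<Sum>j\<in>{1..<m}. (y j)\<^sup>2)) \<partial>?P)
      = emeasure ?P ({f. sqrt (\<Sum>j\<in>{1..<m}. (f j)\<^sup>2) \<le> r} \<inter> space ?P)"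
  proof -
    have "{f. sqrt (\<Sum>j\<in>{1..<m}. (f j)\<^sup>2) \<le> r} \<inter> space ?P = {y\<in>space ?P. (\<Sum>j\<in>{1..<m}. (y j)\<^sup>2) \<le> r\<^sup>2}"
      using assms real_sqrt_le_iff[of _ "r\<^sup>2"] by auto
    then show ?thesis
      using emeasure_eq_nn_integral_indicator[of "\<lambda>y. \<Sum>j\<in>{1..<m}. (y j)\<^sup>2" ?P borel "{..r\<^sup>2}"] by simp
  qed
  also have "\<dots> = ennreal (unit_ball_vol (real m - 1) * r ^ (m - 1))"
    using assms by (subst emeasure_cball_aux) (auto simp: of_nat_diff)
  finally show ?thesis using assms by (simp add: ennreal_mult'[symmetric] mult.commute)
qed

section \<open>The set of nearly regular polygons\<close>

lemma chain_restrict [simp]: "chain m z (restrict y {1..<m}) = chain m z y"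
  by (auto simp: chain_def fun_eq_iff)

definition gap :: "nat \<Rightarrow> (nat \<Rightarrow> real) \<Rightarrow> nat \<Rightarrow> real" where
  "gap m y j = chain m (2*pi) y j - chain m (2*pi) y (j - 1)"

lemma gap_measurable [measurable]:
  "(\<lambda>y. gap m y j) \<in> borel_measurable (PiM {1..<m} (\<lambda>_. borel))"
  unfolding gap_def by measurable

lemma sum_gap_upto:
  "0 < m \<Longrightarrow> i \<le> m \<Longrightarrow> (\<Sum>j=1..i. gap m y j) = chain m (2*pi) y i"
  using sum_telescope''[of 0 i "chain m (2*pi) y"] by (simp add: gap_def)

text \<open>Here a is the slope of the tangent at \<mu>, c the local curvature constant and \<kappa>
  the global one. Measurability of g is asked on the whole line because \<open>deficit\<close> is a
  function on all of the product space, where gaps may leave the interval.\<close>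

locale concave_gap_function =
  fixes m :: nat and g :: "real \<Rightarrow> real" and \<mu> a c \<kappa> :: real
  assumes m: "m \<ge> 2" and g_meas [measurable]: "g \<in> borel_measurable borel"
    and \<mu>: "\<mu> = 2*pi / real m"
    and c: "c > 0" and \<kappa>: "\<kappa> > 0"
    and g_gap: "\<And>x. x \<in> {0..2*pi} \<Longrightarrow> \<kappa> * (x - \<mu>)\<^sup>2 \<le> g \<mu> + a * (x - \<mu>) - g x"
    and g_taylor: "((\<lambda>h. (g \<mu> + a * h - g (\<mu> + h)) / h\<^sup>2) \<longlongrightarrow> c) (at 0)"
begin

lemma \<mu>_pos: "\<mu> > 0" and m_\<mu>: "real m * \<mu> = 2*pi"
  using m by (auto simp: \<mu>)

definition deficit :: "(nat \<Rightarrow> real) \<Rightarrow> real" where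
  "deficit y = real m * g \<mu> - (\<Sum>j=1..m. g (gap m y j))"

text \<open>Strict positivity of the gaps makes the vertices distinct, so that one ordering at most
  of given points qualifies and different orderings give disjoint events.\<close>

definition region :: "real \<Rightarrow> (nat \<Rightarrow> real) set" where
  "region s = {y. (\<forall>j\<in>{1..m}. 0 < gap m y j) \<and> deficit y \<le> s}"

text \<open>Points of the product space over \<open>{1..<m}\<close> are undefined outside the index
  set, whereas relative angles form a total function; this lemma mediates between the two.\<close>

lemma region_restrict [simp]: "restrict y {1..<m} \<in> region s \<longleftrightarrow> y \<in> region s"
  by (simp add: region_def deficit_def gap_def del: One_nat_def)

lemma region_measurable [measurable]:
  "Measurable.pred (PiM {1..<m} (\<lambda>_. borel)) (\<lambda>y. y \<in> region s)"
  unfolding region_def deficit_def mem_Collect_eq by measurable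

lemma gap_le_2pi:
  assumes "\<And>j. j \<in> {1..m} \<Longrightarrow> 0 \<le> gap m y j" "j \<in> {1..m}"
  shows "gap m y j \<le> 2*pi"
proof -
  have "gap m y j \<le> (\<Sum>j=1..m. gap m y j)"
    using assms by (intro member_le_sum) auto
  then show ?thesis using m sum_gap_upto[of m m y] by simp
qed

text \<open>The tangent distances are nonnegative, so each single one inherits the bound on their
  sum. The gaps are only assumed nonnegative because the lemma is also what shows, for small s, that
  they are positive.\<close>

lemma gap_near_mu:
  assumes nn: "\<And>j. j \<in> {1..m} \<Longrightarrow> 0 \<le> gap m y j" and s: "deficit y \<le> s" and j: "j \<in> {1..m}"
  shows "\<bar>gap m y j - \<mu>\<bar> \<le> sqrt (s / \<kappa>)"
proof -
  have sum0: "(\<Sum>j=1..m. gap m y j - \<mu>) = 0"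
    using m sum_gap_upto[of m m y] m_\<mu> by (simp add: sum_subtractf)
  have "\<kappa> * (gap m y j - \<mu>)\<^sup>2 \<le> (\<Sum>j=1..m. \<kappa> * (gap m y j - \<mu>)\<^sup>2)"
    using j \<kappa> by (intro member_le_sum) auto
  also have "\<dots> \<le> (\<Sum>j=1..m. g \<mu> + a * (gap m y j - \<mu>) - g (gap m y j))"
    using nn gap_le_2pi[OF nn] by (intro sum_mono g_gap) auto
  also have "\<dots> = deficit y"
    using sum0 by (simp add: deficit_def sum.distrib sum_subtractf sum_distrib_left[symmetric])
  finally have "(gap m y j - \<mu>)\<^sup>2 \<le> s / \<kappa>" using s \<kappa> by (simp add: field_simps)
  then show ?thesis by (metis real_sqrt_abs real_sqrt_le_mono)
qed

lemma chain_near_lattice: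
  assumes y: "y \<in> region s" and j: "j \<le> m"
  shows "\<bar>chain m (2*pi) y j - real j * \<mu>\<bar> \<le> real m * sqrt (s / \<kappa>)"
proof -
  have "chain m (2*pi) y j - real j * \<mu> = (\<Sum>i=1..j. gap m y i - \<mu>)"
    using m j sum_gap_upto[of m j y] by (simp add: sum_subtractf)
  also have "\<bar>\<dots>\<bar> \<le> (\<Sum>i=1..j. sqrt (s / \<kappa>))"
    using y j by (intro order_trans[OF sum_abs sum_mono] gap_near_mu) (auto simp: region_def intro: less_imp_le)
  also have "\<dots> = real j * sqrt (s / \<kappa>)" by simp
  also have "\<dots> \<le> real m * sqrt (s / \<kappa>)"
  proof (intro mult_right_mono)
    \<comment> \<open>The sign of s is not assumed and \<open>sqrt\<close> is negative on negative
      numbers; nonnegativity is read off from the bound for one gap.\<close>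
    have "\<bar>gap m y 1 - \<mu>\<bar> \<le> sqrt (s / \<kappa>)"
      using y m by (intro gap_near_mu) (auto simp: region_def intro: less_imp_le)
    then show "0 \<le> sqrt (s / \<kappa>)" by linarith
  qed (use j in auto)
  finally show ?thesis .
qed

text \<open>Lets the indicators of \<open>{0..<2*pi}\<close> in the density of the relative angles
  be dropped on the region.\<close>

lemma chain_in_region:
  assumes "y \<in> region s" "1 \<le> j" "j < m"
  shows "0 < y j" "y j < 2*pi"
proof -
  have "(\<Sum>i\<in>{1..m}. gap m y i) = (\<Sum>i=1..j. gap m y i) + (\<Sum>i\<in>{Suc j..m}. gap m y i)"
    using sum.ub_add_nat[of 1 j "gap m y" "m - j"] assms by simp
  moreover have "(\<Sum>i=1..j. gap m y i) > 0" "(\<Sum>i\<in>{Suc j..m}. gap m y i) > 0"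
    using assms by (auto intro!: sum_pos simp: region_def)
  ultimately show "0 < y j" "y j < 2*pi"
    using sum_gap_upto[of m m y] sum_gap_upto[of m j y] assms by auto
qed

definition blowup :: "real \<Rightarrow> (nat \<Rightarrow> real) \<Rightarrow> nat \<Rightarrow> real" where
  "blowup \<sigma> x = (\<lambda>j\<in>{1..<m}. real j * \<mu> + \<sigma> * x j)"

lemma gap_blowup:
  assumes "j \<in> {1..m}"
  shows "gap m (blowup \<sigma> x) j = \<mu> + \<sigma> * (chain m 0 x j - chain m 0 x (j - 1))"
proof -
  have "chain m (2*pi) (blowup \<sigma> x) i = real i * \<mu> + \<sigma> * chain m 0 x i" if "i \<le> m" for i
    using that m m_\<mu> by (auto simp: chain_def blowup_def)
  from this[of j] this[of "j - 1"] show ?thesis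
    using assms by (auto simp: gap_def algebra_simps of_nat_diff)
qed

lemma taylor_scaled:
  assumes "\<sigma> \<longlonglongrightarrow> 0" "\<And>n. \<sigma> n > 0"
  shows "(\<lambda>n. (g \<mu> + a * (\<sigma> n * e) - g (\<mu> + \<sigma> n * e)) / (\<sigma> n)\<^sup>2) \<longlonglongrightarrow> c * e\<^sup>2"
\<comment> \<open>For e = 0 the argument stays at \<mu>, where the punctured limit gives no
  information; the quotient is then identically 0.\<close>
proof (cases "e = 0")
  case False
  have "filterlim (\<lambda>n. \<sigma> n * e) (at 0) sequentially"
    using assms False tendsto_mult_right[OF assms(1), of e]
    by (auto simp: filterlim_at order_less_imp_not_eq2)
  from filterlim_compose[OF g_taylor this]
  have "(\<lambda>n. e\<^sup>2 * ((g \<mu> + a * (\<sigma> n * e) - g (\<mu> + \<sigma> n * e)) / (\<sigma> n * e)\<^sup>2)) \<longlonglongrightarrow> e\<^sup>2 * c"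
    by (intro tendsto_intros)
  then show ?thesis using False by (simp add: power_mult_distrib mult.commute)
qed simp

lemma deficit_blowup_tendsto:
  assumes "\<sigma> \<longlonglongrightarrow> 0" "\<And>n. \<sigma> n > 0"
  shows "(\<lambda>n. deficit (blowup (\<sigma> n) x) / (\<sigma> n)\<^sup>2) \<longlonglongrightarrow> c * gap_energy m 0 x"
proof -
  define e where "e j = chain m 0 x j - chain m 0 x (j - 1)" for j
  have e0: "(\<Sum>j=1..m. e j) = 0"
    using sum_telescope''[of 0 m "chain m 0 x"] m by (simp add: e_def)
  have "deficit (blowup (\<sigma> n) x) = (\<Sum>j=1..m. g \<mu> + a * (\<sigma> n * e j) - g (\<mu> + \<sigma> n * e j))" for n
    using e0 by (simp add: deficit_def gap_blowup e_def[symmetric] sum.distrib sum_subtractf sum_distrib_left[symmetric] del: One_nat_def)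
  moreover have "(\<lambda>n. \<Sum>j=1..m. (g \<mu> + a * (\<sigma> n * e j) - g (\<mu> + \<sigma> n * e j)) / (\<sigma> n)\<^sup>2) \<longlonglongrightarrow> (\<Sum>j=1..m. c * (e j)\<^sup>2)"
    using assms by (intro tendsto_sum taylor_scaled)
  ultimately show ?thesis
    by (simp add: gap_energy_def e_def sum_divide_distrib sum_distrib_left)
qed

text \<open>Off the boundary of the ellipsoid the limit of the scaled deficit differs strictly from
  \<tau>, so the comparison is eventually decided. The gaps tend to \<mu> > 0, so their positivity
  is eventually automatic.\<close>

lemma indicator_region_tendsto:
  assumes \<sigma>: "\<sigma> \<longlonglongrightarrow> 0" "\<And>n. \<sigma> n > 0" and ne: "gap_energy m 0 x \<noteq> \<tau> / c"
  shows "(\<lambda>n. indicat_real (region (\<tau> * (\<sigma> n)\<^sup>2)) (blowup (\<sigma> n) x))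
           \<longlonglongrightarrow> indicator {x. gap_energy m 0 x \<le> \<tau> / c} x"
proof -
  have pos: "eventually (\<lambda>n. \<forall>j\<in>{1..m}. 0 < gap m (blowup (\<sigma> n) x) j) sequentially"
  proof (intro eventually_ball_finite ballI)
    fix j assume j: "j \<in> {1..m}"
    have "(\<lambda>n. \<mu> + \<sigma> n * (chain m 0 x j - chain m 0 x (j - 1))) \<longlonglongrightarrow> \<mu> + 0 * (chain m 0 x j - chain m 0 x (j - 1))"
      using \<sigma> by (intro tendsto_intros)
    then show "eventually (\<lambda>n. 0 < gap m (blowup (\<sigma> n) x) j) sequentially"
      using j \<mu>_pos unfolding gap_blowup[OF j] by (intro order_tendstoD(1)) auto
  qed simp
  have lim: "(\<lambda>n. deficit (blowup (\<sigma> n) x) / (\<sigma> n)\<^sup>2) \<longlonglongrightarrow> c * gap_energy m 0 x"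
    by (rule deficit_blowup_tendsto[OF \<sigma>])
  have div: "deficit (blowup (\<sigma> n) x) \<le> \<tau> * (\<sigma> n)\<^sup>2 \<longleftrightarrow> deficit (blowup (\<sigma> n) x) / (\<sigma> n)\<^sup>2 \<le> \<tau>" for n
    using \<sigma>(2)[of n] by (simp add: divide_simps)
  show ?thesis
  proof (cases "gap_energy m 0 x < \<tau> / c")
    case True
    then have "c * gap_energy m 0 x < \<tau>" using c by (simp add: field_simps)
    from order_tendstoD(2)[OF lim this] pos
    have "eventually (\<lambda>n. indicat_real (region (\<tau> * (\<sigma> n)\<^sup>2)) (blowup (\<sigma> n) x) = indicator {x. gap_energy m 0 x \<le> \<tau> / c} x) sequentially"
      by eventually_elim (use True div in \<open>auto simp: region_def\<close>)
    then show ?thesis by (rule tendsto_eventually)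
  next
    case False
    then have *: "gap_energy m 0 x > \<tau> / c" using ne by simp
    then have "c * gap_energy m 0 x > \<tau>" using c by (simp add: field_simps)
    from order_tendstoD(1)[OF lim this] pos
    have "eventually (\<lambda>n. indicat_real (region (\<tau> * (\<sigma> n)\<^sup>2)) (blowup (\<sigma> n) x) = indicator {x. gap_energy m 0 x \<le> \<tau> / c} x) sequentially"
      by eventually_elim (use * div in \<open>auto simp: region_def\<close>)
    then show ?thesis by (rule tendsto_eventually)
  qed
qed

end

section \<open>The mass of nearly regular polygons under rescaling\<close>

locale concave_gap_density = concave_gap_function +
  fixes p :: "real \<Rightarrow> real"
  assumes p_cont: "continuous_on UNIV p"
    and p_periodic: "\<And>x. p (x + 2*pi) = p x"
    and p_nonneg: "\<And>x. 0 \<le> p x"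
begin

lemma p_meas [measurable]: "p \<in> borel_measurable borel"
  using p_cont by (rule borel_measurable_continuous_onI)

lemma p_bounded: "\<exists>B. B \<ge> 0 \<and> (\<forall>x. p x \<le> B)"
proof -
  have "compact (p ` {0..2*pi})"
    using p_cont by (intro compact_continuous_image) (auto intro: continuous_on_subset)
  then obtain B where B: "\<And>x. x \<in> {0..2*pi} \<Longrightarrow> p x \<le> B"
    by (metis bounded_imp_bdd_above compact_imp_bounded bdd_above.unfold imageI)
  have per: "p (x + 2*pi * of_int k) = p x" for x k
  proof (induction k rule: int_induct[where k = 0])
    case (step1 i)
    then show ?case using p_periodic[of "x + 2*pi * of_int i"] by (simp add: algebra_simps)
  next
    case (step2 i)
    then show ?case using p_periodic[of "x + 2*pi * of_int (i - 1)"] by (simp add: algebra_simps)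
  qed simp
  have "p x \<le> B" for x
  proof -
    define k where "k = \<lfloor>x / (2*pi)\<rfloor>"
    have "of_int k \<le> x / (2*pi)" "x / (2*pi) < of_int k + 1" unfolding k_def by linarith+
    then have "x + 2*pi * of_int (- k) \<in> {0..2*pi}" by (simp add: field_simps)
    from B[OF this] show ?thesis by (simp only: per)
  qed
  moreover have "B \<ge> 0" using p_nonneg[of 0] calculation[of 0] by linarith
  ultimately show ?thesis by blast
qed

text \<open>The probability, given a first vertex at angle \<theta>, that m - 1 further points taken
  in a fixed order complete it to a polygon of deficit at most s; \<open>region_mass\<close>
  averages over the first vertex. The probabilistic meaning is established in
  \<open>emeasure_shape_event\<close>.\<close>

definition local_mass :: "real \<Rightarrow> real \<Rightarrow> ennreal" where
  "local_mass s \<theta> = (\<integral>\<^sup>+y. ennreal (indicator (region s) y * (\<Prod>j\<in>{1..<m}. p (\<theta> + y j))) \<partial>PiM {1..<m} (\<lambda>_. lborel))"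

definition region_mass :: "real \<Rightarrow> ennreal" where
  "region_mass s = (\<integral>\<^sup>+\<theta>. ennreal (p \<theta>) * indicator {0..<2*pi} \<theta> * local_mass s \<theta> \<partial>lborel)"

lemma local_mass_measurable [measurable]: "local_mass s \<in> borel_measurable borel"
proof -
  interpret L: product_sigma_finite "\<lambda>_::nat. lborel :: real measure" ..
  interpret P: sigma_finite_measure "PiM {1..<m} (\<lambda>_. lborel :: real measure)"
    by (rule L.sigma_finite) simp
  have [measurable]: "(\<lambda>x. indicat_real (region s) (snd x)) \<in> borel_measurable (borel \<Otimes>\<^sub>M PiM {1..<m} (\<lambda>_. lborel))"
    by (intro borel_measurable_indicator') measurable
  show ?thesis unfolding local_mass_def by measurable
qed

text \<open>Extracts the Jacobian before the limit is taken. What remains is an integral whose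
  integrand is supported in a fixed cube for s = \<tau> * \<sigma>\<twosuperior>, whatever \<sigma>
  is.\<close>

lemma local_mass_blowup:
  assumes \<sigma>: "\<sigma> > 0"
  shows "local_mass s \<theta> = ennreal (\<sigma> ^ (m - 1)) *
     (\<integral>\<^sup>+x. ennreal (indicator (region s) (blowup \<sigma> x) * (\<Prod>j\<in>{1..<m}. p (\<theta> + (real j * \<mu> + \<sigma> * x j))))
        \<partial>PiM {1..<m} (\<lambda>_. lborel))"
proof -
  let ?P = "PiM {1..<m} (\<lambda>_. lborel :: real measure)"
  define H where "H y = ennreal (indicator (region s) y * (\<Prod>j\<in>{1..<m}. p (\<theta> + y j)))" for y
  have [measurable]: "(\<lambda>x. indicat_real (region s) x) \<in> borel_measurable (PiM {1..<m} (\<lambda>_. borel))"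
    by (intro borel_measurable_indicator') measurable
  have H[measurable]: "H \<in> borel_measurable (PiM {1..<m} (\<lambda>_. borel))"
    unfolding H_def by measurable
  have Hb: "H (blowup \<sigma> x) = ennreal (indicator (region s) (blowup \<sigma> x)
      * (\<Prod>j\<in>{1..<m}. p (\<theta> + (real j * \<mu> + \<sigma> * x j))))" for x
  proof -
    have "(\<Prod>j\<in>{1..<m}. p (\<theta> + blowup \<sigma> x j)) = (\<Prod>j\<in>{1..<m}. p (\<theta> + (real j * \<mu> + \<sigma> * x j)))"
      by (intro prod.cong) (auto simp: blowup_def)
    then show ?thesis by (simp only: H_def)
  qed
  have "(\<integral>\<^sup>+x. H (blowup \<sigma> x) \<partial>?P) = (\<integral>\<^sup>+y. H y * (\<Prod>j\<in>{1..<m}. ennreal (1 / \<sigma>)) \<partial>?P)"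
    unfolding blowup_def
  proof (rule nn_integral_PiM_substitution[OF _ _ _ _ _ _ H])
    fix j :: nat and h :: "real \<Rightarrow> ennreal" assume [measurable]: "h \<in> borel_measurable borel"
    have "(\<integral>\<^sup>+x. h x \<partial>lborel) = ennreal \<sigma> * (\<integral>\<^sup>+x. h (real j * \<mu> + \<sigma> * x) \<partial>lborel)"
      using \<sigma> by (subst nn_integral_real_affine[where c = \<sigma> and t = "real j * \<mu>"]) auto
    then have "(\<integral>\<^sup>+x. h x \<partial>lborel) * ennreal (1 / \<sigma>) = ennreal (\<sigma> * (1 / \<sigma>)) * (\<integral>\<^sup>+x. h (real j * \<mu> + \<sigma> * x) \<partial>lborel)"
      using \<sigma> by (simp only: ennreal_mult less_imp_le zero_le_divide_1_iff) (simp add: mult_ac)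
    then show "(\<integral>\<^sup>+x. h (real j * \<mu> + \<sigma> * x) \<partial>lborel) = (\<integral>\<^sup>+y. h y * ennreal (1 / \<sigma>) \<partial>lborel)"
      using \<sigma> by (simp add: nn_integral_multc)
  qed (auto intro: lborel.sigma_finite_measure_axioms)
  also have "\<dots> = local_mass s \<theta> * ennreal ((1 / \<sigma>) ^ (m - 1))"
    using \<sigma> by (simp add: nn_integral_multc ennreal_power local_mass_def H_def[symmetric] del: One_nat_def)
  finally have "ennreal (\<sigma> ^ (m - 1)) * (\<integral>\<^sup>+x. H (blowup \<sigma> x) \<partial>?P)
      = local_mass s \<theta> * (ennreal ((1 / \<sigma>) ^ (m - 1)) * ennreal (\<sigma> ^ (m - 1)))"
    by (simp add: mult_ac)
  also have "ennreal ((1 / \<sigma>) ^ (m - 1)) * ennreal (\<sigma> ^ (m - 1)) = 1"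
    using \<sigma> by (subst ennreal_mult[symmetric]) (auto simp: power_mult_distrib[symmetric])
  finally show ?thesis by (simp only: Hb mult_1_right)
qed

definition polygon_density :: "real \<Rightarrow> real" where
  "polygon_density \<theta> = (\<Prod>j\<in>{1..<m}. p (\<theta> + real j * \<mu>))"

definition ellipsoid_volume :: "real \<Rightarrow> ennreal" where
  "ellipsoid_volume r = emeasure (PiM {1..<m} (\<lambda>_. lborel)) {y\<in>space (PiM {1..<m} (\<lambda>_. lborel)). gap_energy m 0 y \<le> r}"

text \<open>Deficit scales like the square of the offsets, so measured in units of \<sigma> the
  offsets have a bound free of \<sigma>.\<close>

lemma blowup_in_region_bounded:
  assumes "\<sigma> > 0" "blowup \<sigma> x \<in> region (\<tau> * \<sigma>\<^sup>2)" "j \<in> {1..<m}"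
  shows "\<bar>x j\<bar> \<le> real m * sqrt (\<tau> / \<kappa>)"
proof -
  have "\<bar>\<sigma> * x j\<bar> \<le> real m * sqrt (\<tau> * \<sigma>\<^sup>2 / \<kappa>)"
    using chain_near_lattice[OF assms(2), of j] assms(3) by (simp add: blowup_def)
  also have "sqrt (\<tau> * \<sigma>\<^sup>2 / \<kappa>) = \<sigma> * sqrt (\<tau> / \<kappa>)"
    using assms(1) by (simp add: real_sqrt_mult real_sqrt_divide)
  finally have "\<sigma> * \<bar>x j\<bar> \<le> \<sigma> * (real m * sqrt (\<tau> / \<kappa>))"
    using assms(1) by (simp add: abs_mult mult_ac)
  then show ?thesis using assms(1) by simp
qed

context
  fixes \<sigma> :: "nat \<Rightarrow> real" and \<tau> :: real
  assumes \<sigma>: "\<sigma> \<longlonglongrightarrow> 0" "\<And>n. \<sigma> n > 0" and \<tau>: "\<tau> > 0"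
begin

definition scaled_mass :: "nat \<Rightarrow> real \<Rightarrow> ennreal" where
  "scaled_mass n \<theta> = (\<integral>\<^sup>+x. ennreal (indicator (region (\<tau> * (\<sigma> n)\<^sup>2)) (blowup (\<sigma> n) x)
      * (\<Prod>j\<in>{1..<m}. p (\<theta> + (real j * \<mu> + \<sigma> n * x j)))) \<partial>PiM {1..<m} (\<lambda>_. lborel))"

lemma scaled_mass_eq: "local_mass (\<tau> * (\<sigma> n)\<^sup>2) \<theta> = ennreal (\<sigma> n ^ (m - 1)) * scaled_mass n \<theta>"
  unfolding scaled_mass_def by (rule local_mass_blowup[OF \<sigma>(2)])

lemma blowup_measurable [measurable]:
  "blowup s \<in> PiM {1..<m} (\<lambda>_. borel) \<rightarrow>\<^sub>M PiM {1..<m} (\<lambda>_. borel)"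
  unfolding blowup_def[abs_def] by measurable

lemma indicator_blowup_measurable [measurable]:
  "(\<lambda>x. indicat_real (region s) (blowup r x)) \<in> borel_measurable (PiM {1..<m} (\<lambda>_. borel))"
  by (intro borel_measurable_indicator') measurable

lemma scaled_mass_measurable [measurable]: "scaled_mass n \<in> borel_measurable borel"
proof -
  interpret L: product_sigma_finite "\<lambda>_::nat. lborel :: real measure" ..
  interpret P: sigma_finite_measure "PiM {1..<m} (\<lambda>_. lborel :: real measure)"
    by (rule L.sigma_finite) simp
  show ?thesis unfolding scaled_mass_def by measurable
qed

text \<open>The dominating function is written as a product over the coordinates so that its
  integral factorises.\<close>

lemma integrand_bound:
  assumes "\<And>x. p x \<le> B" "B \<ge> 0"
  shows "ennreal (indicator (region (\<tau> * (\<sigma> n)\<^sup>2)) (blowup (\<sigma> n) x)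
      * (\<Prod>j\<in>{1..<m}. p (\<theta> + (real j * \<mu> + \<sigma> n * x j))))
    \<le> (\<Prod>j\<in>{1..<m}. ennreal B * indicator {- (real m * sqrt (\<tau> / \<kappa>))..real m * sqrt (\<tau> / \<kappa>)} (x j))"
proof (cases "blowup (\<sigma> n) x \<in> region (\<tau> * (\<sigma> n)\<^sup>2)")
  case True
  have "(\<Prod>j\<in>{1..<m}. p (\<theta> + (real j * \<mu> + \<sigma> n * x j))) \<le> (\<Prod>j\<in>{1..<m}. B)"
    using assms p_nonneg by (intro prod_mono) auto
  then have "ennreal (\<Prod>j\<in>{1..<m}. p (\<theta> + (real j * \<mu> + \<sigma> n * x j))) \<le> (\<Prod>j\<in>{1..<m}. ennreal B)"
    using assms by (subst prod_ennreal) (auto intro!: ennreal_leI)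
  also have "\<dots> = (\<Prod>j\<in>{1..<m}. ennreal B * indicator {- (real m * sqrt (\<tau> / \<kappa>))..real m * sqrt (\<tau> / \<kappa>)} (x j))"
  proof (intro prod.cong refl)
    fix j assume "j \<in> {1..<m}"
    from blowup_in_region_bounded[OF \<sigma>(2) True this]
    have "x j \<in> {- (real m * sqrt (\<tau> / \<kappa>))..real m * sqrt (\<tau> / \<kappa>)}" by auto
    then show "ennreal B = ennreal B * indicator {- (real m * sqrt (\<tau> / \<kappa>))..real m * sqrt (\<tau> / \<kappa>)} (x j)"
      by simp
  qed
  finally show ?thesis using True by simp
qed simp

lemma nn_integral_bound:
  fixes B R :: real
  shows "(\<integral>\<^sup>+x. (\<Prod>j\<in>{1..<m}. ennreal B * indicator {- R..R} (x j)) \<partial>PiM {1..<m} (\<lambda>_. lborel)) < \<infinity>"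
proof -
  interpret L: product_sigma_finite "\<lambda>_::nat. lborel :: real measure" ..
  have "(\<integral>\<^sup>+x. (\<Prod>j\<in>{1..<m}. ennreal B * indicator {- R..R} (x j)) \<partial>PiM {1..<m} (\<lambda>_. lborel))
      = (\<Prod>j\<in>{1..<m}. \<integral>\<^sup>+x. ennreal B * indicator {- R..R} x \<partial>lborel)"
    by (rule L.product_nn_integral_prod[where f = "\<lambda>_ x::real. ennreal B * indicator {- R..R} x"]) auto
  also have "\<dots> < \<infinity>"
    by (auto simp: nn_integral_cmult ennreal_mult_less_top power_less_top_ennreal emeasure_lborel_Icc_eq)
  finally show ?thesis .
qed

lemma scaled_mass_tendsto:
  "(\<lambda>n. scaled_mass n \<theta>) \<longlonglongrightarrow> ellipsoid_volume (\<tau> / c) * ennreal (polygon_density \<theta>)"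
proof -
  let ?P = "PiM {1..<m} (\<lambda>_. lborel :: real measure)"
  obtain B where B: "B \<ge> 0" "\<And>x. p x \<le> B" using p_bounded by blast
  have cont: "isCont p x" for x using p_cont by (simp add: continuous_on_eq_continuous_at)
  have E[measurable]: "(\<lambda>x. indicat_real {x. gap_energy m 0 x \<le> \<tau> / c} x) \<in> borel_measurable ?P"
    by (intro borel_measurable_indicator') measurable
  have "(\<lambda>n. scaled_mass n \<theta>) \<longlonglongrightarrow>
     (\<integral>\<^sup>+x. ennreal (indicator {x. gap_energy m 0 x \<le> \<tau> / c} x * polygon_density \<theta>) \<partial>?P)"
    unfolding scaled_mass_def
  proof (rule nn_integral_dominated_convergence[where
        w = "\<lambda>x. \<Prod>j\<in>{1..<m}. ennreal B * indicator {- (real m * sqrt (\<tau> / \<kappa>))..real m * sqrt (\<tau> / \<kappa>)} (x j)"])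
    have "AE x in ?P. gap_energy m 0 x \<noteq> \<tau> / c"
    proof (rule AE_I[OF _ emeasure_gap_energy_null[OF m]])
      show "{y \<in> space ?P. gap_energy m 0 y = \<tau> / c} \<in> sets ?P" by measurable
    qed auto
    then show "AE x in ?P. (\<lambda>n. ennreal (indicator (region (\<tau> * (\<sigma> n)\<^sup>2)) (blowup (\<sigma> n) x)
        * (\<Prod>j\<in>{1..<m}. p (\<theta> + (real j * \<mu> + \<sigma> n * x j)))))
       \<longlonglongrightarrow> ennreal (indicator {x. gap_energy m 0 x \<le> \<tau> / c} x * polygon_density \<theta>)"
    proof eventually_elim
      case (elim x)
      have "(\<lambda>n. p (\<theta> + (real j * \<mu> + \<sigma> n * x j))) \<longlonglongrightarrow> p (\<theta> + real j * \<mu>)" for j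
      proof (rule isCont_tendsto_compose[OF cont])
        have "(\<lambda>n. \<theta> + (real j * \<mu> + \<sigma> n * x j)) \<longlonglongrightarrow> \<theta> + (real j * \<mu> + 0 * x j)"
          by (intro tendsto_intros \<sigma>)
        then show "(\<lambda>n. \<theta> + (real j * \<mu> + \<sigma> n * x j)) \<longlonglongrightarrow> \<theta> + real j * \<mu>" by simp
      qed
      then show ?case
        unfolding polygon_density_def
        by (intro tendsto_ennrealI tendsto_mult tendsto_prod indicator_region_tendsto \<sigma> elim)
    qed
    show "(\<lambda>x. ennreal (indicator {x. gap_energy m 0 x \<le> \<tau> / c} x * polygon_density \<theta>)) \<in> borel_measurable ?P"
      by measurable
    show "(\<integral>\<^sup>+x. (\<Prod>j\<in>{1..<m}. ennreal B * indicator {- (real m * sqrt (\<tau> / \<kappa>))..real m * sqrt (\<tau> / \<kappa>)} (x j)) \<partial>?P) < \<infinity>"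
      by (rule nn_integral_bound)
    show "AE x in ?P. ennreal (indicator (region (\<tau> * (\<sigma> n)\<^sup>2)) (blowup (\<sigma> n) x)
        * (\<Prod>j\<in>{1..<m}. p (\<theta> + (real j * \<mu> + \<sigma> n * x j))))
      \<le> (\<Prod>j\<in>{1..<m}. ennreal B * indicator {- (real m * sqrt (\<tau> / \<kappa>))..real m * sqrt (\<tau> / \<kappa>)} (x j))" for n
      by (intro AE_I2 integrand_bound B)
  qed measurable
  also have "(\<integral>\<^sup>+x. ennreal (indicator {x. gap_energy m 0 x \<le> \<tau> / c} x * polygon_density \<theta>) \<partial>?P)
      = (\<integral>\<^sup>+x. indicator {..\<tau> / c} (gap_energy m 0 x) * ennreal (polygon_density \<theta>) \<partial>?P)"
    by (intro nn_integral_cong) (auto simp: indicator_def)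
  also have "\<dots> = (\<integral>\<^sup>+x. indicator {..\<tau> / c} (gap_energy m 0 x) \<partial>?P) * ennreal (polygon_density \<theta>)"
    by (intro nn_integral_multc) measurable
  also have "(\<integral>\<^sup>+x. indicator {..\<tau> / c} (gap_energy m 0 x) \<partial>?P) = ellipsoid_volume (\<tau> / c)"
    unfolding ellipsoid_volume_def
    using emeasure_eq_nn_integral_indicator[of "gap_energy m 0" ?P borel "{..\<tau> / c}"]
    by (simp del: One_nat_def)
  finally show ?thesis .
qed

lemma region_mass_tendsto:
  assumes p_int: "(\<integral>\<^sup>+\<theta>. ennreal (p \<theta>) * indicator {0..<2*pi} \<theta> \<partial>lborel) < \<infinity>"
  shows "(\<lambda>n. region_mass (\<tau> * (\<sigma> n)\<^sup>2) / ennreal (\<sigma> n ^ (m - 1))) \<longlonglongrightarrow>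
     ellipsoid_volume (\<tau> / c) * (\<integral>\<^sup>+\<theta>. ennreal (p \<theta> * polygon_density \<theta>) * indicator {0..<2*pi} \<theta> \<partial>lborel)"
proof -
  obtain B where B: "B \<ge> 0" "\<And>x. p x \<le> B" using p_bounded by blast
  \<comment> \<open>This C bounds \<open>scaled_mass\<close> uniformly in n and \<theta>, so p times
    C dominates the outer integral over the first vertex.\<close>
  define C where "C = (\<integral>\<^sup>+x. (\<Prod>j\<in>{1..<m}. ennreal B * indicator {- (real m * sqrt (\<tau> / \<kappa>))..real m * sqrt (\<tau> / \<kappa>)} (x j))
      \<partial>PiM {1..<m} (\<lambda>_. lborel))"
  have C: "C < \<infinity>" unfolding C_def by (rule nn_integral_bound)
  have [measurable]: "polygon_density \<in> borel_measurable borel"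
    unfolding polygon_density_def[abs_def] by measurable
  have bound: "scaled_mass n \<theta> \<le> C" for n \<theta>
    unfolding scaled_mass_def C_def by (intro nn_integral_mono integrand_bound B)
  have *: "region_mass (\<tau> * (\<sigma> n)\<^sup>2) / ennreal (\<sigma> n ^ (m - 1))
      = (\<integral>\<^sup>+\<theta>. ennreal (p \<theta>) * indicator {0..<2*pi} \<theta> * scaled_mass n \<theta> \<partial>lborel)" for n
  proof -
    have "region_mass (\<tau> * (\<sigma> n)\<^sup>2)
      = (\<integral>\<^sup>+\<theta>. ennreal (\<sigma> n ^ (m - 1)) * (ennreal (p \<theta>) * indicator {0..<2*pi} \<theta> * scaled_mass n \<theta>) \<partial>lborel)"
      unfolding region_mass_def scaled_mass_eq by (intro nn_integral_cong) (simp add: mult_ac)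
    also have "\<dots> = ennreal (\<sigma> n ^ (m - 1)) * (\<integral>\<^sup>+\<theta>. ennreal (p \<theta>) * indicator {0..<2*pi} \<theta> * scaled_mass n \<theta> \<partial>lborel)"
      by (intro nn_integral_cmult) measurable
    finally show ?thesis
      unfolding mult.commute[of "ennreal (\<sigma> n ^ (m - 1))"]
      using \<sigma>(2)[of n] by (simp only:) (intro ennreal_mult_divide_eq, auto)
  qed
  have "(\<lambda>n. \<integral>\<^sup>+\<theta>. ennreal (p \<theta>) * indicator {0..<2*pi} \<theta> * scaled_mass n \<theta> \<partial>lborel) \<longlonglongrightarrow>
     (\<integral>\<^sup>+\<theta>. ennreal (p \<theta>) * indicator {0..<2*pi} \<theta> * (ellipsoid_volume (\<tau> / c) * ennreal (polygon_density \<theta>)) \<partial>lborel)"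
  proof (rule nn_integral_dominated_convergence[where w = "\<lambda>\<theta>. ennreal (p \<theta>) * indicator {0..<2*pi} \<theta> * C"])
    show "(\<integral>\<^sup>+\<theta>. ennreal (p \<theta>) * indicator {0..<2*pi} \<theta> * C \<partial>lborel) < \<infinity>"
      using p_int C by (subst nn_integral_multc) (auto simp: ennreal_mult_less_top)
    show "AE \<theta> in lborel. ennreal (p \<theta>) * indicator {0..<2*pi} \<theta> * scaled_mass n \<theta>
        \<le> ennreal (p \<theta>) * indicator {0..<2*pi} \<theta> * C" for n
      using bound by (auto intro!: mult_left_mono)
    show "AE \<theta> in lborel. (\<lambda>n. ennreal (p \<theta>) * indicator {0..<2*pi} \<theta> * scaled_mass n \<theta>)
       \<longlonglongrightarrow> ennreal (p \<theta>) * indicator {0..<2*pi} \<theta> * (ellipsoid_volume (\<tau> / c) * ennreal (polygon_density \<theta>))"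
      by (intro AE_I2 ennreal_tendsto_cmult scaled_mass_tendsto) (auto simp: indicator_def)
  qed measurable
  also have "(\<integral>\<^sup>+\<theta>. ennreal (p \<theta>) * indicator {0..<2*pi} \<theta> * (ellipsoid_volume (\<tau> / c) * ennreal (polygon_density \<theta>)) \<partial>lborel)
     = (\<integral>\<^sup>+\<theta>. ellipsoid_volume (\<tau> / c) * (ennreal (p \<theta> * polygon_density \<theta>) * indicator {0..<2*pi} \<theta>) \<partial>lborel)"
    using p_nonneg by (intro nn_integral_cong) (simp add: ennreal_mult' mult_ac)
  also have "\<dots> = ellipsoid_volume (\<tau> / c) * (\<integral>\<^sup>+\<theta>. ennreal (p \<theta> * polygon_density \<theta>) * indicator {0..<2*pi} \<theta> \<partial>lborel)"
    by (intro nn_integral_cmult) measurable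
  finally show ?thesis unfolding * .
qed

end
end

section \<open>The side kernel in terms of angles\<close>

text \<open>The representative of x modulo 2*pi in [0, 2*pi), expressed through
  \<open>Arg2pi\<close> to match \<open>ccw_angle\<close>.\<close>

definition wrap :: "real \<Rightarrow> real" where
  "wrap x = Arg2pi (cis x)"

lemma wrap_bounds: "0 \<le> wrap x" "wrap x < 2*pi"
  by (simp_all add: wrap_def Arg2pi_ge_0 Arg2pi_lt_2pi)

lemma cis_Arg2pi: "norm z = 1 \<Longrightarrow> cis (Arg2pi z) = z"
  using complex_norm_eq_1_exp[of z] by (simp add: cis_conv_exp)

lemma Arg2pi_cis: "0 \<le> x \<Longrightarrow> x < 2*pi \<Longrightarrow> Arg2pi (cis x) = x"
  by (rule Arg2pi_unique[of 1]) (auto simp: cis_conv_exp)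

lemma wrap_id: "0 \<le> x \<Longrightarrow> x < 2*pi \<Longrightarrow> wrap x = x"
  by (simp add: wrap_def Arg2pi_cis)

lemma wrap_add_2pi: "wrap (x + 2*pi) = wrap x"
proof -
  have "cis (x + 2*pi) = cis x" by (simp add: complex_eq_iff)
  then show ?thesis by (simp add: wrap_def)
qed

lemma wrap_eq_add_multiple: obtains k :: int where "wrap x = x + 2*pi * of_int k"
proof -
  have "cis (wrap x) = cis x"
    unfolding wrap_def by (rule cis_Arg2pi) simp
  then have "sin (wrap x) = sin x \<and> cos (wrap x) = cos x"
    by (metis cis.sel)
  then obtain k :: int where "wrap x = x + 2*pi * of_int k"
    using sin_cos_eq_iff[of "wrap x" x] by (auto simp: mult_ac)
  then show ?thesis by (rule that)
qed

lemma ccw_angle_eq_wrap: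
  "norm u = 1 \<Longrightarrow> norm v = 1 \<Longrightarrow> ccw_angle u v = wrap (Arg2pi v - Arg2pi u)"
  using cis_divide[of "Arg2pi v" "Arg2pi u"] by (simp add: ccw_angle_def wrap_def cis_Arg2pi)

text \<open>For a list \<open>xs\<close> of indices, \<open>rel_angle \<theta> xs j\<close> is the angle called \<open>\<beta>\<^sub>j\<close> in the informal context.\<close>

definition rel_angle :: "(nat \<Rightarrow> real) \<Rightarrow> nat list \<Rightarrow> nat \<Rightarrow> real" where
  "rel_angle \<theta> xs j = wrap (\<theta> (xs ! j) - \<theta> (xs ! 0))"

lemma rel_angle_bounds: "0 \<le> rel_angle \<theta> xs j" "rel_angle \<theta> xs j < 2*pi"
  by (simp_all add: rel_angle_def wrap_bounds)

lemma chain_rel_angle: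
  assumes "j < m"
  shows "chain m z (rel_angle \<theta> xs) j = wrap (\<theta> (xs ! j) - \<theta> (xs ! 0))"
  using assms by (auto simp: chain_def rel_angle_def wrap_id)

text \<open>The padded list is sorted and runs from 0 to 2*pi, so its consecutive differences stay
  in the interval. This permits exchanging g for a Borel function that agrees with it there.\<close>

lemma side_h_cong:
  assumes "set bs \<subseteq> {0..2*pi}" "\<And>x. x \<in> {0..2*pi} \<Longrightarrow> g x = g' x"
  shows "side_h g bs = side_h g' bs"
proof -
  define cs where "cs = 0 # sort bs @ [2*pi]"
  have "sorted cs" using assms(1) by (auto simp: cs_def sorted_append)
  have len: "length cs = length bs + 2" by (simp add: cs_def)
  have "set cs \<subseteq> {0..2*pi}" using assms(1) by (auto simp: cs_def)
  have "cs ! i - cs ! (i - 1) \<in> {0..2*pi}" if "i \<in> {1..length bs + 1}" for i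
  proof -
    have i: "i < length cs" "i - 1 < length cs" using that len by auto
    then have "cs ! (i - 1) \<le> cs ! i" using \<open>sorted cs\<close> by (intro sorted_nth_mono) auto
    moreover have "cs ! i \<in> {0..2*pi}" "cs ! (i - 1) \<in> {0..2*pi}"
      using nth_mem[OF i(1)] nth_mem[OF i(2)] \<open>set cs \<subseteq> {0..2*pi}\<close> by blast+
    ultimately show ?thesis by simp
  qed
  then show ?thesis
    unfolding side_h_def Let_def cs_def[symmetric] by (intro sum.cong refl assms(2))
qed

lemma side_kernel_cong:
  assumes "\<And>x. x \<in> {0..2*pi} \<Longrightarrow> g x = g' x"
  shows "side_kernel g us = side_kernel g' us"
  unfolding side_kernel_def
  by (intro side_h_cong assms) (auto simp: ccw_angle_def Arg2pi_ge_0 intro: less_imp_le[OF Arg2pi_lt_2pi])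

lemma side_h_eq_sum_gap:
  assumes m: "m \<ge> 2" and bs: "length bs = m - 1" and y: "\<And>j. 1 \<le> j \<Longrightarrow> j < m \<Longrightarrow> y j = sort bs ! (j - 1)"
  shows "side_h g bs = (\<Sum>j=1..m. g (gap m y j))"
proof -
  have nth_chain: "(0 # sort bs @ [2*pi]) ! j = chain m (2*pi) y j" if "j \<le> m" for j
  proof (cases "j = 0")
    case False
    then have "(0 # sort bs @ [2*pi]) ! j = (sort bs @ [2*pi]) ! (j - 1)" by (simp add: nth_Cons')
    also have "\<dots> = (if j < m then sort bs ! (j - 1) else 2*pi)"
      using that False m bs by (auto simp: nth_append)
    finally show ?thesis using y[of j] False by (auto simp: chain_def)
  qed simp
  then have "(\<Sum>j=1..m. g ((0 # sort bs @ [2*pi]) ! j - (0 # sort bs @ [2*pi]) ! (j - 1))) = (\<Sum>j=1..m. g (gap m y j))"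
    unfolding gap_def
  proof (intro sum.cong refl)
    fix j assume "j \<in> {1..m}"
    then have "j \<le> m" "j - 1 \<le> m" by auto
    then show "g ((0 # sort bs @ [2*pi]) ! j - (0 # sort bs @ [2*pi]) ! (j - 1))
        = g (chain m (2*pi) y j - chain m (2*pi) y (j - 1))"
      by (simp only: nth_chain)
  qed
  then show ?thesis
    using m bs by (simp add: side_h_def Let_def)
qed

lemma Min_Cons_permutation:
  assumes "finite B" "B \<noteq> {}" "ys \<in> permutations_of_set (B - {Min B})"
  shows "set (Min B # ys) = B" "distinct (Min B # ys)" "length (Min B # ys) = card B"
proof -
  have ys: "set ys = B - {Min B}" "distinct ys"
    using assms(3) by (simp_all add: permutations_of_set_def)
  have "Min B \<in> B" using assms by simp
  then show S: "set (Min B # ys) = B" unfolding list.set ys(1) by blast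
  show D: "distinct (Min B # ys)" unfolding distinct.simps ys(1) using ys(2) by blast
  show "length (Min B # ys) = card B" using distinct_card[OF D] unfolding S by (rule sym)
qed

context concave_gap_function
begin

lemma region_strictly_sorted:
  assumes "length ys = m - 1" "rel_angle \<theta> (k # ys) \<in> region s"
  shows "sorted_wrt (<) (map (\<lambda>i. wrap (\<theta> i - \<theta> k)) ys)"
proof (subst sorted_wrt_iff_nth_Suc_transp)
  show "\<forall>i. Suc i < length (map (\<lambda>i. wrap (\<theta> i - \<theta> k)) ys) \<longrightarrow>
      map (\<lambda>i. wrap (\<theta> i - \<theta> k)) ys ! i < map (\<lambda>i. wrap (\<theta> i - \<theta> k)) ys ! Suc i"
  proof (intro allI impI)
    fix i assume i: "Suc i < length (map (\<lambda>i. wrap (\<theta> i - \<theta> k)) ys)"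
    \<comment> \<open>Position 0 of the list is k, so entries i and i + 1 of \<open>ys\<close> bound
      the gap with index i + 2.\<close>
    then have "0 < gap m (rel_angle \<theta> (k # ys)) (Suc (Suc i))"
      using assms by (auto simp: region_def)
    then show "map (\<lambda>i. wrap (\<theta> i - \<theta> k)) ys ! i < map (\<lambda>i. wrap (\<theta> i - \<theta> k)) ys ! Suc i"
      using i assms by (simp add: gap_def rel_angle_def)
  qed
qed auto

text \<open>An arrangement along which pairwise distinct keys increase is unique. This makes the
  events of different orderings disjoint.\<close>

lemma region_perm_unique:
  assumes "length ys = m - 1" "length ys' = m - 1" "set ys = set ys'"
    and "rel_angle \<theta> (k # ys) \<in> region s" "rel_angle \<theta> (k # ys') \<in> region s'"
  shows "ys = ys'"
proof -
  have "sorted (map (\<lambda>i. wrap (\<theta> i - \<theta> k)) ys)" "distinct (map (\<lambda>i. wrap (\<theta> i - \<theta> k)) ys)"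
    "sorted (map (\<lambda>i. wrap (\<theta> i - \<theta> k)) ys')" "distinct (map (\<lambda>i. wrap (\<theta> i - \<theta> k)) ys')"
    using region_strictly_sorted[OF assms(1,4)] region_strictly_sorted[OF assms(2,5)]
    by (simp_all only: strict_sorted_iff)
  then show ?thesis
    using assms(3) by (intro map_sorted_distinct_set_unique) (auto simp: distinct_map)
qed

text \<open>The kernel sorts the angles whatever their order and allows ties, whereas the region
  demands strictly positive gaps. The smallness of s bridges the two: it keeps every gap within less
  than \<mu> of \<mu>, so ties cannot occur and the sorted order lies in the region. Conversely an
  ordering in the region is the sorted one.\<close>

lemma side_kernel_region_iff:
  fixes u :: "nat \<Rightarrow> complex"
  assumes len: "length xs = m" and norm: "\<And>i. i \<in> set xs \<Longrightarrow> norm (u i) = 1" and s: "sqrt (s / \<kappa>) < \<mu>"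
  defines "\<theta> \<equiv> (\<lambda>i. Arg2pi (u i))"
  shows "real m * g \<mu> - side_kernel g (map u xs) \<le> s \<longleftrightarrow>
    (\<exists>ys. mset ys = mset (tl xs) \<and> rel_angle \<theta> (hd xs # ys) \<in> region s)"
proof -
  define k where "k = hd xs"
  obtain zs where xs: "xs = k # zs" using len m by (cases xs) (auto simp: k_def)
  define f where "f i = wrap (\<theta> i - \<theta> k)" for i
  have ker: "side_kernel g (map u xs) = side_h g (map f zs)"
  proof -
    have "map (ccw_angle (hd (map u xs))) (tl (map u xs)) = map f zs"
      using norm unfolding xs by (auto simp: f_def \<theta>_def ccw_angle_eq_wrap)
    then show ?thesis by (simp add: side_kernel_def)
  qed
  have sorted_case: "real m * g \<mu> - side_kernel g (map u xs) = deficit (rel_angle \<theta> (k # ys))"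
    if "mset ys = mset zs" "sorted (map f ys)" for ys
  proof -
    have "sort (map f zs) = map f ys"
      using that by (intro properties_for_sort) auto
    moreover have "length ys = m - 1" using that(1) len xs by (metis diff_Suc_1 length_Cons size_mset)
    moreover have "length zs = m - 1" using len xs by auto
    ultimately have "side_h g (map f zs) = (\<Sum>j=1..m. g (gap m (rel_angle \<theta> (k # ys)) j))"
      using m by (intro side_h_eq_sum_gap) (auto simp: rel_angle_def f_def nth_Cons')
    then show ?thesis by (simp add: deficit_def ker)
  qed
  show ?thesis
  proof
    assume *: "real m * g \<mu> - side_kernel g (map u xs) \<le> s"
    define ys where "ys = sort_key f zs"
    have ys: "mset ys = mset zs" "sorted (map f ys)" by (simp_all add: ys_def)
    have len_ys: "length ys = m - 1" using len xs by (simp add: ys_def)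
    have d: "deficit (rel_angle \<theta> (k # ys)) \<le> s" using * sorted_case[OF ys] by simp
    \<comment> \<open>The first gap is nonnegative because relative angles are, the last because
      they stay below 2*pi, the others by sorting.\<close>
    have nn: "0 \<le> gap m (rel_angle \<theta> (k # ys)) j" if "j \<in> {1..m}" for j
    proof (cases "j = m")
      case True
      then show ?thesis
        using m rel_angle_bounds[of \<theta> "k # ys" "m - 1"] by (simp add: gap_def)
    next
      case False
      show ?thesis
      proof (cases "j = 1")
        case True
        then show ?thesis using m rel_angle_bounds by (simp add: gap_def)
      next
        case F: False
        have "map f ys ! (j - 2) \<le> map f ys ! (j - 1)"
          using ys(2) that False F len_ys by (intro sorted_nth_mono) auto
        moreover have "(k # ys) ! j = ys ! (j - 1)" "(k # ys) ! (j - 1) = ys ! (j - 2)"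
          using that F by (auto simp: nth_Cons' numeral_2_eq_2)
        moreover have "j - 1 < length ys" "j - 2 < length ys" using that False F len_ys by auto
        ultimately have "rel_angle \<theta> (k # ys) (j - 1) \<le> rel_angle \<theta> (k # ys) j"
          by (simp add: rel_angle_def f_def)
        moreover have "chain m (2*pi) (rel_angle \<theta> (k # ys)) i = rel_angle \<theta> (k # ys) i"
          if "i \<in> {j - 1, j}" for i
          using that \<open>j \<in> {1..m}\<close> False F by (intro chain_simps) auto
        ultimately show ?thesis by (simp add: gap_def)
      qed
    qed
    have "0 < gap m (rel_angle \<theta> (k # ys)) j" if "j \<in> {1..m}" for j
      using gap_near_mu[OF nn d that] s by linarith
    then have "rel_angle \<theta> (k # ys) \<in> region s" using d by (simp add: region_def)
    then show "\<exists>ys. mset ys = mset (tl xs) \<and> rel_angle \<theta> (hd xs # ys) \<in> region s"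
      using ys(1) xs by auto
  next
    assume "\<exists>ys. mset ys = mset (tl xs) \<and> rel_angle \<theta> (hd xs # ys) \<in> region s"
    then obtain ys where ys: "mset ys = mset zs" "rel_angle \<theta> (k # ys) \<in> region s"
      unfolding xs by auto
    have "length ys = m - 1" using ys(1) len xs by (metis diff_Suc_1 length_Cons size_mset)
    then have "sorted (map f ys)"
      using region_strictly_sorted[OF _ ys(2)] by (auto simp: f_def[abs_def] strict_sorted_iff)
    from sorted_case[OF ys(1) this] show "real m * g \<mu> - side_kernel g (map u xs) \<le> s"
      using ys(2) by (simp add: region_def)
  qed
qed

text \<open>
  Fixing the smallest index as the first vertex leaves exactly one ordering of the remaining ones for
  which the angles increase, so the orderings below describe disjoint events.
\<close>

definition near_polygon :: "real \<Rightarrow> (nat \<Rightarrow> real) \<Rightarrow> nat set \<Rightarrow> bool" where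
  "near_polygon s \<theta> A \<longleftrightarrow>
     (\<exists>ys\<in>permutations_of_set (A - {Min A}). rel_angle \<theta> (Min A # ys) \<in> region s)"

text \<open>A maximum over a finite nonempty set reaches a level iff some element does; n \<ge> m
  provides nonemptiness. Increasing index lists correspond to m-element sets, and the head of such a
  list is the minimum that \<open>near_polygon\<close> uses as first vertex.\<close>

lemma U_max_le_iff:
  fixes u :: "nat \<Rightarrow> complex"
  assumes n: "n \<ge> m" and norm: "\<And>i. i \<ge> 1 \<Longrightarrow> norm (u i) = 1" and s: "sqrt (s / \<kappa>) < \<mu>"
  shows "real m * g \<mu> - U_max (side_kernel g) m n u \<le> s \<longleftrightarrow>
    (\<exists>A. A \<subseteq> {1..n} \<and> card A = m \<and> near_polygon s (\<lambda>i. Arg2pi (u i)) A)"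
proof -
  let ?I = "{is. length is = m \<and> sorted_wrt (<) is \<and> set is \<subseteq> {1..n}}"
  have fin: "finite ?I"
    by (rule finite_subset[OF _ finite_lists_length_eq[of "{1..n}" m]]) auto
  have "[1..<Suc m] \<in> ?I" using n m by (auto simp del: upt_Suc)
  then have ne: "?I \<noteq> {}" by blast
  have "real m * g \<mu> - U_max (side_kernel g) m n u \<le> s \<longleftrightarrow>
     real m * g \<mu> - s \<le> Max ((\<lambda>is. side_kernel g (map u is)) ` ?I)"
    by (auto simp: U_max_def)
  also have "\<dots> \<longleftrightarrow> (\<exists>is\<in>?I. real m * g \<mu> - side_kernel g (map u is) \<le> s)"
    using fin ne by (subst Max_ge_iff) (auto simp: algebra_simps)
  also have "\<dots> \<longleftrightarrow> (\<exists>is\<in>?I. near_polygon s (\<lambda>i. Arg2pi (u i)) (set is))"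
  proof (intro bex_cong refl)
    fix xs assume xs: "xs \<in> ?I"
    then obtain k zs where k: "xs = k # zs" using m by (cases xs) auto
    have srt: "sorted_wrt (<) (k # zs)" using xs k by auto
    then have hd: "Min (set xs) = k" unfolding k by (intro Min_eqI) (auto intro: less_imp_le)
    have dist: "distinct zs" "k \<notin> set zs"
    proof -
      have "distinct (k # zs)" using srt strict_sorted_iff by blast
      then show "distinct zs" "k \<notin> set zs" by auto
    qed
    have "mset ys = mset zs \<longleftrightarrow> ys \<in> permutations_of_set (set xs - {Min (set xs)})" for ys
    proof -
      have "set xs - {Min (set xs)} = set zs" using dist hd by (auto simp: k)
      then show ?thesis
        using dist mset_eq_setD[of ys zs] mset_eq_imp_distinct_iff[of ys zs] set_eq_iff_mset_eq_distinct[of ys zs]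
        by (auto simp: permutations_of_set_def)
    qed
    then show "real m * g \<mu> - side_kernel g (map u xs) \<le> s \<longleftrightarrow> near_polygon s (\<lambda>i. Arg2pi (u i)) (set xs)"
      using xs norm s hd unfolding near_polygon_def
      by (subst side_kernel_region_iff) (auto simp: k Bex_def)
  qed
  also have "\<dots> \<longleftrightarrow> (\<exists>A. A \<subseteq> {1..n} \<and> card A = m \<and> near_polygon s (\<lambda>i. Arg2pi (u i)) A)"
  proof
    assume "\<exists>is\<in>?I. near_polygon s (\<lambda>i. Arg2pi (u i)) (set is)"
    then obtain xs where "xs \<in> ?I" "near_polygon s (\<lambda>i. Arg2pi (u i)) (set xs)" by blast
    then show "\<exists>A. A \<subseteq> {1..n} \<and> card A = m \<and> near_polygon s (\<lambda>i. Arg2pi (u i)) A"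
      by (intro exI[of _ "set xs"]) (auto simp: distinct_card strict_sorted_iff)
  next
    assume "\<exists>A. A \<subseteq> {1..n} \<and> card A = m \<and> near_polygon s (\<lambda>i. Arg2pi (u i)) A"
    then obtain A where A: "A \<subseteq> {1..n}" "card A = m" "near_polygon s (\<lambda>i. Arg2pi (u i)) A" by blast
    then have "finite A" using finite_subset by blast
    then have "sorted_list_of_set A \<in> ?I" "set (sorted_list_of_set A) = A"
      using A by auto
    then show "\<exists>is\<in>?I. near_polygon s (\<lambda>i. Arg2pi (u i)) (set is)"
      using A(3) by (metis (no_types, lifting))
  qed
  finally show ?thesis .
qed

text \<open>Both vertices are compared with the first one, hence the factor 2. Full turns introduced
  by \<open>wrap\<close> are multiples of \<mu> because 2*pi = m * \<mu>, so k absorbs them.\<close>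

lemma near_polygon_pairwise:
  assumes A: "finite A" "card A = m" and np: "near_polygon s \<theta> A" and ij: "i \<in> A" "j \<in> A"
  obtains k :: int where "\<bar>\<theta> i - \<theta> j - of_int k * \<mu>\<bar> \<le> 2 * real m * sqrt (s / \<kappa>)"
proof -
  obtain ys where ys: "ys \<in> permutations_of_set (A - {Min A})" "rel_angle \<theta> (Min A # ys) \<in> region s"
    using np by (auto simp: near_polygon_def)
  define xs where "xs = Min A # ys"
  have "A \<noteq> {}" using ij by auto
  note Min_Cons_permutation[OF A(1) this ys(1)]
  then have "set xs = A" and len: "length xs = m" using A(2) unfolding xs_def by (simp_all only:)
  have *: "\<exists>k::int. \<bar>\<theta> i - \<theta> (xs ! 0) - of_int k * \<mu>\<bar> \<le> real m * sqrt (s / \<kappa>)" if i: "i \<in> A" for i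
  proof -
    obtain q where q: "q < m" "xs ! q = i" using i \<open>set xs = A\<close> len by (metis in_set_conv_nth)
    obtain k :: int where k: "wrap (\<theta> i - \<theta> (xs ! 0)) = \<theta> i - \<theta> (xs ! 0) + 2*pi * of_int k"
      by (rule wrap_eq_add_multiple)
    have "\<bar>wrap (\<theta> i - \<theta> (xs ! 0)) - real q * \<mu>\<bar> \<le> real m * sqrt (s / \<kappa>)"
      using chain_near_lattice[OF ys(2), of q] q chain_rel_angle[OF q(1), of "2*pi" \<theta> xs]
      by (simp add: xs_def)
    also have "wrap (\<theta> i - \<theta> (xs ! 0)) - real q * \<mu> = \<theta> i - \<theta> (xs ! 0) - of_int (int q - int m * k) * \<mu>"
      unfolding k m_\<mu>[symmetric] by (simp add: algebra_simps)
    finally show ?thesis by blast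
  qed
  from *[OF ij(1)] *[OF ij(2)] obtain k l :: int where
    "\<bar>\<theta> i - \<theta> (xs ! 0) - of_int k * \<mu>\<bar> \<le> real m * sqrt (s / \<kappa>)"
    "\<bar>\<theta> j - \<theta> (xs ! 0) - of_int l * \<mu>\<bar> \<le> real m * sqrt (s / \<kappa>)" by blast
  then have "\<bar>\<theta> i - \<theta> j - of_int (k - l) * \<mu>\<bar> \<le> 2 * real m * sqrt (s / \<kappa>)"
    by (simp add: algebra_simps abs_le_iff)
  then show ?thesis by (rule that)
qed

end

section \<open>Probabilities of nearly regular polygons\<close>

lemma nn_integral_periodic_shift:
  fixes k :: "real \<Rightarrow> ennreal"
  assumes [measurable]: "k \<in> borel_measurable borel" and per: "\<And>x. k (x + l) = k x"
    and \<theta>: "0 \<le> \<theta>" "\<theta> \<le> l"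
  shows "(\<integral>\<^sup>+x. k x * indicator {- \<theta>..<l - \<theta>} x \<partial>lborel) = (\<integral>\<^sup>+x. k x * indicator {0..<l} x \<partial>lborel)"
proof -
  have "(\<integral>\<^sup>+x. k x * indicator {- \<theta>..<l - \<theta>} x \<partial>lborel)
      = (\<integral>\<^sup>+x. k x * indicator {- \<theta>..<0} x + k x * indicator {0..<l - \<theta>} x \<partial>lborel)"
    using \<theta> by (intro nn_integral_cong) (auto simp: indicator_def)
  also have "\<dots> = (\<integral>\<^sup>+x. k x * indicator {- \<theta>..<0} x \<partial>lborel) + (\<integral>\<^sup>+x. k x * indicator {0..<l - \<theta>} x \<partial>lborel)"
    by (intro nn_integral_add) auto
  also have "(\<integral>\<^sup>+x. k x * indicator {- \<theta>..<0} x \<partial>lborel) = (\<integral>\<^sup>+x. k x * indicator {l - \<theta>..<l} x \<partial>lborel)"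
  proof -
    have "(\<integral>\<^sup>+x. k x * indicator {l - \<theta>..<l} x \<partial>lborel)
        = (\<integral>\<^sup>+x. k (l + 1 * x) * indicator {l - \<theta>..<l} (l + 1 * x) \<partial>lborel)"
      by (subst nn_integral_real_affine[where c = 1 and t = l]) auto
    also have "\<dots> = (\<integral>\<^sup>+x. k x * indicator {- \<theta>..<0} x \<partial>lborel)"
      using per by (intro nn_integral_cong) (auto simp: indicator_def add.commute)
    finally show ?thesis by simp
  qed
  also have "(\<integral>\<^sup>+x. k x * indicator {l - \<theta>..<l} x \<partial>lborel) + (\<integral>\<^sup>+x. k x * indicator {0..<l - \<theta>} x \<partial>lborel)
      = (\<integral>\<^sup>+x. k x * indicator {l - \<theta>..<l} x + k x * indicator {0..<l - \<theta>} x \<partial>lborel)"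
    by (intro nn_integral_add[symmetric]) auto
  also have "\<dots> = (\<integral>\<^sup>+x. k x * indicator {0..<l} x \<partial>lborel)"
    using \<theta> by (intro nn_integral_cong) (auto simp: indicator_def)
  finally show ?thesis .
qed

lemma (in prob_space) indep_var_cong_space:
  assumes "indep_var S X T Y" "\<And>\<omega>. \<omega> \<in> space M \<Longrightarrow> X \<omega> = X' \<omega>" "\<And>\<omega>. \<omega> \<in> space M \<Longrightarrow> Y \<omega> = Y' \<omega>"
  shows "indep_var S X' T Y'"
proof -
  have "distr M S X = distr M S X'" "distr M T Y = distr M T Y'"
    "distr M (S \<Otimes>\<^sub>M T) (\<lambda>x. (X x, Y x)) = distr M (S \<Otimes>\<^sub>M T) (\<lambda>x. (X' x, Y' x))"
    using assms(2,3) by (auto intro!: distr_cong)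
  moreover have "X \<in> M \<rightarrow>\<^sub>M S \<longleftrightarrow> X' \<in> M \<rightarrow>\<^sub>M S" "Y \<in> M \<rightarrow>\<^sub>M T \<longleftrightarrow> Y' \<in> M \<rightarrow>\<^sub>M T"
    using assms(2,3) by (auto intro!: measurable_cong)
  ultimately show ?thesis using assms(1) by (simp add: indep_var_distribution_eq)
qed

text \<open>\<open>Arg2pi\<close> is continuous off the closed nonnegative real axis and constantly
  0 on it.\<close>

lemma Arg2pi_measurable [measurable]: "Arg2pi \<in> borel_measurable borel"
proof -
  have cl: "closed {z::complex. Im z = 0 \<and> 0 \<le> Re z}"
    by (intro closed_Collect_conj closed_Collect_eq closed_Collect_le continuous_intros)
  have "continuous_on (- {z::complex. Im z = 0 \<and> 0 \<le> Re z}) Arg2pi"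
  proof (intro continuous_at_imp_continuous_on ballI)
    fix z :: complex assume "z \<in> - {z. Im z = 0 \<and> 0 \<le> Re z}"
    then have "z \<notin> \<real>\<^sub>\<ge>\<^sub>0" by (auto simp: complex_nonneg_Reals_iff)
    then show "isCont Arg2pi z" by (rule continuous_at_Arg2pi)
  qed
  then have "(\<lambda>z. if z \<in> - {z. Im z = 0 \<and> 0 \<le> Re z} then Arg2pi z else 0) \<in> borel_measurable borel"
    using cl by (intro borel_measurable_continuous_on_if) (auto simp: open_Compl borel_open)
  also have "(\<lambda>z. if z \<in> - {z. Im z = 0 \<and> 0 \<le> Re z} then Arg2pi z else 0) = Arg2pi"
    using Arg2pi_eq_0 by (auto simp: fun_eq_iff complex_is_Real_iff)
  finally show ?thesis .
qed

lemma cis_borel_measurable [measurable]: "cis \<in> borel_measurable borel"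
  by (intro borel_measurable_continuous_onI continuous_on_cis continuous_on_id)

lemma wrap_measurable [measurable]: "wrap \<in> borel_measurable borel"
  unfolding wrap_def[abs_def] by measurable

context concave_gap_function
begin

lemma rel_angle_region_measurable:
  assumes "set xs \<subseteq> A" "length xs = m"
  shows "Measurable.pred (PiM A (\<lambda>_. borel)) (\<lambda>\<theta>. rel_angle \<theta> xs \<in> region s)"
proof -
  have [measurable]: "(\<lambda>\<theta>. \<theta> (xs ! j)) \<in> borel_measurable (PiM A (\<lambda>_. borel))" if "j < m" for j
    using assms that by (intro measurable_component_singleton) auto
  have "(\<lambda>\<theta>. \<lambda>j\<in>{1..<m}. rel_angle \<theta> xs j) \<in> PiM A (\<lambda>_. borel) \<rightarrow>\<^sub>M PiM {1..<m} (\<lambda>_. borel)"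
    unfolding rel_angle_def using m by (intro measurable_restrict) measurable
  from measurable_compose[OF this region_measurable] show ?thesis
    by (simp only: region_restrict)
qed

lemma near_polygon_measurable:
  assumes "B \<subseteq> A" "card B = m"
  shows "Measurable.pred (PiM A (\<lambda>_. borel)) (\<lambda>\<theta>. near_polygon s \<theta> B)"
  unfolding near_polygon_def
proof (intro pred_intros_finite)
  have B: "finite B" "B \<noteq> {}" using assms m card_ge_0_finite[of B] by auto
  show "finite (permutations_of_set (B - {Min B}))" by simp
  fix ys assume ys: "ys \<in> permutations_of_set (B - {Min B})"
  have "set (Min B # ys) \<subseteq> A" "length (Min B # ys) = m"
    unfolding Min_Cons_permutation[OF B ys] by (rule assms)+
  then show "Measurable.pred (PiM A (\<lambda>_. borel)) (\<lambda>\<theta>. rel_angle \<theta> (Min B # ys) \<in> region s)"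
    by (rule rel_angle_region_measurable)
qed

text \<open>Only the angles with index in B matter, which turns disjointness of index sets into
  independence.\<close>

lemma near_polygon_restrict:
  assumes "B \<subseteq> A" "card B = m"
  shows "near_polygon s (restrict \<theta> A) B \<longleftrightarrow> near_polygon s \<theta> B"
proof -
  have B: "finite B" "B \<noteq> {}" using assms m card_ge_0_finite[of B] by auto
  have "rel_angle (restrict \<theta> A) (Min B # ys) \<in> region s \<longleftrightarrow> rel_angle \<theta> (Min B # ys) \<in> region s"
    if ys: "ys \<in> permutations_of_set (B - {Min B})" for ys
  proof -
    have xs: "set (Min B # ys) \<subseteq> A" "length (Min B # ys) = m"
      unfolding Min_Cons_permutation[OF B ys] by (rule assms)+
    have "(Min B # ys) ! j \<in> A" if "j < m" for j
      using nth_mem[of j "Min B # ys"] xs that by auto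
    then have "restrict (rel_angle (restrict \<theta> A) (Min B # ys)) {1..<m} = restrict (rel_angle \<theta> (Min B # ys)) {1..<m}"
      using m by (intro restrict_ext) (auto simp: rel_angle_def simp del: nth_Cons_0 nth_Cons_pos)
    then show ?thesis by (metis region_restrict)
  qed
  then show ?thesis by (auto simp: near_polygon_def)
qed

end

context concave_gap_density
begin

definition angle_law :: "real measure" where
  "angle_law = density lborel (\<lambda>x. ennreal (p x) * indicator {0..<2*pi} x)"

lemma sets_angle_law [simp, measurable_cong]: "sets angle_law = sets borel"
  and space_angle_law [simp]: "space angle_law = UNIV"
  by (simp_all add: angle_law_def)

lemma nn_integral_angle_law:
  "h \<in> borel_measurable borel \<Longrightarrow>
    (\<integral>\<^sup>+x. h x \<partial>angle_law) = (\<integral>\<^sup>+x. ennreal (p x) * indicator {0..<2*pi} x * h x \<partial>lborel)"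
  unfolding angle_law_def by (subst nn_integral_density) auto

text \<open>Subtracting \<theta> moves the period [0, 2*pi) to one starting at -\<theta>. The
  integrand is periodic, so the window may be moved back, and there \<open>wrap\<close> is the
  identity: the relative angle has density p (\<theta> + y).\<close>

lemma nn_integral_wrap_angle_law:
  assumes [measurable]: "h \<in> borel_measurable borel" and \<theta>: "\<theta> \<in> {0..<2*pi}"
  shows "(\<integral>\<^sup>+x. h (wrap (x - \<theta>)) \<partial>angle_law)
       = (\<integral>\<^sup>+y. h y * (ennreal (p (\<theta> + y)) * indicator {0..<2*pi} y) \<partial>lborel)"
proof -
  have "(\<integral>\<^sup>+x. h (wrap (x - \<theta>)) \<partial>angle_law)
      = (\<integral>\<^sup>+x. ennreal (p x) * indicator {0..<2*pi} x * h (wrap (x - \<theta>)) \<partial>lborel)"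
    by (intro nn_integral_angle_law) measurable
  also have "\<dots> = (\<integral>\<^sup>+y. ennreal (p (\<theta> + 1 * y)) * indicator {0..<2*pi} (\<theta> + 1 * y) * h (wrap (\<theta> + 1 * y - \<theta>)) \<partial>lborel)"
    by (subst nn_integral_real_affine[where c = 1 and t = \<theta>]) auto
  also have "\<dots> = (\<integral>\<^sup>+y. (ennreal (p (\<theta> + y)) * h (wrap y)) * indicator {- \<theta>..<2*pi - \<theta>} y \<partial>lborel)"
    by (intro nn_integral_cong) (auto simp: indicator_def)
  also have "\<dots> = (\<integral>\<^sup>+y. (ennreal (p (\<theta> + y)) * h (wrap y)) * indicator {0..<2*pi} y \<partial>lborel)"
  proof (rule nn_integral_periodic_shift)
    show "ennreal (p (\<theta> + (x + 2*pi))) * h (wrap (x + 2*pi)) = ennreal (p (\<theta> + x)) * h (wrap x)" for x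
      using p_periodic[of "\<theta> + x"] by (simp add: wrap_add_2pi add.assoc)
  qed (use \<theta> in auto)
  also have "\<dots> = (\<integral>\<^sup>+y. h y * (ennreal (p (\<theta> + y)) * indicator {0..<2*pi} y) \<partial>lborel)"
    by (intro nn_integral_cong) (auto simp: indicator_def wrap_id mult_ac)
  finally show ?thesis .
qed

end

lemma distr_indep_eq_PiM:
  assumes "prob_space M" and ind: "prob_space.indep_vars M (\<lambda>_. borel) T I" and J: "J \<subseteq> I" "J \<noteq> {}"
    and law: "\<And>i. i \<in> J \<Longrightarrow> distr M borel (T i) = \<nu>"
  shows "distr M (PiM J (\<lambda>_. borel)) (\<lambda>\<omega>. \<lambda>i\<in>J. T i \<omega>) = PiM J (\<lambda>_. \<nu>)"
proof -
  interpret prob_space M by fact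
  have ind': "indep_vars (\<lambda>_. borel) T J" using ind J(1) by (rule indep_vars_subset)
  then have "distr M (PiM J (\<lambda>_. borel)) (\<lambda>\<omega>. \<lambda>i\<in>J. T i \<omega>) = PiM J (\<lambda>i. distr M borel (T i))"
    using J(2) by (subst indep_vars_iff_distr_eq_PiM'[symmetric]) (auto simp: indep_vars_def)
  also have "\<dots> = PiM J (\<lambda>_. \<nu>)" using law by (intro PiM_cong) auto
  finally show ?thesis .
qed

locale random_polygon = prob_space M + concave_gap_density m g \<mu> a c \<kappa> p
  for M :: "'a measure" and m g \<mu> a c \<kappa> p +
  fixes T :: "nat \<Rightarrow> 'a \<Rightarrow> real"
  assumes indep_T: "indep_vars (\<lambda>_. borel) T {1..}"
    and law_T: "\<And>i. i \<ge> 1 \<Longrightarrow> distr M borel (T i) = angle_law"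
begin

lemma T_measurable [measurable]: "i \<ge> 1 \<Longrightarrow> T i \<in> borel_measurable M"
  using indep_T by (auto simp: indep_vars_def)

lemma T_restrict_measurable [measurable]:
  "J \<subseteq> {1..} \<Longrightarrow> (\<lambda>\<omega>. \<lambda>i\<in>J. T i \<omega>) \<in> M \<rightarrow>\<^sub>M PiM J (\<lambda>_. borel)"
  by (intro measurable_restrict T_measurable) auto

lemma prob_space_angle_law: "prob_space angle_law"
  using prob_space_distr[OF T_measurable[of 1]] law_T[of 1] by simp

lemma distr_T: "J \<subseteq> {1..} \<Longrightarrow> J \<noteq> {} \<Longrightarrow>
    distr M (PiM J (\<lambda>_. borel)) (\<lambda>\<omega>. \<lambda>i\<in>J. T i \<omega>) = PiM J (\<lambda>_. angle_law)"
  using indep_T law_T by (intro distr_indep_eq_PiM prob_space_axioms) auto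

definition shape_event :: "real \<Rightarrow> nat list \<Rightarrow> 'a set" where
  "shape_event s xs = {\<omega>\<in>space M. rel_angle (\<lambda>i. T i \<omega>) xs \<in> region s}"

definition polygon_event :: "real \<Rightarrow> nat set \<Rightarrow> 'a set" where
  "polygon_event s A = {\<omega>\<in>space M. near_polygon s (\<lambda>i. T i \<omega>) A}"

text \<open>Reindexing by list positions gives every choice and ordering of m distinct indices the
  same law.\<close>

lemma distr_T_list:
  assumes xs: "distinct xs" "length xs = m" "set xs \<subseteq> {1..}"
  shows "distr M (PiM {..<m} (\<lambda>_. borel)) (\<lambda>\<omega>. \<lambda>j\<in>{..<m}. T (xs ! j) \<omega>) = PiM {..<m} (\<lambda>_. angle_law)"
proof -
  have ne: "set xs \<noteq> {}" using xs m by auto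
  have nth: "xs ! j \<in> set xs" if "j < m" for j using that xs by auto
  have meas: "(\<lambda>\<theta>. \<lambda>j\<in>{..<m}. \<theta> (xs ! j)) \<in> PiM (set xs) (\<lambda>_. borel :: real measure) \<rightarrow>\<^sub>M PiM {..<m} (\<lambda>_. borel)"
    using nth by (intro measurable_restrict measurable_component_singleton) auto
  have "PiM {..<m} (\<lambda>_. angle_law) = distr (PiM (set xs) (\<lambda>_. angle_law)) (PiM {..<m} (\<lambda>_. angle_law)) (\<lambda>\<theta>. \<lambda>j\<in>{..<m}. \<theta> (xs ! j))"
    using xs nth by (intro distr_PiM_reindex[symmetric] prob_space_angle_law inj_on_nth) auto
  also have "\<dots> = distr (PiM (set xs) (\<lambda>_. angle_law)) (PiM {..<m} (\<lambda>_. borel)) (\<lambda>\<theta>. \<lambda>j\<in>{..<m}. \<theta> (xs ! j))"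
    by (intro distr_cong refl sets_PiM_cong) auto
  also have "\<dots> = distr M (PiM {..<m} (\<lambda>_. borel)) ((\<lambda>\<theta>. \<lambda>j\<in>{..<m}. \<theta> (xs ! j)) \<circ> (\<lambda>\<omega>. \<lambda>i\<in>set xs. T i \<omega>))"
    unfolding distr_T[OF xs(3) ne, symmetric]
    by (intro distr_distr meas T_restrict_measurable xs(3))
  also have "((\<lambda>\<theta>. \<lambda>j\<in>{..<m}. \<theta> (xs ! j)) \<circ> (\<lambda>\<omega>. \<lambda>i\<in>set xs. T i \<omega>)) = (\<lambda>\<omega>. \<lambda>j\<in>{..<m}. T (xs ! j) \<omega>)"
    using nth by (auto simp: fun_eq_iff)
  finally show ?thesis by (rule sym)
qed

lemma shape_event_measurable:
  assumes "length xs = m" "set xs \<subseteq> {1..}"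
  shows "shape_event s xs \<in> events"
proof -
  have "(\<lambda>\<omega>. \<lambda>j\<in>{1..<m}. rel_angle (\<lambda>i. T i \<omega>) xs j) \<in> M \<rightarrow>\<^sub>M PiM {1..<m} (\<lambda>_. borel)"
  proof (intro measurable_restrict)
    fix j assume "j \<in> {1..<m}"
    then have "xs ! j \<in> set xs" "xs ! 0 \<in> set xs" using assms by auto
    then have [measurable]: "T (xs ! j) \<in> borel_measurable M" "T (xs ! 0) \<in> borel_measurable M"
      using assms by auto
    show "(\<lambda>\<omega>. rel_angle (\<lambda>i. T i \<omega>) xs j) \<in> borel_measurable M"
      unfolding rel_angle_def by measurable
  qed
  from measurable_compose[OF this region_measurable, of s]
  have "Measurable.pred M (\<lambda>\<omega>. rel_angle (\<lambda>i. T i \<omega>) xs \<in> region s)"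
    by (simp only: region_restrict)
  then show ?thesis unfolding shape_event_def by simp
qed

text \<open>The angle t of the first vertex is integrated last. For fixed t the relative angles of
  the other vertices are independent with density p (t + y), and the substitution rule applies in
  all coordinates at once.\<close>

lemma emeasure_shape_event:
  assumes xs: "distinct xs" "length xs = m" "set xs \<subseteq> {1..}"
  shows "emeasure M (shape_event s xs) = region_mass s"
proof -
  interpret N: product_sigma_finite "\<lambda>_::nat. angle_law"
    by (intro product_sigma_finite.intro prob_space_imp_sigma_finite prob_space_angle_law)
  define G :: "(nat \<Rightarrow> real) \<Rightarrow> ennreal" where "G \<theta> = indicator (region s) (\<lambda>j\<in>{1..<m}. wrap (\<theta> j - \<theta> 0))" for \<theta>
  have dom: "{..<m} = insert 0 {1..<m}" using m by auto
  have [measurable]: "(\<lambda>y. indicator (region s) y :: ennreal) \<in> borel_measurable (PiM {1..<m} (\<lambda>_. borel))"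
    by (intro borel_measurable_indicator') measurable
  have mm: "(\<lambda>\<theta>. \<lambda>j\<in>{1..<m}. wrap (\<theta> j - \<theta> 0)) \<in> PiM {..<m} (\<lambda>_. borel) \<rightarrow>\<^sub>M PiM {1..<m} (\<lambda>_. borel)"
  proof (intro measurable_restrict)
    fix j assume "j \<in> {1..<m}"
    then have [measurable]: "(\<lambda>\<theta>. \<theta> j) \<in> borel_measurable (PiM {..<m} (\<lambda>_. borel :: real measure))"
      "(\<lambda>\<theta>. \<theta> 0) \<in> borel_measurable (PiM {..<m} (\<lambda>_. borel :: real measure))"
      by (auto intro!: measurable_component_singleton)
    show "(\<lambda>\<theta>. wrap (\<theta> j - \<theta> 0)) \<in> borel_measurable (PiM {..<m} (\<lambda>_. borel))" by measurable
  qed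
  have G[measurable]: "G \<in> borel_measurable (PiM {..<m} (\<lambda>_. borel))"
    unfolding G_def[abs_def] using mm by measurable
  have "emeasure M (shape_event s xs) = (\<integral>\<^sup>+\<omega>. indicator (shape_event s xs) \<omega> \<partial>M)"
    using shape_event_measurable[OF xs(2,3)] by simp
  also have "\<dots> = (\<integral>\<^sup>+\<omega>. G (\<lambda>j\<in>{..<m}. T (xs ! j) \<omega>) \<partial>M)"
  proof (intro nn_integral_cong)
    fix \<omega> assume "\<omega> \<in> space M"
    have "(\<lambda>j\<in>{1..<m}. wrap ((\<lambda>j\<in>{..<m}. T (xs ! j) \<omega>) j - (\<lambda>j\<in>{..<m}. T (xs ! j) \<omega>) 0))
        = restrict (rel_angle (\<lambda>i. T i \<omega>) xs) {1..<m}"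
      using m by (auto simp: fun_eq_iff rel_angle_def)
    then show "indicator (shape_event s xs) \<omega> = G (\<lambda>j\<in>{..<m}. T (xs ! j) \<omega>)"
      using \<open>\<omega> \<in> space M\<close> unfolding G_def shape_event_def indicator_def by (simp only: region_restrict) simp
  qed
  also have "\<dots> = (\<integral>\<^sup>+\<theta>. G \<theta> \<partial>distr M (PiM {..<m} (\<lambda>_. borel)) (\<lambda>\<omega>. \<lambda>j\<in>{..<m}. T (xs ! j) \<omega>))"
  proof (rule nn_integral_distr[symmetric])
    show "(\<lambda>\<omega>. \<lambda>j\<in>{..<m}. T (xs ! j) \<omega>) \<in> M \<rightarrow>\<^sub>M PiM {..<m} (\<lambda>_. borel)"
      using xs(3) nth_mem[of _ xs] xs(2) by (intro measurable_restrict T_measurable) (auto simp: subset_iff)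
  qed (simp add: G)
  also have "\<dots> = (\<integral>\<^sup>+\<theta>. G \<theta> \<partial>PiM (insert 0 {1..<m}) (\<lambda>_. angle_law))"
    unfolding dom[symmetric] distr_T_list[OF xs] ..
  also have "\<dots> = (\<integral>\<^sup>+t. \<integral>\<^sup>+x. G (x(0 := t)) \<partial>PiM {1..<m} (\<lambda>_. angle_law) \<partial>angle_law)"
    using G unfolding dom by (intro N.product_nn_integral_insert_rev) auto
  also have "\<dots> = (\<integral>\<^sup>+t. local_mass s t \<partial>angle_law)"
  proof (rule nn_integral_cong_AE)
    \<comment> \<open>The substitution for relative angles requires t in the base period, which
      holds almost everywhere under \<open>angle_law\<close>.\<close>
    have "AE t in angle_law. t \<in> {0..<2*pi}"
      unfolding angle_law_def by (subst AE_density) (auto simp: indicator_def)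
    then show "AE t in angle_law. (\<integral>\<^sup>+x. G (x(0 := t)) \<partial>PiM {1..<m} (\<lambda>_. angle_law)) = local_mass s t"
    proof eventually_elim
      case (elim t)
      have "(\<integral>\<^sup>+x. G (x(0 := t)) \<partial>PiM {1..<m} (\<lambda>_. angle_law))
          = (\<integral>\<^sup>+x. indicator (region s) (\<lambda>j\<in>{1..<m}. wrap (x j - t)) \<partial>PiM {1..<m} (\<lambda>_. angle_law))"
      proof (intro nn_integral_cong)
        fix x :: "nat \<Rightarrow> real"
        have "(\<lambda>j\<in>{1..<m}. wrap ((x(0 := t)) j - (x(0 := t)) 0)) = (\<lambda>j\<in>{1..<m}. wrap (x j - t))"
          by (auto simp: fun_eq_iff)
        then show "G (x(0 := t)) = indicator (region s) (\<lambda>j\<in>{1..<m}. wrap (x j - t))"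
          by (simp only: G_def)
      qed
      also have "\<dots> = (\<integral>\<^sup>+y. indicator (region s) y * (\<Prod>j\<in>{1..<m}. ennreal (p (t + y j)) * indicator {0..<2*pi} (y j)) \<partial>PiM {1..<m} (\<lambda>_. lborel))"
        by (rule nn_integral_PiM_substitution[where \<phi> = "\<lambda>_ x. wrap (x - t)"
              and w = "\<lambda>_ y. ennreal (p (t + y)) * indicator {0..<2*pi} y"])
          (use elim in \<open>auto intro!: prob_space_imp_sigma_finite prob_space_angle_law nn_integral_wrap_angle_law simp del: One_nat_def\<close>)
      also have "\<dots> = local_mass s t"
        unfolding local_mass_def
      proof (intro nn_integral_cong)
        fix y
        show "indicator (region s) y * (\<Prod>j\<in>{1..<m}. ennreal (p (t + y j)) * indicator {0..<2*pi} (y j))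
            = ennreal (indicator (region s) y * (\<Prod>j\<in>{1..<m}. p (t + y j)))"
        proof (cases "y \<in> region s")
          case True
          have "(\<Prod>j\<in>{1..<m}. ennreal (p (t + y j)) * indicator {0..<2*pi} (y j)) = (\<Prod>j\<in>{1..<m}. ennreal (p (t + y j)))"
            using chain_in_region[OF True] by (intro prod.cong) (auto simp: indicator_def less_imp_le)
          also have "\<dots> = ennreal (\<Prod>j\<in>{1..<m}. p (t + y j))"
            using p_nonneg by (intro prod_ennreal) auto
          finally show ?thesis using True by simp
        qed simp
      qed
      finally show ?case .
    qed
  qed
  also have "\<dots> = region_mass s"
    unfolding region_mass_def by (rule nn_integral_angle_law) measurable
  finally show ?thesis .
qed

lemma polygon_event_eq_UN:
  "polygon_event s A = (\<Union>ys\<in>permutations_of_set (A - {Min A}). shape_event s (Min A # ys))"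
  by (auto simp: polygon_event_def near_polygon_def shape_event_def)

text \<open>The (m - 1)! orderings are disjoint and equally likely. Against the 1 / m! from the
  number of subsets this factor leaves the 1 / m of the limit.\<close>

lemma prob_polygon_event:
  assumes A: "A \<subseteq> {1..}" "finite A" "card A = m"
  shows "polygon_event s A \<in> events"
    and "prob (polygon_event s A) = fact (m - 1) * enn2real (region_mass s)"
proof -
  have ne: "A \<noteq> {}" using A m by auto
  note xs = Min_Cons_permutation[OF A(2) ne]
  have ev: "shape_event s (Min A # ys) \<in> events" if "ys \<in> permutations_of_set (A - {Min A})" for ys
    using xs[OF that] A by (intro shape_event_measurable) (simp_all only:)
  then show "polygon_event s A \<in> events"
    unfolding polygon_event_eq_UN by (intro sets.finite_UN) auto
  have "disjoint_family_on (\<lambda>ys. shape_event s (Min A # ys)) (permutations_of_set (A - {Min A}))"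
  proof (unfold disjoint_family_on_def, intro ballI impI)
    fix ys ys' assume ys: "ys \<in> permutations_of_set (A - {Min A})" "ys' \<in> permutations_of_set (A - {Min A})" "ys \<noteq> ys'"
    have "length ys = m - 1" "length ys' = m - 1"
      using xs(3)[OF ys(1)] xs(3)[OF ys(2)] A(3) by auto
    moreover have "set ys = set ys'" using ys by (auto simp: permutations_of_set_def)
    ultimately show "shape_event s (Min A # ys) \<inter> shape_event s (Min A # ys') = {}"
      using region_perm_unique[of ys ys'] ys(3) by (auto simp: shape_event_def)
  qed
  then have "prob (polygon_event s A) = (\<Sum>ys\<in>permutations_of_set (A - {Min A}). prob (shape_event s (Min A # ys)))"
    unfolding polygon_event_eq_UN using ev by (intro finite_measure_finite_Union) auto
  also have "\<dots> = (\<Sum>ys\<in>permutations_of_set (A - {Min A}). enn2real (region_mass s))"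
  proof (intro sum.cong refl)
    fix ys assume ys: "ys \<in> permutations_of_set (A - {Min A})"
    have "emeasure M (shape_event s (Min A # ys)) = region_mass s"
      using xs[OF ys] A by (intro emeasure_shape_event) (simp_all only:)
    then show "prob (shape_event s (Min A # ys)) = enn2real (region_mass s)"
      by (simp add: measure_def)
  qed
  also have "\<dots> = fact (m - 1) * enn2real (region_mass s)"
    using A ne by (simp add: card_Diff_singleton)
  finally show "prob (polygon_event s A) = fact (m - 1) * enn2real (region_mass s)" .
qed

text \<open>The event for A is a function of the angles indexed by A, the sum a function of the
  angles indexed outside A; these two blocks are independent.\<close>

lemma indep_polygon_events:
  assumes A: "A \<subseteq> {1..}" "card A = m" and I: "\<And>B. B \<in> I \<Longrightarrow> B \<subseteq> {1..} \<and> card B = m \<and> A \<inter> B = {}"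
  shows "indep_var borel (indicator (polygon_event s A) :: 'a \<Rightarrow> real)
                  borel (\<lambda>\<omega>. \<Sum>B\<in>I. indicator (polygon_event s B) \<omega>)"
proof -
  define C where "C = {1..} - A"
  have iv: "indep_var (PiM A (\<lambda>_. borel)) (\<lambda>\<omega>. restrict (\<lambda>i. T i \<omega>) A) (PiM C (\<lambda>_. borel)) (\<lambda>\<omega>. restrict (\<lambda>i. T i \<omega>) C)"
    using A by (intro indep_var_restrict[OF indep_T]) (auto simp: C_def)
  have IC: "B \<subseteq> C" "card B = m" if "B \<in> I" for B using I[OF that] by (auto simp: C_def)
  have m1: "indicat_real {\<theta>. near_polygon s \<theta> A} \<in> borel_measurable (PiM A (\<lambda>_. borel))"
    using near_polygon_measurable[of A A s] A
    by (intro borel_measurable_indicator') simp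
  have m2: "(\<lambda>\<theta>. \<Sum>B\<in>I. indicat_real {\<theta>. near_polygon s \<theta> B} \<theta>) \<in> borel_measurable (PiM C (\<lambda>_. borel))"
    using near_polygon_measurable[OF IC] by (intro borel_measurable_sum borel_measurable_indicator') simp
  show ?thesis
  proof (rule indep_var_cong_space[OF indep_var_compose[OF iv m1 m2]])
    fix \<omega> assume "\<omega> \<in> space M"
    then show "(indicat_real {\<theta>. near_polygon s \<theta> A} \<circ> (\<lambda>\<omega>. restrict (\<lambda>i. T i \<omega>) A)) \<omega> = indicator (polygon_event s A) \<omega>"
      using near_polygon_restrict[of A A s "\<lambda>i. T i \<omega>"] A
      by (simp add: indicator_def polygon_event_def)
    show "((\<lambda>\<theta>. \<Sum>B\<in>I. indicat_real {\<theta>. near_polygon s \<theta> B} \<theta>) \<circ> (\<lambda>\<omega>. restrict (\<lambda>i. T i \<omega>) C)) \<omega>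
        = (\<Sum>B\<in>I. indicator (polygon_event s B) \<omega>)"
      using near_polygon_restrict[OF IC] \<open>\<omega> \<in> space M\<close>
      by (auto simp: indicator_def polygon_event_def intro!: sum.cong)
  qed
qed

end

section \<open>Clustering of overlapping polygons\<close>

context random_polygon
begin

text \<open>The vertices of the regular polygon through t, thickened by d and unrolled on the line.
  Two angles in [0, 2*pi) differ by less than m * \<mu>, so for d \<le> \<mu> only multiples with
  \<bar>k\<bar> \<le> m + 1 can occur; the chosen range has 2 * m + 5 elements.\<close>

definition near_lattice :: "real \<Rightarrow> real \<Rightarrow> real set" where
  "near_lattice d t = (\<Union>k\<in>{- int (m + 2)..int (m + 2)}. {t + of_int k * \<mu> - d..t + of_int k * \<mu> + d})"

lemma near_lattice_borel [measurable]:
  "Measurable.pred (borel \<Otimes>\<^sub>M borel) (\<lambda>(t, x). x \<in> near_lattice d t)"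
proof -
  have "Measurable.pred (borel \<Otimes>\<^sub>M borel) (\<lambda>z. \<exists>k\<in>{- int (m + 2)..int (m + 2)}.
      fst z + of_int k * \<mu> - d \<le> snd z \<and> snd z \<le> fst z + of_int k * \<mu> + d)"
    by (intro pred_intros_finite) measurable
  then show ?thesis by (simp add: near_lattice_def case_prod_beta)
qed

lemma near_latticeI:
  assumes "t \<in> {0..<2*pi}" "x \<in> {0..<2*pi}" "\<bar>x - t - of_int k * \<mu>\<bar> \<le> d" "d \<le> \<mu>"
  shows "x \<in> near_lattice d t"
proof -
  have "\<bar>of_int k * \<mu>\<bar> \<le> 2*pi + \<mu>" using assms by (auto simp: abs_le_iff)
  then have "\<bar>of_int k :: real\<bar> * \<mu> \<le> real (m + 1) * \<mu>"
    using m_\<mu> \<mu>_pos by (simp add: abs_mult algebra_simps)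
  then have "\<bar>of_int k :: real\<bar> \<le> real (m + 1)" using \<mu>_pos by simp
  then have "k \<in> {- int (m + 2)..int (m + 2)}" by (simp add: abs_le_iff)
  then show ?thesis using assms(3) unfolding near_lattice_def by (intro UN_I[of k]) (auto simp: abs_le_iff)
qed

lemma emeasure_near_lattice:
  assumes B: "\<And>x. p x \<le> B" "B \<ge> 0" and d: "d \<ge> 0"
  shows "emeasure angle_law (near_lattice d t) \<le> ennreal (real (2 * m + 5) * (B * (2 * d)))"
proof -
  let ?I = "\<lambda>k::int. {t + of_int k * \<mu> - d..t + of_int k * \<mu> + d}"
  have "emeasure angle_law (?I k) \<le> ennreal (B * (2 * d))" for k
  proof -
    have "emeasure angle_law (?I k) = (\<integral>\<^sup>+x. ennreal (p x) * indicator {0..<2*pi} x * indicator (?I k) x \<partial>lborel)"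
      by (subst nn_integral_angle_law[symmetric]) auto
    also have "\<dots> \<le> (\<integral>\<^sup>+x. ennreal B * indicator (?I k) x \<partial>lborel)"
      using B(1) by (intro nn_integral_mono) (auto simp: indicator_def intro!: ennreal_leI)
    also have "\<dots> = ennreal (B * (2 * d))"
      using B(2) d by (simp add: nn_integral_cmult ennreal_mult'[symmetric])
    finally show ?thesis .
  qed
  then have "(\<Sum>k\<in>{- int (m + 2)..int (m + 2)}. emeasure angle_law (?I k))
      \<le> (\<Sum>k\<in>{- int (m + 2)..int (m + 2)}. ennreal (B * (2 * d)))"
    by (intro sum_mono)
  moreover have "emeasure angle_law (near_lattice d t) \<le> (\<Sum>k\<in>{- int (m + 2)..int (m + 2)}. emeasure angle_law (?I k))"
    unfolding near_lattice_def by (intro emeasure_subadditive_finite) auto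
  moreover have "(\<Sum>k\<in>{- int (m + 2)..int (m + 2)}. ennreal (B * (2 * d))) = ennreal (real (2 * m + 5) * (B * (2 * d)))"
  proof -
    have "nat (int (m + 2) - (- int (m + 2)) + 1) = 2 * m + 5" by simp
    then show ?thesis by (simp add: ennreal_mult' ennreal_of_nat_eq_real_of_nat)
  qed
  ultimately show ?thesis by simp
qed

lemma star_event_measurable:
  assumes J: "finite J" "insert c0 J \<subseteq> {1..}"
  shows "{\<omega>\<in>space M. \<forall>j\<in>J. T j \<omega> \<in> near_lattice d (T c0 \<omega>)} \<in> events"
proof -
  have "{\<omega>\<in>space M. T j \<omega> \<in> near_lattice d (T c0 \<omega>)} \<in> events" if "j \<in> J" for j
  proof -
    have "(\<lambda>\<omega>. (T c0 \<omega>, T j \<omega>)) \<in> M \<rightarrow>\<^sub>M borel \<Otimes>\<^sub>M borel"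
      using J that by (intro measurable_Pair T_measurable) auto
    from measurable_compose[OF this near_lattice_borel] show ?thesis by simp
  qed
  then show ?thesis using J(1) by (intro sets.sets_Collect_finite_All) auto
qed

text \<open>Given the angle of the centre c0 the other points are independent, and each hits the
  thickened lattice with probability at most q, uniformly in the centre.\<close>

lemma prob_star_le:
  assumes J: "finite J" "c0 \<notin> J" "insert c0 J \<subseteq> {1..}"
    and q: "\<And>t. emeasure angle_law (near_lattice d t) \<le> ennreal q" "q \<ge> 0"
  shows "prob {\<omega>\<in>space M. \<forall>j\<in>J. T j \<omega> \<in> near_lattice d (T c0 \<omega>)} \<le> q ^ card J"
proof -
  interpret N: product_sigma_finite "\<lambda>_::nat. angle_law"
    by (intro product_sigma_finite.intro prob_space_imp_sigma_finite prob_space_angle_law)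
  interpret A: prob_space angle_law by (rule prob_space_angle_law)
  define G :: "(nat \<Rightarrow> real) \<Rightarrow> ennreal" where
    "G \<theta> = (\<Prod>j\<in>J. indicator {z. case z of (t, x) \<Rightarrow> x \<in> near_lattice d t} (\<theta> c0, \<theta> j))" for \<theta>
  have I: "(\<lambda>z. indicator {z. case z of (t, x) \<Rightarrow> x \<in> near_lattice d t} z :: ennreal) \<in> borel_measurable (borel \<Otimes>\<^sub>M borel)"
    by (intro borel_measurable_indicator') (use near_lattice_borel in \<open>simp add: case_prod_beta\<close>)
  have G[measurable]: "G \<in> borel_measurable (PiM (insert c0 J) (\<lambda>_. borel))"
    unfolding G_def[abs_def]
    by (intro borel_measurable_prod_ennreal measurable_compose[OF _ I] measurable_Pair measurable_component_singleton) auto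
  define E where "E = {\<omega>\<in>space M. \<forall>j\<in>J. T j \<omega> \<in> near_lattice d (T c0 \<omega>)}"
  have ev: "E \<in> events"
    unfolding E_def by (rule star_event_measurable[OF J(1,3)])
  have "emeasure M E = (\<integral>\<^sup>+\<omega>. indicator E \<omega> \<partial>M)"
    using ev by simp
  also have "\<dots> = (\<integral>\<^sup>+\<omega>. G (\<lambda>i\<in>insert c0 J. T i \<omega>) \<partial>M)"
  proof (intro nn_integral_cong)
    fix \<omega> assume w: "\<omega> \<in> space M"
    show "indicator E \<omega> = G (\<lambda>i\<in>insert c0 J. T i \<omega>)"
      using w J(1) by (auto simp: E_def G_def indicator_def prod_zero_iff intro!: prod.neutral[symmetric])
  qed
  also have "\<dots> = (\<integral>\<^sup>+\<theta>. G \<theta> \<partial>PiM (insert c0 J) (\<lambda>_. angle_law))"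
    unfolding distr_T[OF J(3) insert_not_empty, symmetric]
    using J(3) by (intro nn_integral_distr[symmetric] T_restrict_measurable) auto
  also have "\<dots> = (\<integral>\<^sup>+t. \<integral>\<^sup>+x. G (x(c0 := t)) \<partial>PiM J (\<lambda>_. angle_law) \<partial>angle_law)"
    using J by (intro N.product_nn_integral_insert_rev) auto
  also have "\<dots> \<le> (\<integral>\<^sup>+t. ennreal (q ^ card J) \<partial>angle_law)"
  proof (intro nn_integral_mono)
    fix t :: real
    have nl: "near_lattice d t \<in> sets borel" unfolding near_lattice_def by measurable
    have "(\<integral>\<^sup>+x. G (x(c0 := t)) \<partial>PiM J (\<lambda>_. angle_law))
        = (\<integral>\<^sup>+x. (\<Prod>j\<in>J. indicator (near_lattice d t) (x j)) \<partial>PiM J (\<lambda>_. angle_law))"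
      unfolding G_def using J(2) by (intro nn_integral_cong prod.cong) (auto simp: indicator_def)
    also have "\<dots> = (\<Prod>j\<in>J. \<integral>\<^sup>+x. indicator (near_lattice d t) x \<partial>angle_law)"
      using nl J(1) by (intro N.product_nn_integral_prod) auto
    also have "\<dots> = (\<Prod>j\<in>J. emeasure angle_law (near_lattice d t))"
      using nl by simp
    also have "\<dots> \<le> (\<Prod>j\<in>J. ennreal q)" by (intro prod_mono_ennreal q)
    also have "\<dots> = ennreal (q ^ card J)" using q(2) by (simp add: ennreal_power)
    finally show "(\<integral>\<^sup>+x. G (x(c0 := t)) \<partial>PiM J (\<lambda>_. angle_law)) \<le> ennreal (q ^ card J)" .
  qed
  also have "\<dots> = ennreal (q ^ card J)"
    using A.emeasure_space_1 by simp
  finally show ?thesis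
    unfolding E_def[symmetric] using q(2) by (simp add: emeasure_eq_measure)
qed

definition density_bound :: real where
  "density_bound = (SOME B. B \<ge> 0 \<and> (\<forall>x. p x \<le> B))"

lemma density_bound: "density_bound \<ge> 0" "p x \<le> density_bound"
  using someI_ex[OF p_bounded] by (simp_all add: density_bound_def)

text \<open>Number of intervals times density bound times interval length, the half-width being the
  one from \<open>near_polygon_pairwise\<close>. It is proportional to sqrt s, hence to \<sigma> for
  s = t * \<sigma>\<twosuperior>.\<close>

definition cluster_bound :: "real \<Rightarrow> real" where
  "cluster_bound s = real (2 * m + 5) * (density_bound * (2 * (2 * real m * sqrt (s / \<kappa>))))"

lemma AE_T_range: "i \<ge> 1 \<Longrightarrow> AE \<omega> in M. T i \<omega> \<in> {0..<2*pi}"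
proof -
  assume i: "i \<ge> 1"
  have "AE t in angle_law. t \<in> {0..<2*pi}"
    unfolding angle_law_def by (subst AE_density) (auto simp: indicator_def)
  then have "AE t in distr M borel (T i). t \<in> {0..<2*pi}" by (simp only: law_T[OF i])
  then show ?thesis using i by (subst (asm) AE_distr_iff) auto
qed

text \<open>Every point of the union lies in a polygon with the shared vertex c0, so all of them
  form a star around c0. The case A = B is included and bounds the probability of a single
  event.\<close>

lemma prob_polygon_events_overlap:
  assumes AB: "A \<subseteq> {1..}" "B \<subseteq> {1..}" "card A = m" "card B = m" "A \<inter> B \<noteq> {}"
    and s: "s \<ge> 0" "2 * real m * sqrt (s / \<kappa>) \<le> \<mu>"
  shows "prob (polygon_event s A \<inter> polygon_event s B) \<le> cluster_bound s ^ (card (A \<union> B) - 1)"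
proof -
  define d where "d = 2 * real m * sqrt (s / \<kappa>)"
  have d: "d \<ge> 0" "d \<le> \<mu>" using s \<kappa> by (auto simp: d_def)
  have cb: "cluster_bound s = real (2 * m + 5) * (density_bound * (2 * d))"
    by (simp add: cluster_bound_def d_def)
  have fin: "finite A" "finite B" using AB m card_ge_0_finite[of A] card_ge_0_finite[of B] by auto
  obtain c0 where c0: "c0 \<in> A" "c0 \<in> B" using AB(5) by auto
  define J where "J = (A \<union> B) - {c0}"
  have J: "finite J" "c0 \<notin> J" "insert c0 J \<subseteq> {1..}" "card J = card (A \<union> B) - 1"
    using fin AB c0 by (auto simp: J_def card_Diff_singleton)
  have "AE \<omega> in M. \<forall>i\<in>insert c0 J. T i \<omega> \<in> {0..<2*pi}"
    using J AE_T_range by (intro AE_finite_allI) auto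
  then have "AE \<omega> in M. \<omega> \<in> polygon_event s A \<inter> polygon_event s B \<longrightarrow>
      \<omega> \<in> {\<omega>\<in>space M. \<forall>j\<in>J. T j \<omega> \<in> near_lattice d (T c0 \<omega>)}"
  proof eventually_elim
    case (elim \<omega>)
    show ?case
    proof
      assume w: "\<omega> \<in> polygon_event s A \<inter> polygon_event s B"
      have "T j \<omega> \<in> near_lattice d (T c0 \<omega>)" if j: "j \<in> J" for j
      proof -
        obtain S where S: "finite S" "card S = m" "near_polygon s (\<lambda>i. T i \<omega>) S" "j \<in> S" "c0 \<in> S"
        proof (cases "j \<in> A")
          case True
          then show ?thesis using that[of A] w c0 fin AB by (simp add: polygon_event_def)
        next
          case False
          then have "j \<in> B" using j by (simp add: J_def)
          then show ?thesis using that[of B] w c0 fin AB by (simp add: polygon_event_def)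
        qed
        obtain k :: int where "\<bar>T j \<omega> - T c0 \<omega> - of_int k * \<mu>\<bar> \<le> d"
          using near_polygon_pairwise[OF S] unfolding d_def by blast
        then show ?thesis using elim j d by (intro near_latticeI) auto
      qed
      then show "\<omega> \<in> {\<omega>\<in>space M. \<forall>j\<in>J. T j \<omega> \<in> near_lattice d (T c0 \<omega>)}"
        using w by (auto simp: polygon_event_def)
    qed
  qed
  moreover have "{\<omega>\<in>space M. \<forall>j\<in>J. T j \<omega> \<in> near_lattice d (T c0 \<omega>)} \<in> events"
    by (rule star_event_measurable[OF J(1,3)])
  ultimately have "prob (polygon_event s A \<inter> polygon_event s B)
      \<le> prob {\<omega>\<in>space M. \<forall>j\<in>J. T j \<omega> \<in> near_lattice d (T c0 \<omega>)}"
    by (rule finite_measure_mono_AE)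
  also have "\<dots> \<le> cluster_bound s ^ card J"
    using density_bound d J(1-3) unfolding cb by (intro prob_star_le emeasure_near_lattice) auto
  finally show ?thesis by (simp add: J(4))
qed

end

section \<open>The limit theorem\<close>

text \<open>A pair is determined by its union V together with two subsets of V: at most n^a choices
  for V of size a, then 4^a for the pair.\<close>

lemma sum_pairs_by_union_card:
  fixes f :: "nat \<Rightarrow> real"
  assumes f: "\<And>a. f a \<ge> 0" and K: "finite K"
    and S: "\<And>A B. (A, B) \<in> S \<Longrightarrow> A \<subseteq> {1..n::nat} \<and> B \<subseteq> {1..n} \<and> card (A \<union> B) \<in> K"
  shows "(\<Sum>(A, B)\<in>S. f (card (A \<union> B))) \<le> (\<Sum>a\<in>K. real n ^ a * 4 ^ a * f a)"
proof -
  have finS: "finite S"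
    by (rule finite_subset[of _ "Pow {1..n} \<times> Pow {1..n}"]) (use S in auto)
  have "(\<Sum>(A, B)\<in>S. f (card (A \<union> B)))
      = (\<Sum>a\<in>K. \<Sum>z\<in>{z\<in>S. card (fst z \<union> snd z) = a}. f (card (fst z \<union> snd z)))"
    using finS K S by (subst sum.group) (auto simp: case_prod_beta)
  also have "\<dots> = (\<Sum>a\<in>K. real (card {z\<in>S. card (fst z \<union> snd z) = a}) * f a)"
    by (intro sum.cong) auto
  also have "\<dots> \<le> (\<Sum>a\<in>K. (real n ^ a * 4 ^ a) * f a)"
  proof (intro sum_mono mult_right_mono f)
    fix a
    let ?V = "{V. V \<subseteq> {1..n} \<and> card V = a}"
    have fin: "finite ?V" "finite (SIGMA V:?V. Pow V \<times> Pow V)"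
      by (auto intro!: finite_subset[of ?V "Pow {1..n}"] finite_SigmaI intro: finite_subset)
    have "fst z \<union> snd z \<in> Pow {1..n}" if "z \<in> S" for z
      using S[of "fst z" "snd z"] that by auto
    then have "(\<lambda>z. (fst z \<union> snd z, z)) ` {z\<in>S. card (fst z \<union> snd z) = a} \<subseteq> (SIGMA V:?V. Pow V \<times> Pow V)"
      by (force simp: image_subset_iff)
    then have "card {z\<in>S. card (fst z \<union> snd z) = a} \<le> card (SIGMA V:?V. Pow V \<times> Pow V)"
      by (intro card_inj_on_le[where f = "\<lambda>z. (fst z \<union> snd z, z)"] fin) (auto simp: inj_on_def)
    also have "\<dots> = (\<Sum>V\<in>?V. card (Pow V \<times> Pow V))"
      using fin by (intro card_SigmaI) (auto intro: finite_subset)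
    also have "\<dots> = (\<Sum>V\<in>?V. 4 ^ a)"
    proof (intro sum.cong refl)
      fix V assume "V \<in> ?V"
      then have "finite V" "card V = a" by (auto intro: finite_subset)
      then show "card (Pow V \<times> Pow V) = 4 ^ a"
        by (simp add: card_Pow card_cartesian_product power_mult_distrib[symmetric])
    qed
    also have "\<dots> = (n choose a) * 4 ^ a" by (simp add: n_subsets)
    also have "\<dots> \<le> n ^ a * 4 ^ a"
    proof (cases "a \<le> n")
      case True
      then show ?thesis by (intro mult_right_mono binomial_le_pow) auto
    qed (simp add: binomial_eq_0)
    finally have "real (card {z\<in>S. card (fst z \<union> snd z) = a}) \<le> real (n ^ a * 4 ^ a)"
      by (rule of_nat_mono)
    then show "real (card {z\<in>S. card (fst z \<union> snd z) = a}) \<le> real n ^ a * 4 ^ a"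
      by simp
  qed
  finally show ?thesis .
qed

context concave_gap_function
begin

text \<open>The length \<sigma> with n^m * \<sigma>^(m - 1) = 1; its square is the reciprocal of the
  normalisation in the theorem. The maximum with 1 keeps it positive at n = 0.\<close>

definition scale :: "nat \<Rightarrow> real" where
  "scale n = real (max 1 n) powr (- (real m / (real m - 1)))"

lemma scale_pos: "scale n > 0"
  by (simp add: scale_def)

lemma power_scale_eq: "n \<ge> 1 \<Longrightarrow> real n ^ i * scale n ^ j = real n powr (real i - real j * (real m / (real m - 1)))"
  by (simp add: scale_def powr_realpow[symmetric] powr_powr powr_add[symmetric] powr_power mult_ac)

lemma power_scale_tendsto_0:
  assumes "i * (m - 1) < j * m"
  shows "(\<lambda>n. real n ^ i * scale n ^ j) \<longlonglongrightarrow> 0"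
proof -
  have "real i * (real m - 1) < real j * real m"
    using assms m by (metis of_nat_diff of_nat_less_iff of_nat_mult of_nat_1 Suc_1 Suc_leD One_nat_def)
  then have "real i - real j * (real m / (real m - 1)) < 0"
    using m by (simp add: field_simps)
  then have "(\<lambda>n. real n powr (real i - real j * (real m / (real m - 1)))) \<longlonglongrightarrow> 0"
    by (intro tendsto_neg_powr filterlim_real_sequentially)
  moreover have "eventually (\<lambda>n. real n powr (real i - real j * (real m / (real m - 1))) = real n ^ i * scale n ^ j) sequentially"
    using eventually_ge_at_top[of 1] by eventually_elim (simp add: power_scale_eq)
  ultimately show ?thesis by (rule Lim_transform_eventually)
qed

lemma scale_tendsto_0: "scale \<longlonglongrightarrow> 0"
  using power_scale_tendsto_0[of 0 1] m by simp

lemma power_scale_m: "n \<ge> 1 \<Longrightarrow> scale n ^ (m - 1) = 1 / real n ^ m"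
proof -
  assume n: "n \<ge> 1"
  have "real (m - 1) * (real m / (real m - 1)) = real m"
    using m by (simp add: of_nat_diff)
  then have "real n ^ m * scale n ^ (m - 1) = 1"
    using power_scale_eq[OF n, of m "m - 1"] n by (simp del: of_nat_diff)
  then show ?thesis using n by (simp add: field_simps)
qed

end

context random_polygon
begin

lemma cluster_bound_scale:
  "t \<ge> 0 \<Longrightarrow> \<sigma> > 0 \<Longrightarrow> cluster_bound (t * \<sigma>\<^sup>2) = cluster_bound t * \<sigma>"
  by (simp add: cluster_bound_def real_sqrt_mult real_sqrt_divide mult_ac)

lemma cluster_bound_nonneg: "t \<ge> 0 \<Longrightarrow> cluster_bound t \<ge> 0"
  using density_bound \<kappa> by (simp add: cluster_bound_def)

lemma prob_no_polygon_tendsto: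
  assumes t: "t > 0"
    and lim: "(\<lambda>n. enn2real (region_mass (t * (scale n)\<^sup>2)) / scale n ^ (m - 1)) \<longlonglongrightarrow> L"
  shows "(\<lambda>n. prob {\<omega>\<in>space M. \<forall>A. A \<subseteq> {1..n} \<and> card A = m \<longrightarrow> \<not> near_polygon (t * (scale n)\<^sup>2) (\<lambda>i. T i \<omega>) A})
           \<longlonglongrightarrow> exp (- (L / real m))"
proof -
  define s where "s n = t * (scale n)\<^sup>2" for n
  define I where "I n = {A. A \<subseteq> {1..n} \<and> card A = m}" for n :: nat
  define E where "E n = polygon_event (s n)" for n
  \<comment> \<open>Sets sharing an index form the neighbourhood; everything outside is independent
    of A.\<close>
  define N where "N n A = {B\<in>I n. A \<inter> B \<noteq> {}}" for n A
  define C where "C = cluster_bound t"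
  define \<Lambda> where "\<Lambda> n = (\<Sum>A\<in>I n. prob (E n A))" for n
  \<comment> \<open>The first sum bounds joint occurrence of distinct overlapping sets, grouped by
    the size a of the union. The second bounds the products of probabilities, where A = B is
    allowed, so a starts at m.\<close>
  define b where "b n = (\<Sum>a\<in>{m+1..2*m}. real n ^ a * 4 ^ a * (C * scale n) ^ (a - 1))
     + (\<Sum>a\<in>{m..2*m-1}. real n ^ a * 4 ^ a * (C * scale n) ^ (2 * (m - 1)))" for n
  have C: "C \<ge> 0" unfolding C_def using t by (intro cluster_bound_nonneg) auto
  have cb: "cluster_bound (s n) = C * scale n" for n
    unfolding s_def C_def using t by (intro cluster_bound_scale scale_pos) auto
  have I: "finite (I n)" "A \<in> I n \<Longrightarrow> A \<subseteq> {1..} \<and> finite A \<and> A \<noteq> {} \<and> card A = m" for n A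
    using m by (auto simp: I_def intro: finite_subset)
  have small: "eventually (\<lambda>n. 2 * real m * sqrt (s n / \<kappa>) \<le> \<mu>) sequentially"
  proof -
    have "(\<lambda>n. 2 * real m * sqrt (s n / \<kappa>)) \<longlonglongrightarrow> 2 * real m * sqrt (t * 0\<^sup>2 / \<kappa>)"
      unfolding s_def using \<kappa> by (intro tendsto_intros scale_tendsto_0) auto
    then have "eventually (\<lambda>n. 2 * real m * sqrt (s n / \<kappa>) < \<mu>) sequentially"
      using \<mu>_pos by (intro order_tendstoD(2)) auto
    then show ?thesis by eventually_elim simp
  qed
  have approx: "eventually (\<lambda>n. \<bar>prob {\<omega>\<in>space M. \<forall>A\<in>I n. \<omega> \<notin> E n A} - exp (- \<Lambda> n)\<bar> \<le> b n) sequentially"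
    using small
  proof eventually_elim
    case (elim n)
    have s0: "s n \<ge> 0" using t by (simp add: s_def)
    have cbn: "0 \<le> C * scale n" using C scale_pos[of n] by simp
    have pE: "prob (E n A) \<le> (C * scale n) ^ (m - 1)" if "A \<in> I n" for A
      using prob_polygon_events_overlap[of A A "s n"] I(2)[OF that] s0 elim by (simp add: E_def cb)
    have "\<bar>prob {\<omega>\<in>space M. \<forall>A\<in>I n. \<omega> \<notin> E n A} - exp (- \<Lambda> n)\<bar>
       \<le> (\<Sum>A\<in>I n. \<Sum>B\<in>N n A - {A}. prob (E n A \<inter> E n B)) + (\<Sum>A\<in>I n. \<Sum>B\<in>N n A. prob (E n A) * prob (E n B))"
      unfolding \<Lambda>_def
    proof (rule poisson_approximation_dissociated)
      fix A assume A: "A \<in> I n"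
      show "E n A \<in> events" unfolding E_def using I(2)[OF A] by (intro prob_polygon_event) auto
      show "A \<in> N n A \<and> N n A \<subseteq> I n" using A I(2)[OF A] by (auto simp: N_def)
      show "indep_var borel (indicator (E n A) :: 'a \<Rightarrow> real) borel (\<lambda>\<omega>. \<Sum>B\<in>I n - N n A. indicator (E n B) \<omega>)"
        unfolding E_def using I(2)[OF A] I(2) by (intro indep_polygon_events) (auto simp: N_def)
    qed (rule I(1))
    also have "(\<Sum>A\<in>I n. \<Sum>B\<in>N n A - {A}. prob (E n A \<inter> E n B))
        \<le> (\<Sum>A\<in>I n. \<Sum>B\<in>N n A - {A}. (C * scale n) ^ (card (A \<union> B) - 1))"
    proof (intro sum_mono)
      fix A B assume "A \<in> I n" "B \<in> N n A - {A}"
      then show "prob (E n A \<inter> E n B) \<le> (C * scale n) ^ (card (A \<union> B) - 1)"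
        using prob_polygon_events_overlap[of A B "s n"] I(2)[of A n] I(2)[of B n] s0 elim by (simp add: E_def cb N_def)
    qed
    also have "\<dots> = (\<Sum>(A, B)\<in>(SIGMA A:I n. N n A - {A}). (C * scale n) ^ (card (A \<union> B) - 1))"
      using I(1) by (intro sum.Sigma) (auto simp: N_def)
    also have "\<dots> \<le> (\<Sum>a\<in>{m+1..2*m}. real n ^ a * 4 ^ a * (C * scale n) ^ (a - 1))"
    proof (rule sum_pairs_by_union_card)
      fix A B assume AB: "(A, B) \<in> (SIGMA A:I n. N n A - {A})"
      then have *: "A \<in> I n" "B \<in> I n" "A \<noteq> B" by (auto simp: N_def)
      then have f: "finite A" "finite B" "card A = m" "card B = m" using I(2) by auto
      then have "card (A \<union> B) \<le> 2 * m" using card_Un_le[of A B] by simp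
      moreover have "card A < card (A \<union> B)"
      proof (rule psubset_card_mono)
        have "\<not> B \<subseteq> A" using f *(3) card_subset_eq by metis
        then show "A \<subset> A \<union> B" by auto
      qed (use f in auto)
      ultimately show "A \<subseteq> {1..n} \<and> B \<subseteq> {1..n} \<and> card (A \<union> B) \<in> {m+1..2*m}"
        using * f by (auto simp: I_def)
    qed (use cbn in auto)
    also have "(\<Sum>A\<in>I n. \<Sum>B\<in>N n A. prob (E n A) * prob (E n B))
        \<le> (\<Sum>A\<in>I n. \<Sum>B\<in>N n A. (C * scale n) ^ (2 * (m - 1)))"
    proof (intro sum_mono)
      fix A B assume "A \<in> I n" "B \<in> N n A"
      then have "prob (E n A) * prob (E n B) \<le> (C * scale n) ^ (m - 1) * (C * scale n) ^ (m - 1)"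
        using cbn by (intro mult_mono pE) (auto simp: N_def)
      then show "prob (E n A) * prob (E n B) \<le> (C * scale n) ^ (2 * (m - 1))"
        by (simp add: mult_2 power_add)
    qed
    also have "\<dots> = (\<Sum>(A, B)\<in>(SIGMA A:I n. N n A). (C * scale n) ^ (2 * (m - 1)))"
      using I(1) by (intro sum.Sigma) (auto simp: N_def)
    also have "\<dots> \<le> (\<Sum>a\<in>{m..2*m-1}. real n ^ a * 4 ^ a * (C * scale n) ^ (2 * (m - 1)))"
    proof (rule sum_pairs_by_union_card)
      fix A B assume AB: "(A, B) \<in> (SIGMA A:I n. N n A)"
      then have *: "A \<in> I n" "B \<in> I n" "A \<inter> B \<noteq> {}" by (auto simp: N_def)
      then have f: "finite A" "finite B" "card A = m" "card B = m" using I(2) by auto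
      have "card (A \<inter> B) \<ge> 1" using *(3) f by (simp add: Suc_le_eq card_gt_0_iff)
      then have "card (A \<union> B) \<le> 2 * m - 1" using card_Un_Int[of A B] f by simp
      moreover have "m \<le> card (A \<union> B)" using card_mono[of "A \<union> B" A] f by auto
      ultimately show "A \<subseteq> {1..n} \<and> B \<subseteq> {1..n} \<and> card (A \<union> B) \<in> {m..2*m-1}"
        using * by (auto simp: I_def)
    qed (use cbn in auto)
    finally show ?case by (simp add: b_def)
  qed
  have pw: "(\<lambda>n. real n ^ a * 4 ^ a * (C * scale n) ^ b) \<longlonglongrightarrow> 0" if "a * (m - 1) < b * m" for a b
    using tendsto_mult_left[OF power_scale_tendsto_0[OF that], of "4 ^ a * C ^ b"]
    by (simp add: power_mult_distrib mult_ac)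
  have b: "b \<longlonglongrightarrow> 0"
  proof -
    \<comment> \<open>The inequality amounts to m < a, which holds because distinct sets of size m
      have a larger union.\<close>
    have "a * (m - 1) < (a - 1) * m" if "a \<in> {m+1..2*m}" for a
    proof -
      have "a * (m - 1) = a * m - a" "(a - 1) * m = a * m - m" by (simp_all add: diff_mult_distrib2 diff_mult_distrib)
      moreover have "a * m - a < a * m - m"
        using that m by (intro diff_less_mono2) (auto intro: less_le_trans[of m a])
      ultimately show ?thesis by (simp only:)
    qed
    \<comment> \<open>Here it amounts to a < 2 * m, which holds because the two sets share a
      point.\<close>
    moreover have "a * (m - 1) < 2 * (m - 1) * m" if "a \<in> {m..2*m-1}" for a
    proof -
      have "a * (m - 1) < (2 * m) * (m - 1)" using that m by (intro mult_strict_right_mono) auto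
      then show ?thesis by (simp add: mult_ac)
    qed
    ultimately have "b \<longlonglongrightarrow> (\<Sum>a\<in>{m+1..2*m}. 0) + (\<Sum>a\<in>{m..2*m-1}. 0)"
      unfolding b_def by (intro tendsto_add tendsto_sum pw) auto
    then show ?thesis by simp
  qed
  have \<Lambda>: "\<Lambda> \<longlonglongrightarrow> L / real m"
  proof -
    have eq: "\<Lambda> n = (real (n choose m) / real n ^ m) * fact (m - 1) * (enn2real (region_mass (s n)) / scale n ^ (m - 1))"
      if "n \<ge> 1" for n
    proof -
      have "\<Lambda> n = (\<Sum>A\<in>I n. fact (m - 1) * enn2real (region_mass (s n)))"
        unfolding \<Lambda>_def E_def using I(2) by (intro sum.cong prob_polygon_event(2)) auto
      also have "\<dots> = real (n choose m) * (fact (m - 1) * enn2real (region_mass (s n)))"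
        by (simp add: I_def n_subsets)
      finally show ?thesis using power_scale_m[OF that] that by (simp add: field_simps)
    qed
    have binom: "(\<lambda>n. real (n choose m) / real n ^ m) \<longlonglongrightarrow> 1 / fact m"
    proof -
      \<comment> \<open>The known limit has denominator n^m for sample size m + n; the next factor
        corrects the denominator, and the offset is removed at the end.\<close>
      have "(\<lambda>n. real ((m + n) choose m) / real (n ^ m)) \<longlonglongrightarrow> 1 / fact m"
        using fact_binomial_limit[of m, where 'a = real] binomial_symmetric[of m "m + _"] by simp
      moreover have "(\<lambda>n. (real n / real (m + n)) ^ m) \<longlonglongrightarrow> 1 ^ m"
      proof (intro tendsto_power)
        have "(\<lambda>n. 1 / (1 + real m / real n)) \<longlonglongrightarrow> 1 / (1 + 0)"
          by (intro tendsto_intros lim_const_over_n) auto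
        moreover have "eventually (\<lambda>n. 1 / (1 + real m / real n) = real n / real (m + n)) sequentially"
          using eventually_gt_at_top[of 0] by eventually_elim (simp add: field_simps)
        ultimately show "(\<lambda>n. real n / real (m + n)) \<longlonglongrightarrow> 1"
          by (auto intro: Lim_transform_eventually)
      qed
      ultimately have *: "(\<lambda>n. real ((m + n) choose m) / real (n ^ m) * (real n / real (m + n)) ^ m) \<longlonglongrightarrow> 1 / fact m * 1 ^ m"
        by (rule tendsto_mult)
      have "eventually (\<lambda>n. real ((m + n) choose m) / real (n ^ m) * (real n / real (m + n)) ^ m
            = real ((n + m) choose m) / real (n + m) ^ m) sequentially"
        using eventually_gt_at_top[of 0] by eventually_elim (simp add: power_divide add.commute)
      from Lim_transform_eventually[OF * this]
      have "(\<lambda>n. real ((n + m) choose m) / real (n + m) ^ m) \<longlonglongrightarrow> 1 / fact m" by simp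
      then show ?thesis by (rule LIMSEQ_offset)
    qed
    have "(\<lambda>n. (real (n choose m) / real n ^ m) * fact (m - 1) * (enn2real (region_mass (s n)) / scale n ^ (m - 1)))
        \<longlonglongrightarrow> (1 / fact m) * fact (m - 1) * L"
      using lim unfolding s_def by (intro tendsto_mult binom tendsto_const)
    also have "(1 / fact m) * fact (m - 1) * L = L / real m"
      using m by (simp add: fact_reduce[of m])
    finally have lim': "(\<lambda>n. (real (n choose m) / real n ^ m) * fact (m - 1)
        * (enn2real (region_mass (s n)) / scale n ^ (m - 1))) \<longlonglongrightarrow> L / real m" .
    have "eventually (\<lambda>n. (real (n choose m) / real n ^ m) * fact (m - 1)
        * (enn2real (region_mass (s n)) / scale n ^ (m - 1)) = \<Lambda> n) sequentially"
      using eventually_ge_at_top[of 1] by eventually_elim (rule eq[symmetric])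
    with lim' show ?thesis by (rule Lim_transform_eventually)
  qed
  have "(\<lambda>n. prob {\<omega>\<in>space M. \<forall>A\<in>I n. \<omega> \<notin> E n A} - exp (- \<Lambda> n)) \<longlonglongrightarrow> 0"
    by (rule Lim_null_comparison[OF _ b]) (simp only: real_norm_def approx)
  then have "(\<lambda>n. (prob {\<omega>\<in>space M. \<forall>A\<in>I n. \<omega> \<notin> E n A} - exp (- \<Lambda> n)) + exp (- \<Lambda> n)) \<longlonglongrightarrow> 0 + exp (- (L / real m))"
    by (rule tendsto_add) (intro tendsto_exp tendsto_minus \<Lambda>)
  moreover have "{\<omega>\<in>space M. \<forall>A\<in>I n. \<omega> \<notin> E n A}
     = {\<omega>\<in>space M. \<forall>A. A \<subseteq> {1..n} \<and> card A = m \<longrightarrow> \<not> near_polygon (s n) (\<lambda>i. T i \<omega>) A}" for n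
    by (auto simp: I_def E_def polygon_event_def)
  ultimately show ?thesis by (simp add: s_def)
qed

end

lemma nn_integral_Ico_eq_integral:
  fixes f :: "real \<Rightarrow> real"
  assumes "continuous_on UNIV f" "\<And>x. 0 \<le> f x"
  shows "(\<integral>\<^sup>+x. ennreal (f x) * indicator {a..<b} x \<partial>lborel) = ennreal (integral {a..b} f)"
proof -
  have "(f has_integral integral {a..b} f) {a..b}"
    using assms(1) by (intro integrable_integral integrable_continuous_real) (rule continuous_on_subset, auto)
  then have "(\<integral>\<^sup>+x. ennreal (f x) * indicator {a..b} x \<partial>lborel) = ennreal (integral {a..b} f)"
    using assms(2) by (intro nn_integral_has_integral_lebesgue') auto
  moreover have "(\<integral>\<^sup>+x. ennreal (f x) * indicator {a..<b} x \<partial>lborel) = (\<integral>\<^sup>+x. ennreal (f x) * indicator {a..b} x \<partial>lborel)"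
  proof (rule nn_integral_cong_AE)
    show "AE x in lborel. ennreal (f x) * indicator {a..<b} x = ennreal (f x) * indicator {a..b} x"
      using AE_lborel_singleton[of b] by eventually_elim (auto simp: indicator_def)
  qed
  ultimately show ?thesis by simp
qed

lemma Arg2pi_measurable_circle [measurable]: "Arg2pi \<in> borel_measurable circle_measure"
proof -
  have "sets circle_measure = sets (restrict_space borel (sphere 0 1))"
    by (simp add: circle_measure_def)
  then have "borel_measurable circle_measure = borel_measurable (restrict_space borel (sphere 0 1))"
    by (intro measurable_cong_sets refl)
  then show ?thesis
    using measurable_restrict_space1[OF Arg2pi_measurable] by blast
qed

text \<open>\<open>circle_measure\<close> is the image of Lebesgue measure on [0, 2*pi) under
  \<open>cis\<close>, and \<open>Arg2pi\<close> inverts \<open>cis\<close> there.\<close>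

lemma distr_Arg2pi_eq_density:
  assumes D: "distributed M circle_measure V (\<lambda>z. ennreal (p (Arg2pi z)))"
    and p: "p \<in> borel_measurable borel"
  shows "distr M borel (\<lambda>\<omega>. Arg2pi (V \<omega>)) = density lborel (\<lambda>x. ennreal (p x) * indicator {0..<2*pi} x)"
proof -
  note [measurable] = p
  have V: "V \<in> M \<rightarrow>\<^sub>M circle_measure" using D by (rule distributed_measurable)
  have "distr M borel (\<lambda>\<omega>. Arg2pi (V \<omega>)) = distr (distr M circle_measure V) borel Arg2pi"
    using V by (subst distr_distr) (auto simp: comp_def)
  also have "\<dots> = distr (density circle_measure (\<lambda>z. ennreal (p (Arg2pi z)))) borel Arg2pi"
    using D by (simp add: distributed_distr_eq_density)
  also have "\<dots> = density lborel (\<lambda>x. ennreal (p x) * indicator {0..<2*pi} x)"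
  proof (rule measure_eqI)
    fix A assume "A \<in> sets (distr (density circle_measure (\<lambda>z. ennreal (p (Arg2pi z)))) borel Arg2pi)"
    then have A[measurable]: "A \<in> sets borel" by simp
    have "emeasure (distr (density circle_measure (\<lambda>z. ennreal (p (Arg2pi z)))) borel Arg2pi) A
        = (\<integral>\<^sup>+z. indicator A (Arg2pi z) \<partial>density circle_measure (\<lambda>z. ennreal (p (Arg2pi z))))"
      by (subst nn_integral_indicator[symmetric], simp, subst nn_integral_distr) auto
    also have "\<dots> = (\<integral>\<^sup>+z. ennreal (p (Arg2pi z)) * indicator A (Arg2pi z) \<partial>circle_measure)"
      by (rule nn_integral_density) measurable
    also have "\<dots> = (\<integral>\<^sup>+x. ennreal (p (Arg2pi (cis x))) * indicator A (Arg2pi (cis x)) \<partial>restrict_space lborel {0..<2*pi})"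
      unfolding circle_measure_def
    proof (rule nn_integral_distr[OF cis_measurable_circle])
      show "(\<lambda>z. ennreal (p (Arg2pi z)) * indicator A (Arg2pi z)) \<in> borel_measurable
          (distr (restrict_space lborel {0..<2*pi}) (restrict_space borel (sphere 0 1)) cis)"
        unfolding circle_measure_def[symmetric] by measurable
    qed
    also have "\<dots> = (\<integral>\<^sup>+x. ennreal (p x) * indicator A x \<partial>restrict_space lborel {0..<2*pi})"
      by (intro nn_integral_cong) (auto simp: space_restrict_space Arg2pi_cis)
    also have "\<dots> = (\<integral>\<^sup>+x. ennreal (p x) * indicator {0..<2*pi} x * indicator A x \<partial>lborel)"
      by (subst nn_integral_restrict_space) (auto simp: mult_ac)
    also have "\<dots> = emeasure (density lborel (\<lambda>x. ennreal (p x) * indicator {0..<2*pi} x)) A"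
      by (rule emeasure_density[symmetric]) auto
    finally show "emeasure (distr (density circle_measure (\<lambda>z. ennreal (p (Arg2pi z)))) borel Arg2pi) A
        = emeasure (density lborel (\<lambda>x. ennreal (p x) * indicator {0..<2*pi} x)) A" .
  qed simp
  finally show ?thesis .
qed

text \<open>
  Cutting \<open>g\<close> off outside the interval makes it Borel measurable and does not change the kernel.
\<close>

lemma concave_gap_function_exists:
  fixes g :: "real \<Rightarrow> real"
  assumes m: "m \<ge> 2"
    and g_cont: "continuous_on {0..2*pi} g"
    and g_concave: "strictly_concave_on {0..2*pi} g"
    and N: "2*pi / real m \<in> N" "C_k_on 3 g N"
    and g_second: "(deriv ^^ 2) g (2*pi / real m) \<noteq> 0"
  obtains \<kappa> where "concave_gap_function m (\<lambda>x. indicator {0..2*pi} x * g x) (2*pi / real m)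
      (deriv g (2*pi / real m)) (- (deriv ^^ 2) g (2*pi / real m) / 2) \<kappa>"
proof -
  define \<mu> where "\<mu> = 2*pi / real m"
  define a where "a = deriv g \<mu>"
  define c where "c = - (deriv ^^ 2) g \<mu> / 2"
  define G where "G x = indicator {0..2*pi} x * g x" for x
  have \<mu>: "0 < \<mu>" "\<mu> < 2*pi" using m by (auto simp: \<mu>_def divide_less_eq)
  have G: "G x = g x" if "x \<in> {0..2*pi}" for x using that by (simp add: G_def)
  have near: "eventually (\<lambda>h. \<mu> + h \<in> {0..2*pi}) (at 0)"
  proof -
    have "((\<lambda>h. \<mu> + h) \<longlongrightarrow> \<mu> + 0) (at 0)" by (intro tendsto_intros)
    then have "eventually (\<lambda>h. \<mu> + h \<in> {0<..<2*pi}) (at 0)"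
      using \<mu> by (intro topological_tendstoD) auto
    then show ?thesis by eventually_elim auto
  qed
  have lim: "((\<lambda>h. (g \<mu> + a * h - g (\<mu> + h)) / h\<^sup>2) \<longlongrightarrow> c) (at 0)"
    unfolding a_def c_def using N by (intro second_order_taylor_quotient[of g N]) (auto simp: \<mu>_def)
  have "g field_differentiable at \<mu>"
    using N unfolding C_k_on_def \<mu>_def[symmetric] by (auto dest: spec[of _ 0])
  then have der: "(g has_real_derivative a) (at \<mu>)"
    unfolding a_def by (rule field_differentiable_derivI)
  have below: "g x \<le> g \<mu> + a * (x - \<mu>)" if "x \<in> {0..2*pi}" for x
    using \<mu> by (intro concave_below_tangent[OF g_concave _ der that]) simp
  \<comment> \<open>The graph lies below its tangent, so the Taylor quotients are nonnegative near 0
    and so is their limit; the nonvanishing second derivative makes c positive.\<close>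
  have "c \<ge> 0"
  proof (rule tendsto_lowerbound[OF lim])
    show "eventually (\<lambda>h. 0 \<le> (g \<mu> + a * h - g (\<mu> + h)) / h\<^sup>2) (at 0)"
      using near
    proof eventually_elim
      case (elim h)
      then show ?case using below[of "\<mu> + h"] by simp
    qed
  qed simp
  moreover have "c \<noteq> 0" using g_second by (simp add: c_def \<mu>_def)
  ultimately have c: "c > 0" by simp
  obtain \<kappa> where \<kappa>: "\<kappa> > 0" "\<And>x. x \<in> {0..2*pi} \<Longrightarrow> \<kappa> * (x - \<mu>)\<^sup>2 \<le> g \<mu> + a * (x - \<mu>) - g x"
    using strictly_concave_quadratic_gap[OF g_concave \<mu> below lim c] by blast
  have "concave_gap_function m G \<mu> a c \<kappa>"
  proof
    show "G \<in> borel_measurable borel"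
      using borel_measurable_continuous_on_indicator[OF _ g_cont] by (simp add: G_def[abs_def])
    show "\<kappa> * (x - \<mu>)\<^sup>2 \<le> G \<mu> + a * (x - \<mu>) - G x" if "x \<in> {0..2*pi}" for x
      using \<kappa>(2)[OF that] G[OF that] G[of \<mu>] \<mu> by simp
    \<comment> \<open>\<mu> is interior to the interval, so the cut-off is invisible to the limit at
      \<mu>.\<close>
    have "eventually (\<lambda>h. (g \<mu> + a * h - g (\<mu> + h)) / h\<^sup>2 = (G \<mu> + a * h - G (\<mu> + h)) / h\<^sup>2) (at 0)"
      using near by eventually_elim (use G[of \<mu>] G \<mu> in auto)
    with lim show "((\<lambda>h. (G \<mu> + a * h - G (\<mu> + h)) / h\<^sup>2) \<longlongrightarrow> c) (at 0)"
      by (rule Lim_transform_eventually)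
  qed (use m c \<kappa>(1) \<mu>_def in auto)
  then show ?thesis
    using that[of \<kappa>] by (simp add: G_def[abs_def] \<mu>_def a_def c_def)
qed

context concave_gap_density
begin

lemma ellipsoid_volume_eq:
  assumes t: "t > 0"
  shows "ellipsoid_volume (t / c)
    = ennreal ((pi * t / c) powr ((real m - 1) / 2) / (Gamma ((real m + 1) / 2) * sqrt (real m)))"
proof -
  have "ellipsoid_volume (t / c) = ennreal (unit_ball_vol (real m - 1) * sqrt (t / c) ^ (m - 1) / sqrt m)"
    using emeasure_gap_energy_le[OF m, of "sqrt (t / c)"] t c by (simp add: ellipsoid_volume_def)
  moreover have "sqrt (t / c) ^ (m - 1) = (t / c) powr ((real m - 1) / 2)"
  proof -
    have "sqrt (t / c) ^ (m - 1) = sqrt (t / c) powr real (m - 1)"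
      using t c by (simp add: powr_realpow)
    also have "\<dots> = (t / c) powr ((real m - 1) / 2)"
      using t c m by (simp add: powr_half_sqrt[symmetric] powr_powr of_nat_diff)
    finally show ?thesis .
  qed
  moreover have "unit_ball_vol (real m - 1) = pi powr ((real m - 1) / 2) / Gamma ((real m + 1) / 2)"
  proof -
    have "(real m - 1) / 2 + 1 = (real m + 1) / 2" by (simp add: field_simps)
    then show ?thesis by (simp only: unit_ball_vol_def)
  qed
  moreover have "(pi * t / c) powr ((real m - 1) / 2) = pi powr ((real m - 1) / 2) * (t / c) powr ((real m - 1) / 2)"
    using t c by (simp add: powr_mult[symmetric])
  ultimately show ?thesis by simp
qed

lemma p_times_polygon_density:
  "p x * polygon_density x = (\<Prod>l=0..m-1. p (x + 2*pi * real l / real m))"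
proof -
  have "{0..m-1} = insert 0 {1..<m}" using m by auto
  then show ?thesis by (simp add: polygon_density_def) (simp add: \<mu> mult_ac)
qed

lemma continuous_on_vertex_product:
  "continuous_on S (\<lambda>x. \<Prod>l=0..m-1. p (x + 2*pi * real l / real m))"
  by (intro continuous_on_prod continuous_on_compose2[OF p_cont] continuous_intros) auto

lemma nn_integral_polygon_density:
  "(\<integral>\<^sup>+\<theta>. ennreal (p \<theta> * polygon_density \<theta>) * indicator {0..<2*pi} \<theta> \<partial>lborel)
    = ennreal (integral {0..2*pi} (\<lambda>x. \<Prod>l=0..m-1. p (x + 2*pi * real l / real m)))"
  unfolding p_times_polygon_density
  by (intro nn_integral_Ico_eq_integral continuous_on_vertex_product prod_nonneg p_nonneg)

end

context random_polygon
begin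

lemma region_mass_scale_tendsto:
  assumes t: "t > 0"
  shows "(\<lambda>n. enn2real (region_mass (t * (scale n)\<^sup>2)) / scale n ^ (m - 1)) \<longlonglongrightarrow>
     (pi * t / c) powr ((real m - 1) / 2) / (Gamma ((real m + 1) / 2) * sqrt (real m))
       * integral {0..2*pi} (\<lambda>x. \<Prod>l=0..m-1. p (x + 2*pi * real l / real m))" (is "_ \<longlonglongrightarrow> ?V * ?I")
proof -
  have I: "?I \<ge> 0" by (intro integral_nonneg integrable_continuous_real continuous_on_vertex_product prod_nonneg p_nonneg)
  have V: "?V \<ge> 0" using m by (auto intro!: divide_nonneg_nonneg mult_nonneg_nonneg Gamma_real_nonneg)
  have "(\<integral>\<^sup>+\<theta>. ennreal (p \<theta>) * indicator {0..<2*pi} \<theta> \<partial>lborel) < \<infinity>"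
    using nn_integral_Ico_eq_integral[OF p_cont p_nonneg] by simp
  from region_mass_tendsto[OF scale_tendsto_0 scale_pos t this]
  have "(\<lambda>n. region_mass (t * (scale n)\<^sup>2) / ennreal (scale n ^ (m - 1))) \<longlonglongrightarrow> ennreal (?V * ?I)"
    using V I by (simp add: ellipsoid_volume_eq[OF t] nn_integral_polygon_density ennreal_mult'[symmetric])
  \<comment> \<open>As the probability of a shape event the mass is finite, so the limit can be
    moved from extended to real numbers.\<close>
  moreover have "region_mass s < top" for s
  proof -
    have "emeasure M (shape_event s [1..<Suc m]) = region_mass s"
      by (rule emeasure_shape_event) auto
    then show ?thesis by (metis emeasure_finite infinity_ennreal_def less_top)
  qed
  then have "region_mass s / ennreal (scale n ^ (m - 1)) = ennreal (enn2real (region_mass s) / scale n ^ (m - 1))" for s n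
    using scale_pos[of n] by (simp add: divide_ennreal[symmetric])
  ultimately have "(\<lambda>n. ennreal (enn2real (region_mass (t * (scale n)\<^sup>2)) / scale n ^ (m - 1))) \<longlonglongrightarrow> ennreal (?V * ?I)"
    by simp
  then show ?thesis
    using V I scale_pos
    by (subst (asm) tendsto_ennreal_iff) (auto intro!: always_eventually divide_nonneg_nonneg simp: less_imp_le)
qed

end

theorem corollary5p1:
  fixes m :: nat
    and g p :: "real \<Rightarrow> real"
    and M :: "'a measure"
    and U :: "nat \<Rightarrow> 'a \<Rightarrow> complex"
    and t K :: real
  assumes m: "m \<ge> 2"
    and g_cont: "continuous_on {0..2*pi} g"
    and g_concave: "strictly_concave_on {0..2*pi} g"
    and g_C3: "\<exists>N. 2*pi / real m \<in> N \<and> N \<subseteq> {0..2*pi} \<and> C_k_on 3 g N"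
    and g_second: "(deriv ^^ 2) g (2*pi / real m) \<noteq> 0"
    and p_cont: "continuous_on UNIV p"
    and p_periodic: "\<And>x. p (x + 2*pi) = p x"
    and p_nonneg: "\<And>x. 0 \<le> p x"
    and p_integral: "integral {0..2*pi} p = 1"
    and prob: "prob_space M"
    and indep: "prob_space.indep_vars M (\<lambda>_. circle_measure) U {1..}"
    and density: "\<And>i. i \<ge> 1 \<Longrightarrow>
           distributed M circle_measure (U i) (\<lambda>z. ennreal (p (Arg2pi z)))"
    and p_pos: "integral {0..2*pi} (\<lambda>x. \<Prod>l=0..m-1. p (x + 2*pi * real l / real m)) > 0"
    and t: "t > 0"
    and K: "K = (2*pi) powr ((real m - 1) / 2)
                 * integral {0..2*pi} (\<lambda>x. \<Prod>l=0..m-1. p (x + 2*pi * real l / real m))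
               / ((- (deriv ^^ 2) g (2*pi / real m)) powr ((real m - 1) / 2)
                  * Gamma ((real m + 1) / 2) * sqrt (real m))"
  shows "(\<lambda>n. measure M {\<omega> \<in> space M.
             real n powr (2 * real m / (real m - 1))
               * (real m * g (2*pi / real m) - U_max (side_kernel g) m n (\<lambda>i. U i \<omega>)) \<le> t})
         \<longlonglongrightarrow> 1 - exp (- (t powr ((real m - 1) / 2) * K / real m))"
proof -
  define \<mu> where "\<mu> = 2*pi / real m"
  define c where "c = - (deriv ^^ 2) g \<mu> / 2"
  define G where "G x = indicator {0..2*pi} x * g x" for x
  obtain \<kappa> where conc: "concave_gap_function m G \<mu> (deriv g \<mu>) c \<kappa>"
    using concave_gap_function_exists[OF m g_cont g_concave _ _ g_second] g_C3
    by (auto simp: \<mu>_def c_def G_def[abs_def])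
  define T where "T i \<omega> = Arg2pi (U i \<omega>)" for i \<omega>
  interpret prob_space M by (rule prob)
  have p_meas: "p \<in> borel_measurable borel"
    using p_cont by (rule borel_measurable_continuous_onI)
  interpret D: concave_gap_density m G \<mu> "deriv g \<mu>" c \<kappa> p
    using conc p_cont p_periodic p_nonneg
    by (intro concave_gap_density.intro concave_gap_density_axioms.intro)
  interpret R: random_polygon M m G \<mu> "deriv g \<mu>" c \<kappa> p T
  proof
    show "indep_vars (\<lambda>_. borel) T {1..}"
      unfolding T_def[abs_def] using indep Arg2pi_measurable_circle by (rule indep_vars_compose2)
    show "distr M borel (T i) = D.angle_law" if "i \<ge> 1" for i
      unfolding T_def[abs_def] D.angle_law_def by (rule distr_Arg2pi_eq_density[OF density[OF that] p_meas])
  qed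
  have norm_U: "norm (U i \<omega>) = 1" if "\<omega> \<in> space M" "i \<ge> 1" for i \<omega>
  proof -
    have "U i \<in> M \<rightarrow>\<^sub>M circle_measure" using density[OF that(2)] by (rule distributed_measurable)
    from measurable_space[OF this that(1)] show ?thesis by simp
  qed
  define s where "s n = t * (D.scale n)\<^sup>2" for n
  define I where "I = integral {0..2*pi} (\<lambda>x. \<Prod>l=0..m-1. p (x + 2*pi * real l / real m))"
  define L where "L = (pi * t / c) powr ((real m - 1) / 2) / (Gamma ((real m + 1) / 2) * sqrt (real m)) * I"
  define NP where "NP n = {\<omega>\<in>space M. \<forall>A. A \<subseteq> {1..n} \<and> card A = m \<longrightarrow> \<not> D.near_polygon (s n) (\<lambda>i. T i \<omega>) A}" for n
  have L_eq: "L = t powr ((real m - 1) / 2) * K"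
  proof -
    define d where "d = - (deriv ^^ 2) g \<mu>"
    have d: "d > 0" using D.c by (simp add: c_def d_def)
    \<comment> \<open>Since c is half of - g'' at \<mu>, the pi of the ball volume becomes the 2*pi
      in K.\<close>
    have "pi * t / c = (2*pi) * t / d" by (simp add: c_def d_def)
    also have "\<dots> powr ((real m - 1) / 2)
        = (2*pi) powr ((real m - 1) / 2) * t powr ((real m - 1) / 2) / d powr ((real m - 1) / 2)"
      using t d by (simp add: powr_mult powr_divide)
    finally show ?thesis
      unfolding L_def K I_def[symmetric] \<mu>_def[symmetric] d_def[symmetric] by (simp add: mult_ac)
  qed
  have kernel: "side_kernel g = side_kernel G"
    by (intro ext side_kernel_cong) (simp add: G_def)
  have \<mu>01: "\<mu> \<in> {0..2*pi}" using m by (auto simp: \<mu>_def divide_le_eq)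
  have small: "eventually (\<lambda>n. sqrt (s n / \<kappa>) < \<mu>) sequentially"
  proof -
    have "(\<lambda>n. sqrt (s n / \<kappa>)) \<longlonglongrightarrow> sqrt (t * 0\<^sup>2 / \<kappa>)"
      unfolding s_def using D.\<kappa> by (intro tendsto_intros D.scale_tendsto_0) auto
    then show ?thesis using D.\<mu>_pos by (intro order_tendstoD(2)) auto
  qed
  have event: "eventually (\<lambda>n. measure M {\<omega> \<in> space M.
             real n powr (2 * real m / (real m - 1))
               * (real m * g \<mu> - U_max (side_kernel g) m n (\<lambda>i. U i \<omega>)) \<le> t} = 1 - prob (NP n)) sequentially"
    using small eventually_ge_at_top[of m]
  proof eventually_elim
    case (elim n)
    have n: "n \<ge> 1" using elim m by simp
    have "D.scale n = real n powr (- (real m / (real m - 1)))" using n by (simp add: D.scale_def)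
    then have "(D.scale n)\<^sup>2 = real n powr (- (2 * real m / (real m - 1)))"
      using n by (simp add: powr_power)
    then have s: "s n = t / real n powr (2 * real m / (real m - 1))"
      by (simp add: s_def powr_minus divide_inverse)
    have iff: "real n powr (2 * real m / (real m - 1)) * D \<le> t \<longleftrightarrow> D \<le> s n" for D
      using n by (simp add: s field_simps)
    have "{\<omega> \<in> space M. real n powr (2 * real m / (real m - 1))
               * (real m * g \<mu> - U_max (side_kernel g) m n (\<lambda>i. U i \<omega>)) \<le> t} = space M - NP n"
    proof -
      have "real m * g \<mu> - U_max (side_kernel G) m n (\<lambda>i. U i \<omega>) \<le> s n \<longleftrightarrow>
          (\<exists>A. A \<subseteq> {1..n} \<and> card A = m \<and> D.near_polygon (s n) (\<lambda>i. T i \<omega>) A)" if "\<omega> \<in> space M" for \<omega>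
        using D.U_max_le_iff[OF elim(2) norm_U[OF that] elim(1)] \<mu>01 by (simp add: G_def T_def)
      then show ?thesis unfolding iff kernel NP_def by blast
    qed
    moreover have "NP n \<in> events"
    proof -
      have "NP n = space M - (\<Union>A\<in>{A. A \<subseteq> {1..n} \<and> card A = m}. R.polygon_event (s n) A)"
        by (auto simp: NP_def R.polygon_event_def)
      also have "\<dots> \<in> events"
        by (intro sets.compl_sets sets.finite_UN R.prob_polygon_event) (auto intro: finite_subset)
      finally show ?thesis .
    qed
    ultimately show ?case by (simp add: prob_compl)
  qed
  have "(\<lambda>n. prob (NP n)) \<longlonglongrightarrow> exp (- (L / real m))"
    unfolding NP_def s_def using R.region_mass_scale_tendsto[OF t]
    by (intro R.prob_no_polygon_tendsto t) (simp add: L_def I_def)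
  then have "(\<lambda>n. 1 - prob (NP n)) \<longlonglongrightarrow> 1 - exp (- (L / real m))"
    by (intro tendsto_diff tendsto_const)
  then have "(\<lambda>n. measure M {\<omega> \<in> space M.
             real n powr (2 * real m / (real m - 1))
               * (real m * g \<mu> - U_max (side_kernel g) m n (\<lambda>i. U i \<omega>)) \<le> t}) \<longlonglongrightarrow> 1 - exp (- (L / real m))"
    by (rule Lim_transform_eventually) (use event in \<open>eventually_elim; simp\<close>)
  then show ?thesis by (simp add: L_eq \<mu>_def)
qed

end
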